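(* Let $\mu,\alpha,\beta>0$, and let $\{\varepsilon_n\}_{n\ge 1}$ be i.i.d. random variables on $(0,\infty)$ with density $f_\varepsilon>0$ on $(0,\infty)$ and finite mean $\mu_\varepsilon=\mathbb{E}[\varepsilon_1]<\infty$. Let $\{\Lambda_n\}_{n\ge 0}$ be the process on $\mathcal{X}=[\mu,\infty)$ with $$\Lambda_n=\mu+(\Lambda_{n-1}-\mu+\alpha)e^{-\beta\tau_n},\qquad \tau_n=\Phi^{-1}(\varepsilon_n,\Lambda_{n-1}),\qquad n\ge 1,$$ where $\Phi(t,x)=\mu t+(x-\mu+\alpha)\frac{1-e^{-\beta t}}{\beta}$ and the inverse is taken in $t$; the $\tau_n$ are called durations (inter-arrival times). Suppose the stability condition $\alpha<\beta\mu_\varepsilon$ holds. Then $\{\Lambda_n\}$ is a Lebesgue-irreducible, aperiodic, and positive Harris recurrent Markov chain on the state space $\mathcal{X}$. Specifically: 1. There exists a unique stationary distribution $\pi$. For any initial distribution, the law of $\Lambda_n$ converges to $\pi$ in total variation as $n\to\infty$. 2. The process is ergodic, ensuring that sample averages of the durations $\{\tau_n\}$ converge to their theoretical counterparts. 3. Under stationarity, the expected inter-arrival time is uniquely determined by the model parameters: $$\mathbb{E}[\tau_n]=\frac{\beta\mu_\varepsilon-\alpha}{\beta\mu}.$$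
   Context: For fixed $x\ge\mu$, $t\mapsto\Phi(t,x)$ is a strictly increasing bijection of $[0,\infty)$ onto itself, and $\Phi^{-1}(y,x)$ denotes its inverse, i.e. $\Phi(\Phi^{-1}(y,x),x)=y$. The initial state $\Lambda_0$ does not depend on the innovations $\{\varepsilon_n\}_{n\ge1}$. The transition kernel is $P(x,B)=\mathbb{P}\big(\mu+(x-\mu+\alpha)e^{-\beta\tau}\in B\big)$ with $\tau=\Phi^{-1}(\varepsilon,x)$, $\varepsilon$ distributed as $\varepsilon_1$, for $x\in\mathcal{X}$ and Borel $B\subseteq\mathcal{X}$; $P^n$ is the $n$-step kernel and, for an initial distribution $\nu$, $\nu P^n(A)=\int_{\mathcal{X}}P^n(x,A)\,\nu(dx)$ is the law of $\Lambda_n$. Convergence in total variation means $\sup_{A\in\mathcal{B}(\mathcal{X})}|\nu P^n(A)-\pi(A)|\to 0$. A stationary distribution is a probability measure $\pi$ on $\mathcal{X}$ with $\pi(B)=\int_{\mathcal{X}}P(x,B)\,\pi(dx)$ for all Borel $B$; "under stationarity" means $\Lambda_0\sim\pi$. Ergodic: regardless of the initial distribution $\nu$, the law of $\Lambda_n$ converges to the stationary distribution $\pi$ in total variation. Lebesgue-irreducible: for every $x\in\mathcal{X}$ and every Borel $B\subseteq\mathcal{X}$ of positive Lebesgue measure there is $n\ge1$ with $P^n(x,B)>0$. Aperiodic: for no $d\ge 2$ can $\mathcal{X}$ be decomposed into disjoint subsets $D_1,\dots,D_d$ with $P(x,D_{i+1})=1$ for all $x\in D_i$, $i=1,\dots,d$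 (indices mod $d$). Harris recurrent: for every Borel $A\subseteq\mathcal{X}$ of positive measure with respect to the maximal irreducibility measure (here Lebesgue measure on $\mathcal{X}$), $\mathbb{P}(\eta_A=\infty\mid\Lambda_0=x)=1$ for all $x\in A$, where $\eta_A$ is the number of visits of the chain to $A$. Positive Harris recurrent: Harris recurrent and admitting an invariant probability measure. *)

theory Defs
  imports "HOL-Probability.Probability"
begin

section \<open>Markov chains on a measurable space\<close>

text \<open>
  A transition kernel on a state space \<^term>\<open>S\<close> is a map \<^term>\<open>K\<close> with
  \<^prop>\<open>K \<in> S \<rightarrow>\<^sub>M prob_algebra S\<close>; the probability measures on \<^term>\<open>S\<close> are the elements of
  \<^term>\<open>space (prob_algebra S)\<close>.
\<close>

definition history :: "'a measure \<Rightarrow> 'b measure \<Rightarrow> (nat \<Rightarrow> 'a \<Rightarrow> 'b) \<Rightarrow> nat \<Rightarrow> 'a measure" where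
  "history M S X n =
     vimage_algebra (space M) (\<lambda>\<omega>. \<lambda>k\<in>{..n}. X k \<omega>) (\<Pi>\<^sub>M k\<in>{..n}. S)"

definition markov_chain ::
  "'a measure \<Rightarrow> 'b measure \<Rightarrow> ('b \<Rightarrow> 'b measure) \<Rightarrow> (nat \<Rightarrow> 'a \<Rightarrow> 'b) \<Rightarrow> bool" where
  "markov_chain M S K X \<longleftrightarrow>
     prob_space M \<and> K \<in> S \<rightarrow>\<^sub>M prob_algebra S \<and> (\<forall>n. X n \<in> M \<rightarrow>\<^sub>M S) \<and>
     (\<forall>n. \<forall>B\<in>sets S. AE \<omega> in M.
        real_cond_exp M (history M S X n) (indicator (X (Suc n) -` B \<inter> space M)) \<omega>
          = measure (K (X n \<omega>)) B)"

text \<open>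
  The n-step kernel. Binding an initial distribution $\nu$ to it gives the measure
  $A \mapsto \int K^n(x,A)\,\nu(dx)$.
\<close>

primrec nstep :: "'b measure \<Rightarrow> ('b \<Rightarrow> 'b measure) \<Rightarrow> nat \<Rightarrow> 'b \<Rightarrow> 'b measure" where
  "nstep S K 0 = return S"
| "nstep S K (Suc n) = (\<lambda>x. nstep S K n x \<bind> K)"

text \<open>
  The law on path space of the chain with kernel \<^term>\<open>K\<close> started at \<^term>\<open>x\<close>: the Ionescu-Tulcea
  measure in which coordinate \<^term>\<open>0::nat\<close> is \<^term>\<open>x\<close> and coordinate \<^term>\<open>Suc i\<close> is drawn from
  \<^term>\<open>K\<close> at coordinate \<^term>\<open>i\<close>.
\<close>

definition path_step ::
  "'b measure \<Rightarrow> ('b \<Rightarrow> 'b measure) \<Rightarrow> 'b \<Rightarrow> nat \<Rightarrow> (nat \<Rightarrow> 'b) \<Rightarrow> 'b measure" where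
  "path_step S K x i \<omega> = (case i of 0 \<Rightarrow> return S x | Suc j \<Rightarrow> K (\<omega> j))"

definition path_law :: "'b measure \<Rightarrow> ('b \<Rightarrow> 'b measure) \<Rightarrow> 'b \<Rightarrow> (nat \<Rightarrow> 'b) measure" where
  "path_law S K x =
     projective_family.lim UNIV (Ionescu_Tulcea.CI (path_step S K x) (\<lambda>_. S)) (\<lambda>_. S)"

lemma Ionescu_Tulcea_path_step:
  assumes K: "K \<in> S \<rightarrow>\<^sub>M prob_algebra S" and x: "x \<in> space S"
  shows "Ionescu_Tulcea (path_step S K x) (\<lambda>_. S)"
proof (rule Ionescu_Tulcea.intro)
  have K': "K \<in> S \<rightarrow>\<^sub>M subprob_algebra S"
    using K by (rule measurable_prob_algebraD)
  show "path_step S K x i \<in> PiM {0..<i} (\<lambda>_. S) \<rightarrow>\<^sub>M subprob_algebra S" for i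
  proof (cases i)
    case 0
    then show ?thesis
      using measurable_space[OF return_measurable x]
      by (auto simp: path_step_def[abs_def] intro!: measurable_const)
  next
    case (Suc j)
    have "(\<lambda>\<omega>. \<omega> j) \<in> PiM {0..<Suc j} (\<lambda>_. S) \<rightarrow>\<^sub>M S"
      by (rule measurable_component_singleton) simp
    from measurable_compose[OF this K'] Suc show ?thesis
      by (simp add: path_step_def[abs_def])
  qed
  show "prob_space (path_step S K x i \<omega>)" if "\<omega> \<in> space (PiM {0..<i} (\<lambda>_. S))" for i \<omega>
  proof (cases i)
    case 0
    then show ?thesis using x by (simp add: path_step_def prob_space_return)
  next
    case (Suc j)
    with that have "\<omega> j \<in> space S" by (auto simp: space_PiM PiE_iff)
    with measurable_space[OF K] have "K (\<omega> j) \<in> space (prob_algebra S)" by blast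
    with Suc show ?thesis by (simp add: path_step_def space_prob_algebra)
  qed
qed

definition stationary :: "'b measure \<Rightarrow> ('b \<Rightarrow> 'b measure) \<Rightarrow> 'b measure \<Rightarrow> bool" where
  "stationary S K \<pi> \<longleftrightarrow>
     \<pi> \<in> space (prob_algebra S) \<and>
     (\<forall>B\<in>sets S. emeasure \<pi> B = (\<integral>\<^sup>+x. emeasure (K x) B \<partial>\<pi>))"

definition tv_dist :: "'b measure \<Rightarrow> 'b measure \<Rightarrow> 'b measure \<Rightarrow> real" where
  "tv_dist S \<rho> \<pi> = (SUP A\<in>sets S. \<bar>measure \<rho> A - measure \<pi> A\<bar>)"

definition ergodic :: "'b measure \<Rightarrow> ('b \<Rightarrow> 'b measure) \<Rightarrow> 'b measure \<Rightarrow> bool" where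
  "ergodic S K \<pi> \<longleftrightarrow>
     stationary S K \<pi> \<and>
     (\<forall>\<nu>\<in>space (prob_algebra S). (\<lambda>n. tv_dist S (\<nu> \<bind> nstep S K n) \<pi>) \<longlonglongrightarrow> 0)"

definition aperiodic :: "'b measure \<Rightarrow> ('b \<Rightarrow> 'b measure) \<Rightarrow> bool" where
  "aperiodic S K \<longleftrightarrow>
     \<not> (\<exists>d\<ge>2. \<exists>D :: nat \<Rightarrow> 'b set.
          (\<forall>i<d. D i \<in> sets S) \<and> disjoint_family_on D {..<d} \<and> (\<Union>i<d. D i) = space S \<and>
          (\<forall>i<d. \<forall>x\<in>D i. measure (K x) (D (Suc i mod d)) = 1))"

definition lebesgue_irreducible :: "real measure \<Rightarrow> (real \<Rightarrow> real measure) \<Rightarrow> bool" where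
  "lebesgue_irreducible S K \<longleftrightarrow>
     (\<forall>x\<in>space S. \<forall>B\<in>sets S. emeasure lborel B > 0 \<longrightarrow> (\<exists>n\<ge>1. measure (nstep S K n x) B > 0))"

text \<open>
  Lebesgue measure takes the place of the maximal irreducibility measure, to which it is
  equivalent for the chain considered here.
\<close>

definition harris_recurrent :: "real measure \<Rightarrow> (real \<Rightarrow> real measure) \<Rightarrow> bool" where
  "harris_recurrent S K \<longleftrightarrow>
     (\<forall>A\<in>sets S. emeasure lborel A > 0 \<longrightarrow>
        (\<forall>x\<in>A. \<P>(\<omega> in path_law S K x. infinite {n. 1 \<le> n \<and> \<omega> n \<in> A}) = 1))"

definition positive_harris_recurrent :: "real measure \<Rightarrow> (real \<Rightarrow> real measure) \<Rightarrow> bool" where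
  "positive_harris_recurrent S K \<longleftrightarrow> harris_recurrent S K \<and> (\<exists>\<pi>. stationary S K \<pi>)"


section \<open>The intensity process at arrival times\<close>

definition state_space :: "real \<Rightarrow> real measure" where
  "state_space \<mu> = restrict_space borel {\<mu>..}"

definition Phi :: "real \<Rightarrow> real \<Rightarrow> real \<Rightarrow> real \<Rightarrow> real \<Rightarrow> real" where
  "Phi \<mu> \<alpha> \<beta> t x = \<mu> * t + (x - \<mu> + \<alpha>) * ((1 - exp (- \<beta> * t)) / \<beta>)"

definition Phi_inv :: "real \<Rightarrow> real \<Rightarrow> real \<Rightarrow> real \<Rightarrow> real \<Rightarrow> real" where
  "Phi_inv \<mu> \<alpha> \<beta> y x = the_inv_into {0..} (\<lambda>t. Phi \<mu> \<alpha> \<beta> t x) y"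

text \<open>The innovation enters as a random variable \<^term>\<open>e\<close> on a probability space \<^term>\<open>M\<close>.\<close>

definition intensity_kernel ::
  "real \<Rightarrow> real \<Rightarrow> real \<Rightarrow> 'a measure \<Rightarrow> ('a \<Rightarrow> real) \<Rightarrow> real \<Rightarrow> real measure" where
  "intensity_kernel \<mu> \<alpha> \<beta> M e x =
     distr M (state_space \<mu>)
       (\<lambda>\<omega>. \<mu> + (x - \<mu> + \<alpha>) * exp (- \<beta> * Phi_inv \<mu> \<alpha> \<beta> (e \<omega>) x))"

text \<open>
  The mean of $\Phi^{-1}(\varepsilon, \Lambda)$ for independent $\varepsilon \sim e$ and
  $\Lambda \sim \pi$.
\<close>

definition mean_duration ::
  "real \<Rightarrow> real \<Rightarrow> real \<Rightarrow> 'a measure \<Rightarrow> ('a \<Rightarrow> real) \<Rightarrow> real measure \<Rightarrow> real" where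
  "mean_duration \<mu> \<alpha> \<beta> M e \<pi> = (\<integral>x. (\<integral>\<omega>. Phi_inv \<mu> \<alpha> \<beta> (e \<omega>) x \<partial>M) \<partial>\<pi>)"

end

theory Submission
  imports Defs
begin

text \<open>
  Put \<open>pot w = (\<mu> ln w + w) / \<beta>\<close>. A step \<open>x \<mapsto> x'\<close> of the chain driven by the innovation \<open>y\<close> satisfies
  \<open>pot (x' - \<mu>) = pot (x - \<mu> + \<alpha>) - y\<close>, so the transition laws from two states are, up to a change of
  coordinate, translates of the law of the innovation. Translates of a law with positive density on
  the half-line overlap, uniformly for bounded translations, which gives a local Doeblin condition
  without any regularity of the density. The step also satisfies \<open>x' = x + \<alpha> - \<beta> y + \<beta> \<mu> \<tau>\<close> with
  \<open>\<tau> \<rightarrow> 0\<close> as \<open>x \<rightarrow> \<infinity>\<close>; increments are bounded above by \<open>\<alpha>\<close> and have negative mean for large \<open>x\<close> under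
  the stability condition, so \<open>exp (\<sigma> (x - \<mu>))\<close> is a geometric Lyapunov function for small \<open>\<sigma>\<close>. Harris'
  theorem in the form of Hairer and Mattingly then yields the stationary law and convergence in total
  variation. Summing the recursion expresses the durations through the innovations and the boundary
  terms, so their averages converge by the strong law of large numbers, and taking expectations
  under stationarity gives the mean duration.
\<close>

section \<open>The strong law of large numbers\<close>

text \<open>The innovation density is only positive and measurable, so a small set with a minorising
  measure cannot be read off from a lower bound on transition densities. What survives is a
  statement on pairs of states: in the coordinate \<open>pot\<close> their transition laws are
  translates of one law, and such translates share mass. The Hairer-Mattingly argument asks for just
  that, a bound on the distance of two transition laws. The Lyapunov function is exponential because
  a linear one would only lose a constant per step, whereas the contraction wants a factor below 1.
  Harris recurrence is deduced from ergodicity: the probability of never visiting a set is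
  subharmonic and vanishes on the set. Sample averages of durations are to converge from every
  initial law. The telescoped recursion reduces this to \<open>\<Lambda> n / n\<close> tending to 0,
  which follows pathwise from a comparison with a reflected walk whose increments are functions of
  the innovations alone; the strong law is thus applied to independent variables only.\<close>

text \<open>The maximum of the partial sums of the first \<open>n\<close> terms, the empty sum
  included. The recursion runs through the shifted sequence because Garsia's argument compares the
  maximum of a walk with that of its shift.\<close>

primrec walk_max :: "nat \<Rightarrow> (nat \<Rightarrow> real) \<Rightarrow> real" where
  "walk_max 0 w = 0"
| "walk_max (Suc n) w = max 0 (w 0 + walk_max n (\<lambda>i. w (Suc i)))"

lemma walk_max_nonneg: "0 \<le> walk_max n w"
  by (cases n) auto

lemma walk_max_le_Suc: "walk_max n w \<le> walk_max (Suc n) w"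
proof (induction n arbitrary: w)
  case (Suc n)
  then have "walk_max n (\<lambda>i. w (Suc i)) \<le> walk_max (Suc n) (\<lambda>i. w (Suc i))" .
  then have "w 0 + walk_max n (\<lambda>i. w (Suc i)) \<le> w 0 + walk_max (Suc n) (\<lambda>i. w (Suc i))" by simp
  then show ?case by (simp only: walk_max.simps(2)[of "n" w] walk_max.simps(2)[of "Suc n" w] max.mono order_refl)
qed simp

lemma sum_le_walk_max: "(\<Sum>i<n. w i) \<le> walk_max n w"
proof (induction n arbitrary: w)
  case (Suc n)
  have "(\<Sum>i<Suc n. w i) = w 0 + (\<Sum>i<n. w (Suc i))"
    by (rule sum.lessThan_Suc_shift)
  with Suc[of "\<lambda>i. w (Suc i)"] show ?case by simp
qed simp

lemma walk_max_le_sum_abs: "walk_max n w \<le> (\<Sum>i<n. \<bar>w i\<bar>)"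
proof (induction n arbitrary: w)
  case (Suc n)
  have "(\<Sum>i<Suc n. \<bar>w i\<bar>) = \<bar>w 0\<bar> + (\<Sum>i<n. \<bar>w (Suc i)\<bar>)"
    by (rule sum.lessThan_Suc_shift)
  moreover have "0 \<le> (\<Sum>i<n. \<bar>w (Suc i)\<bar>)" by (simp add: sum_nonneg)
  ultimately show ?case using Suc[of "\<lambda>i. w (Suc i)"] by simp
qed simp

lemma measurable_walk_max[measurable]:
  "walk_max n \<in> borel_measurable (Pi\<^sub>M UNIV (\<lambda>_. borel))"
proof (induction n)
  case (Suc n)
  have s: "(\<lambda>w i. w (Suc i)) \<in> Pi\<^sub>M UNIV (\<lambda>_. borel) \<rightarrow>\<^sub>M Pi\<^sub>M UNIV (\<lambda>_. borel::real measure)"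
    by (rule measurable_PiM_single') (auto simp: space_PiM)
  have "(\<lambda>w. max 0 (w 0 + walk_max n (\<lambda>i. w (Suc i)))) \<in> borel_measurable (Pi\<^sub>M UNIV (\<lambda>_. borel))"
    using measurable_compose[OF s Suc] by measurable
  then show ?case by simp
qed simp

lemma bdd_above_partial_sums_shift:
  fixes w :: "nat \<Rightarrow> real"
  shows "bdd_above (range (\<lambda>n. \<Sum>i<n. case_nat x w i)) \<longleftrightarrow> bdd_above (range (\<lambda>n. \<Sum>i<n. w i))"
proof -
  have eq: "(\<Sum>i<Suc n. case_nat x w i) = x + (\<Sum>i<n. w i)" for n
    by (subst sum.lessThan_Suc_shift) simp
  show ?thesis
  proof
    assume "bdd_above (range (\<lambda>n. \<Sum>i<n. case_nat x w i))"
    then obtain B where "\<And>n. (\<Sum>i<n. case_nat x w i) \<le> B" by (auto simp: bdd_above_def)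
    then have "(\<Sum>i<n. w i) \<le> B - x" for n using eq[of n] by (metis le_diff_eq add.commute)
    then show "bdd_above (range (\<lambda>n. \<Sum>i<n. w i))" by (auto simp: bdd_above_def)
  next
    assume "bdd_above (range (\<lambda>n. \<Sum>i<n. w i))"
    then obtain B where "\<And>n. (\<Sum>i<n. w i) \<le> B" by (auto simp: bdd_above_def)
    then have "(\<Sum>i<n. case_nat x w i) \<le> max 0 (x + B)" for n
      by (cases n) (simp_all add: eq le_max_iff_disj del: sum.lessThan_Suc)
    then show "bdd_above (range (\<lambda>n. \<Sum>i<n. case_nat x w i))" by (auto simp: bdd_above_def)
  qed
qed

text \<open>Integer bounds suffice, which turns the existential quantifier into a countable
  union.\<close>

lemma pred_bdd_above_range[measurable (raw)]:
  fixes f :: "nat \<Rightarrow> 'a \<Rightarrow> real"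
  assumes [measurable]: "\<And>n. f n \<in> borel_measurable M"
  shows "Measurable.pred M (\<lambda>x. bdd_above (range (\<lambda>n. f n x)))"
proof -
  have "bdd_above (range (\<lambda>n. f n x)) \<longleftrightarrow> (\<exists>k::nat. \<forall>n. f n x \<le> real k)" for x
  proof
    assume "bdd_above (range (\<lambda>n. f n x))"
    then obtain B where "\<And>n. f n x \<le> B" by (auto simp: bdd_above_def)
    moreover obtain k :: nat where "B \<le> real k" using real_arch_simple by blast
    ultimately show "\<exists>k::nat. \<forall>n. f n x \<le> real k" by (meson order_trans)
  qed (auto simp: bdd_above_def)
  then show ?thesis by simp
qed

lemma (in prob_space) distr_pair_snd:
  assumes "prob_space N"
  shows "distr (M \<Otimes>\<^sub>M N) N snd = N"
proof (rule measure_eqI)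
  interpret N: prob_space N by fact
  fix A assume A: "A \<in> sets (distr (M \<Otimes>\<^sub>M N) N snd)"
  then have "snd -` A \<inter> space (M \<Otimes>\<^sub>M N) = space M \<times> A"
    using sets.sets_into_space[of A N] by (auto simp: space_pair_measure)
  with A show "emeasure (distr (M \<Otimes>\<^sub>M N) N snd) A = emeasure N A"
    by (simp add: emeasure_distr N.emeasure_pair_measure_Times emeasure_space_1)
qed simp

text \<open>
  Garsia's maximal inequality, restricted to the event that the partial sums of the shifted sequence
  are unbounded. This event is shift invariant and independent of the first coordinate, so no
  zero-one law is needed.
\<close>
lemma AE_bdd_above_partial_sums:
  fixes L :: "real measure"
  assumes "prob_space L" and sets_L: "sets L = sets borel"
    and int: "integrable L (\<lambda>x. x)" and neg: "(\<integral>x. x \<partial>L) < 0"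
  shows "AE w in Pi\<^sub>M UNIV (\<lambda>_::nat. L). bdd_above (range (\<lambda>n. \<Sum>i<n. w i))"
proof -
  interpret L: prob_space L by fact
  interpret sequence_space L ..
  interpret Q: pair_prob_space L S ..
  note [measurable_cong] = sets_L
  have space_L[simp]: "space L = UNIV" using sets_eq_imp_space_eq[OF sets_L] by simp
  have sets_S[measurable_cong]: "sets S = sets (Pi\<^sub>M UNIV (\<lambda>_. borel))"
    by (intro sets_PiM_cong) (auto simp: sets_L)
  have [measurable]: "walk_max n \<in> borel_measurable S" for n
    using measurable_walk_max[of n] by (simp add: measurable_cong_sets[OF sets_S refl])
  have [measurable]: "(\<lambda>w. w i) \<in> borel_measurable S" for i
    by measurable
  define U where "U = {w \<in> space S. \<not> bdd_above (range (\<lambda>n. \<Sum>i<n. w i))}"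
  have U[measurable]: "U \<in> sets S" unfolding U_def by measurable
  let ?u = "\<lambda>w. indicator U w :: real"
  have coord: "integrable S (\<lambda>w. w i)" for i
  proof -
    have "distr S L (\<lambda>w. w i) = L" by (rule PiM_component) simp
    with int have "integrable (distr S L (\<lambda>w. w i)) (\<lambda>x. x)" by simp
    then show ?thesis by (rule integrable_distr[rotated]) measurable
  qed
  have wm: "integrable S (walk_max n)" for n
    by (rule Bochner_Integration.integrable_bound[of _ "\<lambda>w. \<Sum>i<n. \<bar>w i\<bar>"])
       (auto intro!: coord integrable_abs Bochner_Integration.integrable_sum
          simp: walk_max_nonneg walk_max_le_sum_abs sum_nonneg)
  have uwm: "integrable S (\<lambda>w. ?u w * walk_max n w)" for n
    by (rule Bochner_Integration.integrable_bound[OF wm[of n]]) (auto split: split_indicator)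
  \<comment> \<open>Prepending an independent coordinate reproduces the product law; this plays the
    part of the measure-preserving shift.\<close>
  have iter: "distr (L \<Otimes>\<^sub>M S) S (\<lambda>(s, \<omega>). case_nat s \<omega>) = S" by (rule PiM_iter)
  have Ucase: "case_nat x w \<in> U \<longleftrightarrow> w \<in> U" if "x \<in> space L" "w \<in> space S" for x w
    using that by (auto simp: U_def bdd_above_partial_sums_shift space_PiM split: nat.splits)
  have cm[measurable]: "(\<lambda>(s, w). case_nat s w) \<in> L \<Otimes>\<^sub>M S \<rightarrow>\<^sub>M S" by measurable
  have snd_S: "distr (L \<Otimes>\<^sub>M S) S snd = S" by (rule L.distr_pair_snd[OF P.prob_space_axioms])
  have fst_L: "distr (L \<Otimes>\<^sub>M S) L fst = L" by (rule P.distr_pair_fst)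
  have uwm2: "integrable (L \<Otimes>\<^sub>M S) (\<lambda>p. ?u (snd p) * walk_max n (snd p))"
    and euwm2: "(\<integral>p. ?u (snd p) * walk_max n (snd p) \<partial>(L \<Otimes>\<^sub>M S)) = (\<integral>w. ?u w * walk_max n w \<partial>S)" for n
  proof -
    have "integrable (distr (L \<Otimes>\<^sub>M S) S snd) (\<lambda>w. ?u w * walk_max n w)" using uwm[of n] by (simp add: snd_S)
    then show "integrable (L \<Otimes>\<^sub>M S) (\<lambda>p. ?u (snd p) * walk_max n (snd p))"
      by (rule integrable_distr[rotated]) measurable
    show "(\<integral>p. ?u (snd p) * walk_max n (snd p) \<partial>(L \<Otimes>\<^sub>M S)) = (\<integral>w. ?u w * walk_max n w \<partial>S)"
      using integral_distr[of snd "L \<Otimes>\<^sub>M S" S "\<lambda>w. ?u w * walk_max n w"] by (simp add: snd_S)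
  qed
  have step: "integrable (L \<Otimes>\<^sub>M S) (\<lambda>p. ?u (snd p) * max 0 (fst p + walk_max n (snd p)))"
    and estep: "(\<integral>p. ?u (snd p) * max 0 (fst p + walk_max n (snd p)) \<partial>(L \<Otimes>\<^sub>M S)) =
      (\<integral>w. ?u w * walk_max (Suc n) w \<partial>S)" for n
  proof -
    have eq: "?u (snd p) * max 0 (fst p + walk_max n (snd p)) =
        ?u ((\<lambda>(s, w). case_nat s w) p) * walk_max (Suc n) ((\<lambda>(s, w). case_nat s w) p)"
      if "p \<in> space (L \<Otimes>\<^sub>M S)" for p
      using that Ucase[of "fst p" "snd p"] by (auto simp: space_pair_measure split: split_indicator)
    have "integrable (distr (L \<Otimes>\<^sub>M S) S (\<lambda>(s, w). case_nat s w)) (\<lambda>w. ?u w * walk_max (Suc n) w)"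
      using uwm[of "Suc n"] by (simp only: iter)
    then have "integrable (L \<Otimes>\<^sub>M S) (\<lambda>p. ?u ((\<lambda>(s, w). case_nat s w) p) * walk_max (Suc n) ((\<lambda>(s, w). case_nat s w) p))"
      by (rule integrable_distr[rotated]) measurable
    then show "integrable (L \<Otimes>\<^sub>M S) (\<lambda>p. ?u (snd p) * max 0 (fst p + walk_max n (snd p)))"
      by (subst Bochner_Integration.integrable_cong[OF refl eq]) auto
    have "(\<integral>w. ?u w * walk_max (Suc n) w \<partial>S) =
       (\<integral>w. ?u w * walk_max (Suc n) w \<partial>(distr (L \<Otimes>\<^sub>M S) S (\<lambda>(s, w). case_nat s w)))"
      by (simp only: iter)
    also have "\<dots> = (\<integral>p. ?u ((\<lambda>(s, w). case_nat s w) p) * walk_max (Suc n) ((\<lambda>(s, w). case_nat s w) p) \<partial>(L \<Otimes>\<^sub>M S))"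
      by (rule integral_distr) (simp_all del: walk_max.simps)
    also have "\<dots> = (\<integral>p. ?u (snd p) * max 0 (fst p + walk_max n (snd p)) \<partial>(L \<Otimes>\<^sub>M S))"
      by (rule Bochner_Integration.integral_cong[OF refl eq[symmetric]])
    finally show "(\<integral>p. ?u (snd p) * max 0 (fst p + walk_max n (snd p)) \<partial>(L \<Otimes>\<^sub>M S)) =
      (\<integral>w. ?u w * walk_max (Suc n) w \<partial>S)" ..
  qed
  have fint: "integrable (L \<Otimes>\<^sub>M S) (\<lambda>p. fst p)"
  proof -
    have "integrable (distr (L \<Otimes>\<^sub>M S) L fst) (\<lambda>x. x)" using int by (simp add: fst_L)
    then show ?thesis by (rule integrable_distr[rotated]) measurable
  qed
  \<comment> \<open>Where \<open>x + walk_max n w\<close> is positive, its positive part exceeds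
    \<open>walk_max n w\<close> by exactly \<open>x\<close>; elsewhere the difference is at most 0.
    Hence, on \<open>U\<close>, the growth of the mean of the maximum is at most the mean of
    \<open>x\<close> over the former event, and that growth is nonnegative.\<close>
  let ?g = "\<lambda>n p. ?u (snd p) * (fst p * (if fst p + walk_max n (snd p) > 0 then 1 else 0))"
  have g_nonneg: "0 \<le> (\<integral>p. ?g n p \<partial>(L \<Otimes>\<^sub>M S))" for n
  proof -
    have "(\<integral>w. ?u w * walk_max n w \<partial>S) \<le> (\<integral>w. ?u w * walk_max (Suc n) w \<partial>S)"
      by (intro integral_mono uwm mult_left_mono walk_max_le_Suc) auto
    then have "0 \<le> (\<integral>p. ?u (snd p) * max 0 (fst p + walk_max n (snd p)) - ?u (snd p) * walk_max n (snd p) \<partial>(L \<Otimes>\<^sub>M S))"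
      by (subst Bochner_Integration.integral_diff[OF step uwm2]) (simp only: estep euwm2)
    also have "\<dots> \<le> (\<integral>p. ?g n p \<partial>(L \<Otimes>\<^sub>M S))"
    proof (intro integral_mono Bochner_Integration.integrable_diff step uwm2)
      show "integrable (L \<Otimes>\<^sub>M S) (?g n)"
        by (rule Bochner_Integration.integrable_bound[OF fint]) (auto split: split_indicator)
    qed (auto split: split_indicator simp: walk_max_nonneg)
    finally show ?thesis .
  qed
  have "(\<lambda>n. \<integral>p. ?g n p \<partial>(L \<Otimes>\<^sub>M S)) \<longlonglongrightarrow> (\<integral>p. ?u (snd p) * fst p \<partial>(L \<Otimes>\<^sub>M S))"
  proof (rule integral_dominated_convergence[where w="\<lambda>p. \<bar>fst p\<bar>"])
    show "integrable (L \<Otimes>\<^sub>M S) (\<lambda>p. \<bar>fst p\<bar>)" using fint by (rule integrable_abs)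
    show "AE p in L \<Otimes>\<^sub>M S. (\<lambda>n. ?g n p) \<longlonglongrightarrow> ?u (snd p) * fst p"
    proof (rule AE_I2)
      fix p assume p: "p \<in> space (L \<Otimes>\<^sub>M S)"
      show "(\<lambda>n. ?g n p) \<longlonglongrightarrow> ?u (snd p) * fst p"
      proof (cases "snd p \<in> U")
        case True
        \<comment> \<open>On \<open>U\<close> the maxima exceed every bound, so the restriction on
          the sign disappears in the limit.\<close>
        then have "\<not> (\<forall>n. (\<Sum>i<n. snd p i) \<le> - fst p)"
          by (auto simp: U_def bdd_above_def)
        then obtain n0 where n0: "(\<Sum>i<n0. snd p i) > - fst p" by (auto simp: not_le)
        have "fst p + walk_max n (snd p) > 0" if "n \<ge> n0" for n
        proof -
          have "walk_max n0 (snd p) \<le> walk_max n (snd p)"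
            by (rule lift_Suc_mono_le[where f="\<lambda>n. walk_max n (snd p)", OF _ that]) (rule walk_max_le_Suc)
          with sum_le_walk_max[of "snd p" n0] n0 show ?thesis by linarith
        qed
        then have "\<forall>\<^sub>F n in sequentially. ?u (snd p) * fst p = ?g n p"
          unfolding eventually_sequentially by (intro exI[of _ n0]) auto
        then show ?thesis by (rule Lim_transform_eventually[OF tendsto_const])
      qed simp
    qed
    show "AE p in L \<Otimes>\<^sub>M S. norm (?g n p) \<le> \<bar>fst p\<bar>" for n
      by (auto split: split_indicator)
  qed measurable
  then have "0 \<le> (\<integral>p. ?u (snd p) * fst p \<partial>(L \<Otimes>\<^sub>M S))"
    by (rule LIMSEQ_le_const) (use g_nonneg in auto)
  also have "\<dots> = (\<integral>x. \<integral>w. ?u w * x \<partial>S \<partial>L)"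
  proof -
    have "integrable (L \<Otimes>\<^sub>M S) (\<lambda>p. ?u (snd p) * fst p)"
      by (rule Bochner_Integration.integrable_bound[OF fint]) (auto split: split_indicator)
    then have "integrable (L \<Otimes>\<^sub>M S) (\<lambda>(x, w). ?u w * x)" by (simp add: case_prod_unfold)
    from Q.integral_fst[OF this] show ?thesis by (simp add: case_prod_unfold)
  qed
  \<comment> \<open>\<open>U\<close> was transported to the shifted sequence, which is independent
    of the first coordinate, so the integral factors. A negative mean then forces \<open>U\<close>
    to be null.\<close>
  also have "\<dots> = measure S U * (\<integral>x. x \<partial>L)"
    by simp
  finally have "measure S U = 0"
    using neg by (metis linorder_not_less measure_nonneg mult_pos_neg order_le_less)
  then have "AE w in S. w \<notin> U"
    by (subst AE_iff_measurable[OF U]) (auto simp: U_def P.emeasure_eq_measure)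
  then show ?thesis by (rule AE_mp) (auto simp: U_def)
qed

text \<open>The margins \<open>1 / (k + 1)\<close> make the means of
  \<open>X - m - 1 / (k + 1)\<close> and \<open>m - X - 1 / (k + 1)\<close> negative, so both
  families of partial sums are almost surely bounded above for all \<open>k\<close> at once.
  Dividing by \<open>n\<close> squeezes the average into every neighbourhood of the mean
  \<open>m\<close>.\<close>

lemma (in prob_space) strong_law_of_large_numbers:
  fixes X :: "nat \<Rightarrow> 'a \<Rightarrow> real"
  assumes indep: "indep_vars (\<lambda>_. borel) X UNIV"
    and ident: "\<And>n. distr M borel (X n) = distr M borel (X 0)"
    and int: "integrable M (X 0)"
  shows "AE \<omega> in M. (\<lambda>n. (\<Sum>i<n. X i \<omega>) / real n) \<longlonglongrightarrow> expectation (X 0)"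
proof -
  have X[measurable]: "X i \<in> borel_measurable M" for i
    using indep by (auto simp: indep_vars_def)
  have bdd: "AE \<omega> in M. bdd_above (range (\<lambda>n. \<Sum>i<n. h (X i \<omega>)))"
    if h[measurable]: "h \<in> borel_measurable borel" and hi: "integrable M (\<lambda>\<omega>. h (X 0 \<omega>))"
      and neg: "expectation (\<lambda>\<omega>. h (X 0 \<omega>)) < 0" for h :: "real \<Rightarrow> real"
  proof -
    let ?L = "distr M borel (\<lambda>\<omega>. h (X 0 \<omega>))"
    have ind: "indep_vars (\<lambda>_. borel) (\<lambda>i \<omega>. h (X i \<omega>)) UNIV"
      by (rule indep_vars_compose2[OF indep]) simp
    have same: "distr M borel (\<lambda>\<omega>. h (X i \<omega>)) = ?L" for i
    proof -
      have "distr M borel (\<lambda>\<omega>. h (X i \<omega>)) = distr (distr M borel (X i)) borel h" for i :: nat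
        by (subst distr_distr) (auto simp: comp_def)
      from this[of i] this[of 0] show ?thesis using ident[of i] by simp
    qed
    have D: "distr M (Pi\<^sub>M UNIV (\<lambda>_. borel)) (\<lambda>\<omega> i. h (X i \<omega>)) = Pi\<^sub>M UNIV (\<lambda>_. ?L)"
    proof -
      have "distr M (Pi\<^sub>M UNIV (\<lambda>_. borel)) (\<lambda>\<omega>. \<lambda>i\<in>UNIV. h (X i \<omega>)) =
          Pi\<^sub>M UNIV (\<lambda>i. distr M borel (\<lambda>\<omega>. h (X i \<omega>)))"
        using ind by (subst (asm) indep_vars_iff_distr_eq_PiM) auto
      also have "(\<lambda>i. distr M borel (\<lambda>\<omega>. h (X i \<omega>))) = (\<lambda>_. ?L)"
        using same by (intro ext)
      finally show ?thesis by (simp add: restrict_UNIV)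
    qed
    have "AE w in Pi\<^sub>M UNIV (\<lambda>_::nat. ?L). bdd_above (range (\<lambda>n. \<Sum>i<n. w i))"
    proof (rule AE_bdd_above_partial_sums)
      show "prob_space ?L" by (rule prob_space_distr) simp
      show "integrable ?L (\<lambda>x. x)" using hi by (simp add: integrable_distr_eq)
      show "(\<integral>x. x \<partial>?L) < 0" using neg by (simp add: integral_distr)
    qed simp
    then show ?thesis
      unfolding D[symmetric]
    proof (subst (asm) AE_distr_iff)
      show "(\<lambda>\<omega> i. h (X i \<omega>)) \<in> M \<rightarrow>\<^sub>M Pi\<^sub>M UNIV (\<lambda>_. borel)"
        by (rule measurable_PiM_single') auto
      have [measurable]: "(\<lambda>w. w i :: real) \<in> borel_measurable (Pi\<^sub>M UNIV (\<lambda>_. borel))" for i :: nat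
        by simp
      show "{w \<in> space (Pi\<^sub>M UNIV (\<lambda>_. borel)). bdd_above (range (\<lambda>n::nat. \<Sum>i<n. w i :: real))}
          \<in> sets (Pi\<^sub>M UNIV (\<lambda>_. borel))"
        by measurable
    qed
  qed
  let ?m = "expectation (X 0)"
  have up: "AE \<omega> in M. \<forall>k. bdd_above (range (\<lambda>n. \<Sum>i<n. (X i \<omega> - ?m - inverse (real (Suc k)))))"
    unfolding AE_all_countable
    using int by (intro allI bdd) (auto simp: prob_space)
  have lo: "AE \<omega> in M. \<forall>k. bdd_above (range (\<lambda>n. \<Sum>i<n. (?m - X i \<omega> - inverse (real (Suc k)))))"
    unfolding AE_all_countable
    using int by (intro allI bdd) (auto simp: prob_space)
  show ?thesis
    using up lo
  proof eventually_elim
    case (elim \<omega>)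
    show ?case
    proof (rule LIMSEQ_I)
      fix r :: real assume "0 < r"
      then obtain k where k: "inverse (real (Suc k)) < r / 2"
        using reals_Archimedean[of "r / 2"] by auto
      obtain B1 where B1: "\<And>n. (\<Sum>i<n. (X i \<omega> - ?m - inverse (real (Suc k)))) \<le> B1"
        using elim(1)[rule_format, of k] by (auto simp: bdd_above_def)
      obtain B2 where B2: "\<And>n. (\<Sum>i<n. (?m - X i \<omega> - inverse (real (Suc k)))) \<le> B2"
        using elim(2)[rule_format, of k] by (auto simp: bdd_above_def)
      define B where "B = max B1 B2"
      have B: "0 \<le> B" using B1[of 0] by (simp add: B_def)
      obtain N :: nat where N: "2 * B / r < real N" using reals_Archimedean2 by blast
      have "norm ((\<Sum>i<n. X i \<omega>) / real n - ?m) < r" if n: "n \<ge> Suc N" for n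
      proof -
        have n0: "real n > 0" using n by simp
        have "2 * B / r < real n" using N n by linarith
        then have "B < real n * (r / 2)" using \<open>0 < r\<close> by (simp add: field_simps)
        moreover have "real n * inverse (real (Suc k)) < real n * (r / 2)"
          by (rule mult_strict_left_mono[OF k n0])
        moreover have "\<bar>(\<Sum>i<n. X i \<omega>) - real n * ?m\<bar> \<le> B + real n * inverse (real (Suc k))"
          using B1[of n] B2[of n] by (simp add: sum_subtractf B_def abs_le_iff) linarith
        ultimately have "\<bar>(\<Sum>i<n. X i \<omega>) - real n * ?m\<bar> < real n * r" by linarith
        moreover have "(\<Sum>i<n. X i \<omega>) / real n - ?m = ((\<Sum>i<n. X i \<omega>) - real n * ?m) / real n"
          using n0 by (simp add: field_simps)
        ultimately show ?thesis using n0 by (simp add: abs_divide pos_divide_less_eq mult.commute)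
      qed
      then show "\<exists>no. \<forall>n\<ge>no. norm ((\<Sum>i<n. X i \<omega>) / real n - ?m) < r" by blast
    qed
  qed
qed

section \<open>Harris' theorem\<close>

lemma prob_algebraD:
  assumes "\<nu> \<in> space (prob_algebra S)"
  shows "prob_space \<nu>" "sets \<nu> = sets S" "space \<nu> = space S"
  using assms by (auto simp: space_prob_algebra dest: sets_eq_imp_space_eq)

lemma prob_algebra_integrable:
  fixes \<phi> :: "'b \<Rightarrow> real"
  assumes \<nu>: "\<nu> \<in> space (prob_algebra S)" and \<phi>: "\<phi> \<in> borel_measurable S"
    and B: "\<And>x. x \<in> space S \<Longrightarrow> \<bar>\<phi> x\<bar> \<le> B"
  shows "integrable \<nu> \<phi>" and "\<bar>integral\<^sup>L \<nu> \<phi>\<bar> \<le> B"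
proof -
  interpret prob_space \<nu> by (rule prob_algebraD[OF \<nu>])
  have [measurable]: "\<phi> \<in> borel_measurable \<nu>"
    using \<phi> by (simp add: measurable_cong_sets[OF prob_algebraD(2)[OF \<nu>] refl])
  show i: "integrable \<nu> \<phi>"
    by (rule integrable_const_bound[where B=B]) (use B prob_algebraD(3)[OF \<nu>] in auto)
  have "\<bar>integral\<^sup>L \<nu> \<phi>\<bar> \<le> (\<integral>x. \<bar>\<phi> x\<bar> \<partial>\<nu>)" by (rule integral_abs_bound)
  also have "\<dots> \<le> (\<integral>x. B \<partial>\<nu>)"
    using i B prob_algebraD(3)[OF \<nu>] by (intro integral_mono integrable_abs) auto
  finally show "\<bar>integral\<^sup>L \<nu> \<phi>\<bar> \<le> B" by (simp add: prob_space)
qed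

lemma prob_algebra_integral_bind:
  fixes \<phi> :: "'b \<Rightarrow> real"
  assumes \<nu>: "\<nu> \<in> space (prob_algebra S)" and \<kappa>: "\<kappa> \<in> S \<rightarrow>\<^sub>M prob_algebra S"
    and \<phi>: "\<phi> \<in> borel_measurable S" and B: "\<And>x. x \<in> space S \<Longrightarrow> \<bar>\<phi> x\<bar> \<le> B"
  shows "integral\<^sup>L (\<nu> \<bind> \<kappa>) \<phi> = (\<integral>x. integral\<^sup>L (\<kappa> x) \<phi> \<partial>\<nu>)"
proof (rule integral_bind[where K=S and B=B and B'=1])
  interpret prob_space \<nu> by (rule prob_algebraD[OF \<nu>])
  show "finite_measure \<nu>" by unfold_locales
  show "\<kappa> \<in> \<nu> \<rightarrow>\<^sub>M subprob_algebra S"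
    using measurable_prob_algebraD[OF \<kappa>]
    by (simp add: measurable_cong_sets[OF prob_algebraD(2)[OF \<nu>] refl])
  show "AE x in \<nu>. emeasure (\<kappa> x) (space (\<kappa> x)) \<le> ennreal 1"
    using measurable_space[OF \<kappa>] prob_algebraD(3)[OF \<nu>]
    by (auto simp: prob_space.emeasure_space_1 space_prob_algebra)
qed (use \<phi> B in auto)

lemma prob_algebra_nn_integral_bind:
  assumes \<nu>: "\<nu> \<in> space (prob_algebra S)" and \<kappa>: "\<kappa> \<in> S \<rightarrow>\<^sub>M prob_algebra S"
    and \<phi>: "\<phi> \<in> borel_measurable S"
  shows "(\<integral>\<^sup>+x. \<phi> x \<partial>(\<nu> \<bind> \<kappa>)) = (\<integral>\<^sup>+x. \<integral>\<^sup>+y. \<phi> y \<partial>\<kappa> x \<partial>\<nu>)"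
  using measurable_prob_algebraD[OF \<kappa>] \<phi>
  by (intro nn_integral_bind) (simp_all add: measurable_cong_sets[OF prob_algebraD(2)[OF \<nu>] refl])

lemma prob_algebra_bind:
  assumes "\<nu> \<in> space (prob_algebra S)" and "\<kappa> \<in> S \<rightarrow>\<^sub>M prob_algebra S"
  shows "\<nu> \<bind> \<kappa> \<in> space (prob_algebra S)"
  using prob_space_bind'[OF assms] sets_bind'[OF assms] by (simp add: space_prob_algebra)

lemma prob_algebra_measure_bind:
  assumes \<nu>: "\<nu> \<in> space (prob_algebra S)" and \<kappa>: "\<kappa> \<in> S \<rightarrow>\<^sub>M prob_algebra S" and A: "A \<in> sets S"
  shows "measure (\<nu> \<bind> \<kappa>) A = (\<integral>x. measure (\<kappa> x) A \<partial>\<nu>)"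
  using measurable_prob_algebraD[OF \<kappa>] A
  by (intro subprob_space.measure_bind prob_space_imp_subprob_space prob_algebraD[OF \<nu>])
     (simp_all add: measurable_cong_sets[OF prob_algebraD(2)[OF \<nu>] refl])

lemma kernel_measure_measurable:
  assumes "\<kappa> \<in> S \<rightarrow>\<^sub>M prob_algebra S" "A \<in> sets S"
  shows "(\<lambda>y. measure (\<kappa> y) A) \<in> borel_measurable S"
  by (rule measurable_compose[OF assms(1) measurable_measure_prob_algebra[OF assms(2)]])

lemma kernel_measure_integrable:
  assumes \<nu>: "\<nu> \<in> space (prob_algebra S)" and \<kappa>: "\<kappa> \<in> S \<rightarrow>\<^sub>M prob_algebra S" and A: "A \<in> sets S"
  shows "integrable \<nu> (\<lambda>y. measure (\<kappa> y) A)"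
  by (rule prob_algebra_integrable(1)[OF \<nu> kernel_measure_measurable[OF \<kappa> A], where B=1])
     (use prob_space.prob_le_1[OF prob_algebraD(1)[OF measurable_space[OF \<kappa>]]] in simp)

lemma measure_diff_le_1:
  assumes "\<rho> \<in> space (prob_algebra S)" "\<pi> \<in> space (prob_algebra S)"
  shows "\<bar>measure \<rho> A - measure \<pi> A\<bar> \<le> 1"
  using prob_space.prob_le_1[OF prob_algebraD(1)[OF assms(1)], of A]
    prob_space.prob_le_1[OF prob_algebraD(1)[OF assms(2)], of A]
    measure_nonneg[of \<rho> A] measure_nonneg[of \<pi> A] by linarith

lemma measure_diff_le_tv_dist:
  assumes "\<rho> \<in> space (prob_algebra S)" "\<pi> \<in> space (prob_algebra S)" "A \<in> sets S"
  shows "\<bar>measure \<rho> A - measure \<pi> A\<bar> \<le> tv_dist S \<rho> \<pi>"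
  unfolding tv_dist_def
  by (rule cSUP_upper[OF assms(3)])
     (use measure_diff_le_1[OF assms(1,2)] in \<open>auto simp: bdd_above_def\<close>)

lemma tv_dist_le:
  "(\<And>A. A \<in> sets S \<Longrightarrow> \<bar>measure \<rho> A - measure \<pi> A\<bar> \<le> d) \<Longrightarrow> tv_dist S \<rho> \<pi> \<le> d"
  unfolding tv_dist_def by (rule cSUP_least) auto

lemma tv_dist_nonneg:
  assumes "\<rho> \<in> space (prob_algebra S)" "\<pi> \<in> space (prob_algebra S)"
  shows "0 \<le> tv_dist S \<rho> \<pi>"
  using measure_diff_le_tv_dist[OF assms sets.empty_sets] by simp

lemma sum_indicator_levels:
  fixes u :: real
  assumes "0 \<le> u" "u \<le> 1"
  shows "(\<Sum>k\<in>{1..N}. if real k \<le> real N * u then 1 else 0) = real (nat \<lfloor>real N * u\<rfloor>)"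
proof -
  have "k \<le> nat \<lfloor>real N * u\<rfloor> \<longleftrightarrow> real k \<le> real N * u" for k
    using assms by (simp add: le_nat_iff le_floor_iff)
  moreover have "real k \<le> real N" if "real k \<le> real N * u" for k
    using that assms mult_left_mono[of u 1 "real N"] by linarith
  ultimately have "{k \<in> {1..N}. real k \<le> real N * u} = {1..nat \<lfloor>real N * u\<rfloor>}"
    by auto
  then show ?thesis by (simp add: sum.inter_filter[symmetric])
qed

text \<open>Layer cake: \<open>N * \<phi>\<close> differs by at most 1 from the sum of the
  indicators of \<open>N\<close> superlevel sets, and on each of these the two measures differ by at
  most \<open>d\<close>. Dividing by \<open>N\<close> and letting it grow preserves the constant
  \<open>d\<close>.\<close>

lemma abs_integral_diff_le:
  fixes \<phi> :: "'b \<Rightarrow> real"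
  assumes \<rho>: "\<rho> \<in> space (prob_algebra S)" and \<pi>: "\<pi> \<in> space (prob_algebra S)"
    and \<phi>[measurable]: "\<phi> \<in> borel_measurable S"
    and bnd: "\<And>x. x \<in> space S \<Longrightarrow> 0 \<le> \<phi> x \<and> \<phi> x \<le> 1"
    and d: "\<And>A. A \<in> sets S \<Longrightarrow> \<bar>measure \<rho> A - measure \<pi> A\<bar> \<le> d"
  shows "\<bar>integral\<^sup>L \<rho> \<phi> - integral\<^sup>L \<pi> \<phi>\<bar> \<le> d"
proof (rule field_le_epsilon)
  fix e :: real assume "0 < e"
  then obtain n where n: "inverse (real (Suc n)) < e" using reals_Archimedean by blast
  define N where "N = Suc n"
  have N: "real N > 0" "1 / real N < e" using n by (auto simp: N_def inverse_eq_divide)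
  define A where "A k = {x \<in> space S. real k \<le> real N * \<phi> x}" for k
  have A[measurable]: "A k \<in> sets S" for k unfolding A_def by measurable
  define s where "s x = (\<Sum>k\<in>{1..N}. indicator (A k) x :: real)" for x
  have sx: "s x \<le> real N * \<phi> x" "real N * \<phi> x \<le> s x + 1" if "x \<in> space S" for x
  proof -
    have "s x = real (nat \<lfloor>real N * \<phi> x\<rfloor>)"
      using that bnd[OF that] unfolding s_def
      by (subst sum_indicator_levels[symmetric]) (auto intro!: sum.cong simp: A_def)
    then show "s x \<le> real N * \<phi> x" "real N * \<phi> x \<le> s x + 1"
      using bnd[OF that] by (simp_all add: of_nat_nat)
  qed
  have key: "integrable \<nu> \<phi> \<and> (\<Sum>k\<in>{1..N}. measure \<nu> (A k)) \<le> real N * integral\<^sup>L \<nu> \<phi> \<and>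
      real N * integral\<^sup>L \<nu> \<phi> \<le> (\<Sum>k\<in>{1..N}. measure \<nu> (A k)) + 1"
    if \<nu>: "\<nu> \<in> space (prob_algebra S)" for \<nu>
  proof -
    interpret prob_space \<nu> by (rule prob_algebraD[OF \<nu>])
    have A'[measurable]: "A k \<in> sets \<nu>" for k using A prob_algebraD(2)[OF \<nu>] by simp
    have i\<phi>: "integrable \<nu> \<phi>"
      by (rule prob_algebra_integrable(1)[OF \<nu> \<phi>, where B=1]) (use bnd in force)
    have "integrable \<nu> (indicator (A k) :: _ \<Rightarrow> real)" for k
      by (rule integrable_real_indicator[OF A']) (simp add: less_top[symmetric])
    then have is': "integrable \<nu> s" "integral\<^sup>L \<nu> s = (\<Sum>k\<in>{1..N}. measure \<nu> (A k))"
      unfolding s_def by (simp_all add: Bochner_Integration.integral_sum)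
    have "integral\<^sup>L \<nu> s \<le> (\<integral>x. real N * \<phi> x \<partial>\<nu>)"
      using is' i\<phi> sx prob_algebraD(3)[OF \<nu>] by (intro integral_mono) auto
    moreover have "(\<integral>x. real N * \<phi> x \<partial>\<nu>) \<le> (\<integral>x. s x + 1 \<partial>\<nu>)"
      using is' i\<phi> sx prob_algebraD(3)[OF \<nu>] by (intro integral_mono) auto
    ultimately show ?thesis using i\<phi> is' by (simp add: prob_space)
  qed
  have "\<bar>(\<Sum>k\<in>{1..N}. measure \<rho> (A k)) - (\<Sum>k\<in>{1..N}. measure \<pi> (A k))\<bar> \<le> (\<Sum>k\<in>{1..N}. d)"
    unfolding sum_subtractf[symmetric]
    by (rule order_trans[OF sum_abs]) (intro sum_mono d A)
  then have "\<bar>real N * integral\<^sup>L \<rho> \<phi> - real N * integral\<^sup>L \<pi> \<phi>\<bar> \<le> real N * d + 1"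
    using key[OF \<rho>] key[OF \<pi>] by (simp add: abs_le_iff)
  also have "\<bar>real N * integral\<^sup>L \<rho> \<phi> - real N * integral\<^sup>L \<pi> \<phi>\<bar> =
      real N * \<bar>integral\<^sup>L \<rho> \<phi> - integral\<^sup>L \<pi> \<phi>\<bar>"
    by (simp add: right_diff_distrib[symmetric] abs_mult)
  finally have "\<bar>integral\<^sup>L \<rho> \<phi> - integral\<^sup>L \<pi> \<phi>\<bar> \<le> d + 1 / real N"
    using N(1) by (simp add: field_simps)
  then show "\<bar>integral\<^sup>L \<rho> \<phi> - integral\<^sup>L \<pi> \<phi>\<bar> \<le> d + e" using N(2) by linarith
qed

section \<open>Iterates of a kernel and invariant laws\<close>

locale markov_kernel =
  fixes S :: "'b measure" and K :: "'b \<Rightarrow> 'b measure"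
  assumes kernel[measurable]: "K \<in> S \<rightarrow>\<^sub>M prob_algebra S"
begin

lemma K_prob: "x \<in> space S \<Longrightarrow> K x \<in> space (prob_algebra S)"
  using kernel by (rule measurable_space)

lemma nstep_measurable[measurable]: "nstep S K n \<in> S \<rightarrow>\<^sub>M prob_algebra S"
proof (induction n)
  case (Suc n)
  then show ?case unfolding nstep.simps by (rule measurable_bind_prob_space) (rule kernel)
qed (simp add: measurable_return_prob_space)

lemma nstep_prob: "x \<in> space S \<Longrightarrow> nstep S K n x \<in> space (prob_algebra S)"
  using nstep_measurable by (rule measurable_space)

lemma nstep_add:
  assumes x: "x \<in> space S"
  shows "nstep S K (m + n) x = nstep S K m x \<bind> nstep S K n"
proof (induction n)
  case 0
  show ?case
    using prob_algebraD[OF nstep_prob[OF x, of m]] by (simp add: bind_return'')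
next
  case (Suc n)
  have "nstep S K (m + Suc n) x = (nstep S K m x \<bind> nstep S K n) \<bind> K"
    using Suc by simp
  also have "\<dots> = nstep S K m x \<bind> (\<lambda>y. nstep S K n y \<bind> K)"
  proof (rule bind_assoc[where N=S and R=S])
    show "nstep S K n \<in> nstep S K m x \<rightarrow>\<^sub>M subprob_algebra S"
      using measurable_prob_algebraD[OF nstep_measurable]
      by (simp add: measurable_cong_sets[OF prob_algebraD(2)[OF nstep_prob[OF x]] refl])
  qed (rule measurable_prob_algebraD[OF kernel])
  finally show ?case by simp
qed

lemma nstep_1: "x \<in> space S \<Longrightarrow> nstep S K (Suc 0) x = K x"
  using measurable_prob_algebraD[OF kernel] by (simp add: bind_return)

lemma bind_nstep_Suc:
  assumes \<nu>: "\<nu> \<in> space (prob_algebra S)"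
  shows "\<nu> \<bind> nstep S K (Suc n) = (\<nu> \<bind> nstep S K n) \<bind> K"
proof -
  have "(\<nu> \<bind> nstep S K n) \<bind> K = \<nu> \<bind> (\<lambda>y. nstep S K n y \<bind> K)"
  proof (rule bind_assoc[where N=S and R=S])
    show "nstep S K n \<in> \<nu> \<rightarrow>\<^sub>M subprob_algebra S"
      using measurable_prob_algebraD[OF nstep_measurable]
      by (simp add: measurable_cong_sets[OF prob_algebraD(2)[OF \<nu>] refl])
  qed (rule measurable_prob_algebraD[OF kernel])
  then show ?thesis by simp
qed

lemma stationary_iff: "stationary S K \<pi> \<longleftrightarrow> \<pi> \<in> space (prob_algebra S) \<and> \<pi> \<bind> K = \<pi>"
proof (cases "\<pi> \<in> space (prob_algebra S)")
  case True
  have "\<pi> \<bind> K = \<pi> \<longleftrightarrow> (\<forall>B\<in>sets S. emeasure \<pi> B = emeasure (\<pi> \<bind> K) B)"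
    using prob_algebraD(2)[OF True] prob_algebraD(2)[OF prob_algebra_bind[OF True kernel]]
    by (metis measure_eqI)
  then show ?thesis
    using True by (simp add: stationary_def emeasure_bind_prob_algebra[OF True kernel])
qed (simp add: stationary_def)

lemma stationary_bind_nstep:
  assumes "stationary S K \<pi>"
  shows "\<pi> \<bind> nstep S K n = \<pi>"
proof -
  have \<pi>: "\<pi> \<in> space (prob_algebra S)" "\<pi> \<bind> K = \<pi>" using assms by (auto simp: stationary_iff)
  show ?thesis
  proof (induction n)
    case 0
    show ?case using prob_algebraD(2)[OF \<pi>(1)] by (simp add: bind_return'')
  next
    case (Suc n)
    show ?case unfolding bind_nstep_Suc[OF \<pi>(1)] Suc by (rule \<pi>(2))
  qed
qed

end

section \<open>Contraction and convergence under drift and local overlap\<close>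

text \<open>The bound \<open>2 * (1 - \<eta>)\<close> over test functions with values in [-1, 1]
  expresses that two transition laws share mass \<open>\<eta>\<close>; it compares laws in pairs.
  The level \<open>R\<close> is arbitrary because the one required by the contraction depends on
  \<open>r\<close> and \<open>C\<close>.\<close>

locale harris_kernel = markov_kernel +
  fixes V :: "'b \<Rightarrow> real" and r C :: real
  assumes V[measurable]: "V \<in> borel_measurable S"
    and V_nonneg: "\<And>x. x \<in> space S \<Longrightarrow> 0 \<le> V x"
    and r: "0 \<le> r" "r < 1" and C: "0 < C"
    and drift: "\<And>x. x \<in> space S \<Longrightarrow> (\<integral>\<^sup>+y. ennreal (V y) \<partial>K x) \<le> ennreal (r * V x + C)"
    and local_doeblin: "\<And>R. \<exists>\<eta>>0. \<forall>x\<in>space S. \<forall>y\<in>space S. V x \<le> R \<longrightarrow> V y \<le> R \<longrightarrow>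
      (\<forall>\<phi>\<in>borel_measurable S. (\<forall>z\<in>space S. \<bar>\<phi> z\<bar> \<le> (1::real)) \<longrightarrow>
        (\<integral>z. \<phi> z \<partial>K x) - (\<integral>z. \<phi> z \<partial>K y) \<le> 2 * (1 - \<eta>))"
    and nonempty: "space S \<noteq> {}"
begin

lemma integral_V_finite:
  assumes \<rho>: "\<rho> \<in> space (prob_algebra S)" and b: "(\<integral>\<^sup>+y. ennreal (V y) \<partial>\<rho>) \<le> ennreal B" "0 \<le> B"
  shows "integrable \<rho> V" and "(\<integral>y. V y \<partial>\<rho>) \<le> B"
proof -
  have [measurable]: "V \<in> borel_measurable \<rho>"
    using V by (simp add: measurable_cong_sets[OF prob_algebraD(2)[OF \<rho>] refl])
  have AE: "AE y in \<rho>. 0 \<le> V y" using V_nonneg prob_algebraD(3)[OF \<rho>] by (intro AE_I2) simp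
  show i: "integrable \<rho> V"
    by (rule integrableI_nonneg) (use AE b in \<open>auto intro: order.strict_trans1[OF _ ennreal_less_top]\<close>)
  have "ennreal (\<integral>y. V y \<partial>\<rho>) \<le> ennreal B"
    using nn_integral_eq_integral[OF i AE] b by simp
  then show "(\<integral>y. V y \<partial>\<rho>) \<le> B" using b(2) by simp
qed

lemma integrable_V:
  assumes x: "x \<in> space S"
  shows "integrable (K x) V" and "(\<integral>y. V y \<partial>K x) \<le> r * V x + C"
  using integral_V_finite[OF K_prob[OF x] drift[OF x]] V_nonneg[OF x] r C by simp_all

text \<open>
  The contraction of Hairer and Mattingly. The oscillation bound provides a constant \<open>c\<close> with
  \<open>\<bar>\<psi> - c\<bar> \<le> 1 + \<theta> V\<close>. If \<open>V x + V y\<close> is large, the drift contracts; otherwise \<open>\<psi> - c\<close> is cut off at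
  \<open>\<plusminus> 1\<close>, the local Doeblin condition contracts the truncation, and the rest is at most \<open>\<theta> V\<close>.
\<close>
lemma weighted_contraction:
  obtains a \<theta> where "0 < a" "a < 1" "0 < \<theta>"
    "\<And>(\<psi> :: 'b \<Rightarrow> real) B x y. \<psi> \<in> borel_measurable S \<Longrightarrow> (\<And>z. z \<in> space S \<Longrightarrow> \<bar>\<psi> z\<bar> \<le> B) \<Longrightarrow>
      (\<And>u v. u \<in> space S \<Longrightarrow> v \<in> space S \<Longrightarrow> \<psi> u - \<psi> v \<le> 2 + \<theta> * V u + \<theta> * V v) \<Longrightarrow>
      x \<in> space S \<Longrightarrow> y \<in> space S \<Longrightarrow>
      (\<integral>z. \<psi> z \<partial>K x) - (\<integral>z. \<psi> z \<partial>K y) \<le> a * (2 + \<theta> * V x + \<theta> * V y)"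
proof -
  \<comment> \<open>At this level \<open>(1 - r) * R = 4 * C\<close>: when \<open>V x + V y\<close>
    reaches \<open>R\<close>, half of the drift gain \<open>(1 - r) * (V x + V y)\<close> pays for
    the two constants \<open>C\<close>.\<close>
  define R where "R = 4 * C / (1 - r)"
  obtain \<eta>0 where \<eta>0: "\<eta>0 > 0" "\<And>x y (\<phi> :: 'b \<Rightarrow> real). x \<in> space S \<Longrightarrow> y \<in> space S \<Longrightarrow> V x \<le> R \<Longrightarrow> V y \<le> R \<Longrightarrow>
      \<phi> \<in> borel_measurable S \<Longrightarrow> (\<forall>z\<in>space S. \<bar>\<phi> z\<bar> \<le> 1) \<Longrightarrow>
        (\<integral>z. \<phi> z \<partial>K x) - (\<integral>z. \<phi> z \<partial>K y) \<le> 2 * (1 - \<eta>0)"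
    using local_doeblin[of R] by blast
  define \<eta> where "\<eta> = min \<eta>0 1"
  have \<eta>: "0 < \<eta>" "\<eta> \<le> 1" "\<eta> \<le> \<eta>0" using \<eta>0 by (auto simp: \<eta>_def)
  \<comment> \<open>Here \<open>2 * \<theta> * C = \<eta>\<close>: below the level \<open>R\<close>
    the truncated part gains \<open>2 * \<eta>\<close>, and the drift constants of the two points
    take back half of it.\<close>
  define \<theta> where "\<theta> = \<eta> / (2 * C)"
  have \<theta>: "0 < \<theta>" "2 * \<theta> * C = \<eta>" using \<eta> C by (auto simp: \<theta>_def)
  have R: "0 < R" "(1 - r) * R = 4 * C" using r C by (auto simp: R_def)
  define g where "g = (1 + r) / 2"
  have g: "0 < g" "g < 1" "r \<le> g" using r by (auto simp: g_def)
  \<comment> \<open>The quotient \<open>(2 + \<theta> * g * t) / (2 + \<theta> * t)\<close>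
    decreases in \<open>t\<close>, so over \<open>t \<ge> R\<close> its largest value is the one at
    \<open>R\<close>.\<close>
  define a1 where "a1 = (2 + \<theta> * R * g) / (2 + \<theta> * R)"
  have tR: "0 < \<theta> * R" using \<theta> R by simp
  have a1: "a1 < 1" "g \<le> a1" "0 < a1" "2 * (1 - a1) = \<theta> * R * (a1 - g)"
  proof -
    have "\<theta> * R * g < \<theta> * R * 1" using tR g by (intro mult_strict_left_mono) auto
    then show "a1 < 1" using tR by (simp add: a1_def)
    have "g * (2 + \<theta> * R) \<le> 2 + \<theta> * R * g" using g by (simp add: algebra_simps)
    then show "g \<le> a1" using tR by (simp add: a1_def pos_le_divide_eq)
    then show "0 < a1" using g by linarith
    have "a1 * (2 + \<theta> * R) = 2 + \<theta> * R * g" using tR by (simp add: a1_def)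
    then show "2 * (1 - a1) = \<theta> * R * (a1 - g)" by (simp add: algebra_simps)
  qed
  define a where "a = max a1 (max (1 - \<eta> / 2) r)"
  have a: "0 < a" "a < 1" "a1 \<le> a" "1 - \<eta> / 2 \<le> a" "r \<le> a"
    using a1 \<eta> r by (auto simp: a_def less_max_iff_disj)
  show thesis
  proof (rule that[OF a(1,2) \<theta>(1)])
    fix \<psi> :: "'b \<Rightarrow> real" and B x y
    assume \<psi>[measurable]: "\<psi> \<in> borel_measurable S" and B: "\<And>z. z \<in> space S \<Longrightarrow> \<bar>\<psi> z\<bar> \<le> B"
      and osc: "\<And>u v. u \<in> space S \<Longrightarrow> v \<in> space S \<Longrightarrow> \<psi> u - \<psi> v \<le> 2 + \<theta> * V u + \<theta> * V v"
      and x: "x \<in> space S" and y: "y \<in> space S"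
    \<comment> \<open>The least admissible offset. The oscillation bound says that each
      \<open>\<psi> u - (1 + \<theta> * V u)\<close> lies below each
      \<open>\<psi> v + (1 + \<theta> * V v)\<close>, and any number between the two families
      serves.\<close>
    define c where "c = (SUP u\<in>space S. \<psi> u - (1 + \<theta> * V u))"
    have lo: "\<psi> u - c \<le> 1 + \<theta> * V u" if u: "u \<in> space S" for u
    proof -
      have "\<psi> u - (1 + \<theta> * V u) \<le> c" unfolding c_def
      proof (rule cSUP_upper[OF u])
        have "\<psi> u - (1 + \<theta> * V u) \<le> B" if "u \<in> space S" for u
        proof -
          have "0 \<le> \<theta> * V u" using \<theta>(1) V_nonneg[OF that] by simp
          with B[OF that] show ?thesis by (simp add: abs_le_iff)
        qed
        then show "bdd_above ((\<lambda>u. \<psi> u - (1 + \<theta> * V u)) ` space S)" by (auto simp: bdd_above_def)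
      qed
      then show ?thesis by linarith
    qed
    have up: "c - \<psi> v \<le> 1 + \<theta> * V v" if v: "v \<in> space S" for v
    proof -
      have "c \<le> \<psi> v + (1 + \<theta> * V v)"
        unfolding c_def using osc[OF _ v] by (intro cSUP_least nonempty) (simp add: algebra_simps)
      then show ?thesis by linarith
    qed
    define \<phi>1 where "\<phi>1 u = max (-1) (min 1 (\<psi> u - c))" for u
    have \<phi>1[measurable]: "\<phi>1 \<in> borel_measurable S" unfolding \<phi>1_def by measurable
    have \<phi>1_le: "\<bar>\<phi>1 u\<bar> \<le> 1" for u by (auto simp: \<phi>1_def)
    have est: "integrable (K z) \<psi> \<and> integrable (K z) \<phi>1 \<and> \<bar>(\<integral>u. \<psi> u \<partial>K z) - c\<bar> \<le> 1 + \<theta> * (r * V z + C) \<and>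
        \<bar>(\<integral>u. \<psi> u \<partial>K z) - c - (\<integral>u. \<phi>1 u \<partial>K z)\<bar> \<le> \<theta> * (r * V z + C)" if z: "z \<in> space S" for z
    proof -
      interpret prob_space "K z" by (rule prob_algebraD[OF K_prob[OF z]])
      note sp = prob_algebraD(3)[OF K_prob[OF z]]
      have i\<psi>: "integrable (K z) \<psi>" using \<psi> B by (rule prob_algebra_integrable(1)[OF K_prob[OF z]])
      have i1: "integrable (K z) \<phi>1" using \<phi>1 \<phi>1_le by (rule prob_algebra_integrable(1)[OF K_prob[OF z]])
      have iV: "integrable (K z) V" "\<theta> * (\<integral>u. V u \<partial>K z) \<le> \<theta> * (r * V z + C)"
        using integrable_V[OF z] \<theta>(1) by simp_all
      have e1: "(\<integral>u. \<psi> u \<partial>K z) - c = (\<integral>u. \<psi> u - c \<partial>K z)"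
        using i\<psi> by (simp add: prob_space)
      have e2: "(\<integral>u. \<psi> u \<partial>K z) - c - (\<integral>u. \<phi>1 u \<partial>K z) = (\<integral>u. \<psi> u - c - \<phi>1 u \<partial>K z)"
        using i\<psi> i1 by (simp add: prob_space)
      have "\<bar>\<integral>u. \<psi> u - c \<partial>K z\<bar> \<le> (\<integral>u. \<bar>\<psi> u - c\<bar> \<partial>K z)" by (rule integral_abs_bound)
      also have "\<dots> \<le> (\<integral>u. 1 + \<theta> * V u \<partial>K z)"
        using i\<psi> iV lo up by (intro integral_mono integrable_abs) (auto simp: sp abs_le_iff)
      also have "\<dots> \<le> 1 + \<theta> * (r * V z + C)" using iV by (simp add: prob_space)
      finally have 1: "\<bar>(\<integral>u. \<psi> u \<partial>K z) - c\<bar> \<le> 1 + \<theta> * (r * V z + C)" unfolding e1 .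
      have "\<bar>\<psi> u - c - \<phi>1 u\<bar> \<le> \<theta> * V u" if u: "u \<in> space S" for u
      proof -
        have "0 \<le> \<theta> * V u" using \<theta>(1) V_nonneg[OF u] by simp
        with lo[OF u] up[OF u] show ?thesis by (auto simp: \<phi>1_def max_def min_def abs_if)
      qed
      then have "(\<integral>u. \<bar>\<psi> u - c - \<phi>1 u\<bar> \<partial>K z) \<le> (\<integral>u. \<theta> * V u \<partial>K z)"
        using i\<psi> iV i1 by (intro integral_mono integrable_abs) (auto simp: sp)
      also have "\<dots> \<le> \<theta> * (r * V z + C)" using iV by simp
      finally have 2: "\<bar>(\<integral>u. \<psi> u \<partial>K z) - c - (\<integral>u. \<phi>1 u \<partial>K z)\<bar> \<le> \<theta> * (r * V z + C)"
        unfolding e2 using integral_abs_bound[of "K z" "\<lambda>u. \<psi> u - c - \<phi>1 u"] by linarith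
      from i\<psi> i1 1 2 show ?thesis by blast
    qed
    let ?T = "V x + V y"
    have Vx: "0 \<le> V x" and Vy: "0 \<le> V y" using V_nonneg x y by auto
    show "(\<integral>z. \<psi> z \<partial>K x) - (\<integral>z. \<psi> z \<partial>K y) \<le> a * (2 + \<theta> * V x + \<theta> * V y)"
    proof (cases "R \<le> ?T")
      case True
      have "(\<integral>z. \<psi> z \<partial>K x) - (\<integral>z. \<psi> z \<partial>K y) \<le> 2 + \<theta> * (r * ?T + 2 * C)"
        using est[OF x] est[OF y] by (simp add: abs_le_iff algebra_simps)
      also have "\<dots> \<le> 2 + \<theta> * (g * ?T)"
      proof -
        have "(1 - r) * R \<le> (1 - r) * ?T" using True r by (intro mult_left_mono) auto
        then have "r * ?T + 2 * C \<le> g * ?T" using R(2) by (simp add: g_def algebra_simps add_divide_distrib)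
        then show ?thesis using \<theta>(1) by simp
      qed
      also have "\<dots> \<le> a1 * (2 + \<theta> * ?T)"
      proof -
        have "\<theta> * R * (a1 - g) \<le> \<theta> * ?T * (a1 - g)"
          using True \<theta>(1) a1(2) by (intro mult_right_mono mult_left_mono) auto
        with a1(4) show ?thesis by (simp add: algebra_simps)
      qed
      also have "\<dots> \<le> a * (2 + \<theta> * ?T)"
        using a(3) \<theta>(1) Vx Vy by (intro mult_right_mono) auto
      finally show ?thesis by (simp add: algebra_simps)
    next
      case False
      then have "V x \<le> R" "V y \<le> R" using Vx Vy by auto
      then have "(\<integral>z. \<phi>1 z \<partial>K x) - (\<integral>z. \<phi>1 z \<partial>K y) \<le> 2 * (1 - \<eta>0)"
        using \<eta>0(2)[OF x y _ _ \<phi>1] \<phi>1_le by auto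
      then have "(\<integral>z. \<psi> z \<partial>K x) - (\<integral>z. \<psi> z \<partial>K y) \<le> 2 * (1 - \<eta>) + \<theta> * (r * ?T + 2 * C)"
        using est[OF x] est[OF y] \<eta>(3) by (simp add: abs_le_iff algebra_simps)
      also have "\<dots> = 2 * (1 - \<eta> / 2) + r * (\<theta> * ?T)"
        using \<theta>(2) by (simp add: algebra_simps)
      also have "\<dots> \<le> 2 * a + a * (\<theta> * ?T)"
        using a \<theta>(1) Vx Vy by (intro add_mono mult_left_mono mult_right_mono) auto
      finally show ?thesis by (simp add: algebra_simps)
    qed
  qed
qed

text \<open>The contraction is iterated in dual form: the induction replaces \<open>\<psi>\<close>
  by its mean under one kernel step, so the kernel acts on functions and the powers of
  \<open>a\<close> accumulate in the oscillation bound. A function bounded by 1 starts with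
  oscillation at most 2.\<close>

lemma geometric_oscillation:
  obtains a \<theta> where "0 < a" "a < 1" "0 < \<theta>"
    "\<And>(\<psi> :: 'b \<Rightarrow> real) n x y. \<psi> \<in> borel_measurable S \<Longrightarrow> (\<And>z. z \<in> space S \<Longrightarrow> \<bar>\<psi> z\<bar> \<le> 1) \<Longrightarrow>
      x \<in> space S \<Longrightarrow> y \<in> space S \<Longrightarrow>
      \<bar>(\<integral>z. \<psi> z \<partial>nstep S K n x) - (\<integral>z. \<psi> z \<partial>nstep S K n y)\<bar> \<le> a ^ n * (2 + \<theta> * V x + \<theta> * V y)"
proof -
  obtain a \<theta> where a: "0 < a" "a < 1" and \<theta>: "0 < \<theta>" and contr:
    "\<And>(\<psi> :: 'b \<Rightarrow> real) B x y. \<psi> \<in> borel_measurable S \<Longrightarrow> (\<And>z. z \<in> space S \<Longrightarrow> \<bar>\<psi> z\<bar> \<le> B) \<Longrightarrow>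
      (\<And>u v. u \<in> space S \<Longrightarrow> v \<in> space S \<Longrightarrow> \<psi> u - \<psi> v \<le> 2 + \<theta> * V u + \<theta> * V v) \<Longrightarrow>
      x \<in> space S \<Longrightarrow> y \<in> space S \<Longrightarrow>
      (\<integral>z. \<psi> z \<partial>K x) - (\<integral>z. \<psi> z \<partial>K y) \<le> a * (2 + \<theta> * V x + \<theta> * V y)"
    by (rule weighted_contraction) blast
  let ?D = "\<lambda>x y. 2 + \<theta> * V x + \<theta> * V y"
  \<comment> \<open>The scale \<open>b\<close> is generalised because it becomes
    \<open>a * b\<close> after one step; the contraction is available at scale 1 and is applied to
    \<open>\<psi> / b\<close>.\<close>
  have step: "(\<integral>z. \<psi> z \<partial>nstep S K n x) - (\<integral>z. \<psi> z \<partial>nstep S K n y) \<le> a ^ n * (b * ?D x y)"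
    if "\<psi> \<in> borel_measurable S" "\<And>z. z \<in> space S \<Longrightarrow> \<bar>\<psi> z\<bar> \<le> 1" "0 < b"
      "\<And>u v. u \<in> space S \<Longrightarrow> v \<in> space S \<Longrightarrow> \<psi> u - \<psi> v \<le> b * ?D u v"
      "x \<in> space S" "y \<in> space S" for \<psi> :: "'b \<Rightarrow> real" and b n x y
    using that
  proof (induction n arbitrary: \<psi> b)
    case 0
    then show ?case by (simp add: integral_return)
  next
    case (Suc n)
    note [measurable] = Suc.prems(1)
    let ?K\<psi> = "\<lambda>x. \<integral>z. \<psi> z \<partial>K x"
    have m: "?K\<psi> \<in> borel_measurable S"
      by (rule measurable_compose[OF measurable_prob_algebraD[OF kernel] integral_measurable_subprob_algebra[OF Suc.prems(1)]])
    have bd: "\<bar>?K\<psi> z\<bar> \<le> 1" if "z \<in> space S" for z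
      using prob_algebra_integrable(2)[OF K_prob[OF that] Suc.prems(1,2)] .
    have osc: "?K\<psi> u - ?K\<psi> v \<le> (a * b) * ?D u v" if uv: "u \<in> space S" "v \<in> space S" for u v
    proof -
      have "(\<integral>z. \<psi> z / b \<partial>K u) - (\<integral>z. \<psi> z / b \<partial>K v) \<le> a * ?D u v"
      proof (rule contr[OF _ _ _ uv])
        show "\<bar>\<psi> z / b\<bar> \<le> 1 / b" if "z \<in> space S" for z
          using Suc.prems(2)[OF that] Suc.prems(3) by (simp add: divide_right_mono)
        show "\<psi> u / b - \<psi> v / b \<le> ?D u v" if "u \<in> space S" "v \<in> space S" for u v
          using Suc.prems(4)[OF that] Suc.prems(3) by (simp add: diff_divide_distrib[symmetric] pos_divide_le_eq mult.commute)
      qed measurable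
      then have "(?K\<psi> u - ?K\<psi> v) / b \<le> a * ?D u v" by (simp add: diff_divide_distrib)
      then show ?thesis using Suc.prems(3) by (simp add: pos_divide_le_eq algebra_simps)
    qed
    have eq: "(\<integral>z. \<psi> z \<partial>nstep S K (Suc n) u) = (\<integral>z. ?K\<psi> z \<partial>nstep S K n u)" if "u \<in> space S" for u
      unfolding nstep.simps by (rule prob_algebra_integral_bind[OF nstep_prob[OF that] kernel Suc.prems(1,2)])
    show ?case
      unfolding eq[OF Suc.prems(5)] eq[OF Suc.prems(6)]
      using Suc.IH[OF m bd _ osc Suc.prems(5,6)] a Suc.prems(3) by (simp add: algebra_simps)
  qed
  show thesis
  proof (rule that[OF a \<theta>])
    fix \<psi> :: "'b \<Rightarrow> real" and n x y assume \<psi>: "\<psi> \<in> borel_measurable S" "\<And>z. z \<in> space S \<Longrightarrow> \<bar>\<psi> z\<bar> \<le> 1"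
      and xy: "x \<in> space S" "y \<in> space S"
    have osc: "\<psi> u - \<psi> v \<le> 1 * ?D u v" if "u \<in> space S" "v \<in> space S" for u v
    proof -
      have "0 \<le> \<theta> * V u" "0 \<le> \<theta> * V v" using \<theta> V_nonneg that by auto
      then show ?thesis using \<psi>(2)[OF that(1)] \<psi>(2)[OF that(2)] by (simp add: abs_le_iff)
    qed
    from step[OF \<psi> zero_less_one osc xy] step[OF \<psi> zero_less_one osc xy(2,1)]
    show "\<bar>(\<integral>z. \<psi> z \<partial>nstep S K n x) - (\<integral>z. \<psi> z \<partial>nstep S K n y)\<bar> \<le> a ^ n * ?D x y"
      by (simp add: abs_le_iff algebra_simps)
  qed
qed

text \<open>\<open>C / (1 - r)\<close> is the fixed point of \<open>t \<mapsto> r * t + C\<close>,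
  so each further step preserves the bound, which is thereby uniform in \<open>n\<close>.\<close>

lemma nn_integral_V_nstep:
  assumes x: "x \<in> space S"
  shows "(\<integral>\<^sup>+y. ennreal (V y) \<partial>nstep S K n x) \<le> ennreal (V x + C / (1 - r))"
proof (induction n)
  case 0
  have "V x \<le> V x + C / (1 - r)" using C r by simp
  then show ?case using x by (simp add: nn_integral_return ennreal_leI)
next
  case (Suc n)
  let ?B = "V x + C / (1 - r)"
  have B: "0 \<le> ?B" using V_nonneg[OF x] C r by simp
  interpret prob_space "nstep S K n x" by (rule prob_algebraD[OF nstep_prob[OF x]])
  note sp = prob_algebraD(3)[OF nstep_prob[OF x]]
  have [measurable]: "V \<in> borel_measurable (nstep S K n x)"
    using V by (simp add: measurable_cong_sets[OF prob_algebraD(2)[OF nstep_prob[OF x]] refl])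
  have "(\<integral>\<^sup>+y. ennreal (V y) \<partial>nstep S K (Suc n) x) = (\<integral>\<^sup>+z. \<integral>\<^sup>+y. ennreal (V y) \<partial>K z \<partial>nstep S K n x)"
    unfolding nstep.simps by (rule prob_algebra_nn_integral_bind[OF nstep_prob[OF x] kernel]) measurable
  also have "\<dots> \<le> (\<integral>\<^sup>+z. ennreal r * ennreal (V z) + ennreal C \<partial>nstep S K n x)"
  proof (rule nn_integral_mono)
    fix z assume "z \<in> space (nstep S K n x)"
    then have z: "z \<in> space S" by (simp add: sp)
    show "(\<integral>\<^sup>+y. ennreal (V y) \<partial>K z) \<le> ennreal r * ennreal (V z) + ennreal C"
      using drift[OF z] r C V_nonneg[OF z] by (simp add: ennreal_plus ennreal_mult)
  qed
  also have "\<dots> = ennreal r * (\<integral>\<^sup>+z. ennreal (V z) \<partial>nstep S K n x) + ennreal C"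
    by (subst nn_integral_add) (simp_all add: nn_integral_cmult emeasure_space_1)
  also have "\<dots> \<le> ennreal r * ennreal ?B + ennreal C"
    by (intro add_right_mono mult_left_mono Suc) simp
  also have "\<dots> = ennreal (r * ?B + C)"
    using r C B by (simp add: ennreal_plus ennreal_mult)
  also have "\<dots> \<le> ennreal ?B"
  proof (rule ennreal_leI)
    have "r * V x \<le> 1 * V x" using r V_nonneg[OF x] by (intro mult_right_mono) auto
    moreover have "r * (C / (1 - r)) + C = C / (1 - r)" using r by (simp add: field_simps)
    ultimately show "r * ?B + C \<le> ?B" by (simp add: distrib_left)
  qed
  finally show ?case .
qed

end

lemma prob_algebra_eqI:
  assumes "\<rho> \<in> space (prob_algebra S)" "\<pi> \<in> space (prob_algebra S)"
    and "\<And>A. A \<in> sets S \<Longrightarrow> measure \<rho> A = measure \<pi> A"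
  shows "\<rho> = \<pi>"
  using assms prob_algebraD[OF assms(1)] prob_algebraD[OF assms(2)]
  by (intro measure_eqI) (simp_all add: finite_measure.emeasure_eq_measure prob_space.finite_measure)

text \<open>Completeness for total variation. The limit inherits finite additivity set by set; a
  rate \<open>d\<close> independent of the set allows the limit in \<open>n\<close> to be exchanged
  with that along a sequence of sets decreasing to the empty set, which yields countable
  additivity.\<close>

lemma uniform_limit_measure:
  fixes \<rho> :: "nat \<Rightarrow> 'b measure"
  assumes \<rho>: "\<And>n. \<rho> n \<in> space (prob_algebra S)"
    and lim: "\<And>A. A \<in> sets S \<Longrightarrow> (\<lambda>n. measure (\<rho> n) A) \<longlonglongrightarrow> p A"
    and d: "\<And>n A. A \<in> sets S \<Longrightarrow> \<bar>measure (\<rho> n) A - p A\<bar> \<le> d n" and d0: "d \<longlonglongrightarrow> (0::real)"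
  obtains \<pi> where "\<pi> \<in> space (prob_algebra S)" "\<And>A. A \<in> sets S \<Longrightarrow> measure \<pi> A = p A"
proof -
  have \<rho>_prob: "prob_space (\<rho> n)" and \<rho>_sets: "sets (\<rho> n) = sets S" and \<rho>_space: "space (\<rho> n) = space S" for n
    using prob_algebraD[OF \<rho>] by auto
  have p_nonneg: "0 \<le> p A" if "A \<in> sets S" for A
    by (rule LIMSEQ_le_const[OF lim[OF that]]) auto
  have p_add: "p (A \<union> B) = p A + p B" if AB: "A \<in> sets S" "B \<in> sets S" "A \<inter> B = {}" for A B
  proof (rule LIMSEQ_unique[OF lim])
    have "measure (\<rho> n) (A \<union> B) = measure (\<rho> n) A + measure (\<rho> n) B" for n
      using AB by (intro finite_measure.finite_measure_Union prob_space.finite_measure \<rho>_prob) (auto simp: \<rho>_sets)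
    then show "(\<lambda>n. measure (\<rho> n) (A \<union> B)) \<longlonglongrightarrow> p A + p B"
      using tendsto_add[OF lim[OF AB(1)] lim[OF AB(2)]] by simp
  qed (use AB in auto)
  have p_empty: "p {} = 0" by (rule LIMSEQ_unique[OF lim]) auto
  have p_space: "p (space S) = 1"
  proof (rule LIMSEQ_unique[OF lim])
    show "(\<lambda>n. measure (\<rho> n) (space S)) \<longlonglongrightarrow> 1"
      using prob_space.prob_space[OF \<rho>_prob] by (simp add: \<rho>_space)
  qed simp
  have ca: "countably_additive (sets S) (\<lambda>A. ennreal (p A))"
  proof (rule sets.empty_continuous_imp_countably_additive)
    show "positive (sets S) (\<lambda>A. ennreal (p A))" by (simp add: positive_def p_empty)
    show "additive (sets S) (\<lambda>A. ennreal (p A))"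
      by (auto simp: additive_def p_add p_nonneg ennreal_plus)
    show "\<forall>A\<in>sets S. ennreal (p A) \<noteq> \<infinity>" by simp
  next
    fix A assume A: "range A \<subseteq> sets S" "decseq A" "(\<Inter>i. A i) = {}"
    have "(\<lambda>i. p (A i)) \<longlonglongrightarrow> 0"
    proof (rule LIMSEQ_I)
      fix e :: real assume e: "0 < e"
      obtain n where "\<forall>m\<ge>n. norm (d m - 0) < e / 2"
        using LIMSEQ_D[OF d0, of "e / 2"] e by auto
      then have n: "d n < e / 2" by (auto simp: abs_less_iff)
      have "(\<lambda>i. measure (\<rho> n) (A i)) \<longlonglongrightarrow> measure (\<rho> n) (\<Inter>i. A i)"
        using A by (intro finite_measure.finite_Lim_measure_decseq prob_space.finite_measure \<rho>_prob) (auto simp: \<rho>_sets)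
      then obtain N where N: "\<And>i. i \<ge> N \<Longrightarrow> measure (\<rho> n) (A i) < e / 2"
        using LIMSEQ_D[of _ 0 "e / 2"] e A(3) by force
      have "norm (p (A i) - 0) < e" if "i \<ge> N" for i
      proof -
        have "A i \<in> sets S" using A by auto
        from d[OF this, of n] N[OF that] n p_nonneg[OF this] show ?thesis
          by (simp add: abs_le_iff)
      qed
      then show "\<exists>no. \<forall>i\<ge>no. norm (p (A i) - 0) < e" by blast
    qed
    then show "(\<lambda>i. ennreal (p (A i))) \<longlonglongrightarrow> 0"
      using tendsto_ennrealI by fastforce
  qed
  define \<pi> where "\<pi> = measure_of (space S) (sets S) (\<lambda>A. ennreal (p A))"
  have em: "emeasure \<pi> A = ennreal (p A)" if "A \<in> sets S" for A
    unfolding \<pi>_def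
    by (rule emeasure_measure_of_sigma[OF sets.sigma_algebra_axioms _ ca that]) (simp add: positive_def p_empty)
  have "sets \<pi> = sets S" unfolding \<pi>_def by simp
  moreover have "space \<pi> = space S" unfolding \<pi>_def by (simp add: space_measure_of_conv)
  ultimately have "\<pi> \<in> space (prob_algebra S)"
    using em[OF sets.top] p_space by (auto simp: space_prob_algebra intro!: prob_spaceI)
  moreover have "measure \<pi> A = p A" if "A \<in> sets S" for A
    using em[OF that] p_nonneg[OF that] by (simp add: measure_def)
  ultimately show thesis by (rule that)
qed

context harris_kernel
begin

lemma measure_nstep_eq_integral:
  assumes "x \<in> space S" "A \<in> sets S"
  shows "measure (nstep S K n x) A = (\<integral>z. indicator A z \<partial>nstep S K n x)"
  using prob_algebraD[OF nstep_prob[OF assms(1)]] sets.sets_into_space[OF assms(2)]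
  by (simp add: Int_absorb2)

text \<open>The law after \<open>m + n\<close> steps is a mixture, over the state \<open>y\<close>
  after \<open>m\<close> steps, of the \<open>n\<close>-step laws from \<open>y\<close>. Each of
  these is within \<open>a ^ n * (2 + \<theta> * V y + \<theta> * V x)\<close> of the
  \<open>n\<close>-step law from \<open>x\<close>, and the mean of \<open>V y\<close> is bounded in
  \<open>m\<close>. So the laws from one starting point form a Cauchy sequence, uniformly over
  sets.\<close>

lemma stationary_exists:
  obtains \<pi> where "stationary S K \<pi>" "integrable \<pi> V"
proof -
  obtain a \<theta> where a: "0 < a" "a < 1" and \<theta>: "0 < \<theta>" and geo:
    "\<And>(\<psi> :: 'b \<Rightarrow> real) n x y. \<psi> \<in> borel_measurable S \<Longrightarrow> (\<And>z. z \<in> space S \<Longrightarrow> \<bar>\<psi> z\<bar> \<le> 1) \<Longrightarrow>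
      x \<in> space S \<Longrightarrow> y \<in> space S \<Longrightarrow>
      \<bar>(\<integral>z. \<psi> z \<partial>nstep S K n x) - (\<integral>z. \<psi> z \<partial>nstep S K n y)\<bar> \<le> a ^ n * (2 + \<theta> * V x + \<theta> * V y)"
    by (rule geometric_oscillation) blast
  obtain x where x: "x \<in> space S" using nonempty by blast
  let ?B = "V x + C / (1 - r)"
  have B: "0 \<le> ?B" using V_nonneg[OF x] C r by simp
  define G where "G = 2 + \<theta> * V x + \<theta> * ?B"
  let ?u = "\<lambda>n A. measure (nstep S K n x) A"
  have cauchy: "\<bar>?u (m + n) A - ?u n A\<bar> \<le> a ^ n * G" if A: "A \<in> sets S" for m n A
  proof -
    note \<rho> = nstep_prob[OF x, of m]
    interpret prob_space "nstep S K m x" by (rule prob_algebraD[OF \<rho>])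
    have iA: "integrable (nstep S K m x) (\<lambda>y. measure (nstep S K n y) A)"
      by (rule kernel_measure_integrable[OF \<rho> nstep_measurable A])
    have iV: "integrable (nstep S K m x) V" "(\<integral>y. V y \<partial>nstep S K m x) \<le> ?B"
      using integral_V_finite[OF \<rho> nn_integral_V_nstep[OF x] B] .
    have pt: "\<bar>measure (nstep S K n y) A - ?u n A\<bar> \<le> a ^ n * (2 + \<theta> * V y + \<theta> * V x)"
      if y: "y \<in> space S" for y
      unfolding measure_nstep_eq_integral[OF y A] measure_nstep_eq_integral[OF x A]
      using A by (intro geo y x) (auto split: split_indicator)
    have "?u (m + n) A - ?u n A = (\<integral>y. measure (nstep S K n y) A - ?u n A \<partial>nstep S K m x)"
      unfolding nstep_add[OF x] prob_algebra_measure_bind[OF \<rho> nstep_measurable A]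
      using iA by (simp add: prob_space)
    also have "\<bar>\<dots>\<bar> \<le> (\<integral>y. \<bar>measure (nstep S K n y) A - ?u n A\<bar> \<partial>nstep S K m x)"
      by (rule integral_abs_bound)
    also have "\<dots> \<le> (\<integral>y. a ^ n * (2 + \<theta> * V y + \<theta> * V x) \<partial>nstep S K m x)"
      using iA iV pt prob_algebraD(3)[OF \<rho>] by (intro integral_mono integrable_abs) auto
    also have "\<dots> = a ^ n * (2 + \<theta> * (\<integral>y. V y \<partial>nstep S K m x) + \<theta> * V x)"
      using iV by (simp add: prob_space)
    also have "\<dots> \<le> a ^ n * G"
      using iV \<theta> a by (simp add: G_def)
    finally show ?thesis .
  qed
  have aG: "(\<lambda>n. a ^ n * G) \<longlonglongrightarrow> 0"
    using a by (intro tendsto_mult_left_zero LIMSEQ_power_zero) auto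
  have conv: "convergent (\<lambda>n. ?u n A)" if A: "A \<in> sets S" for A
  proof (rule Cauchy_convergent, rule metric_CauchyI)
    fix e :: real assume e: "0 < e"
    obtain N where N: "\<And>n. n \<ge> N \<Longrightarrow> a ^ n * G < e / 2"
      using LIMSEQ_D[OF aG, of "e / 2"] e by (force simp: abs_less_iff)
    have "dist (?u m A) (?u n A) < e" if "m \<ge> N" "n \<ge> N" for m n
    proof -
      have "\<bar>?u m A - ?u N A\<bar> < e / 2" "\<bar>?u n A - ?u N A\<bar> < e / 2"
        using cauchy[OF A, of "m - N" N] cauchy[OF A, of "n - N" N] N[of N] that by auto
      then show ?thesis unfolding dist_real_def by linarith
    qed
    then show "\<exists>M. \<forall>m\<ge>M. \<forall>n\<ge>M. dist (?u m A) (?u n A) < e" by blast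
  qed
  define p where "p A = lim (\<lambda>n. ?u n A)" for A
  have lim: "(\<lambda>n. ?u n A) \<longlonglongrightarrow> p A" if "A \<in> sets S" for A
    using conv[OF that] by (simp add: p_def convergent_LIMSEQ_iff)
  have d: "\<bar>?u n A - p A\<bar> \<le> a ^ n * G" if A: "A \<in> sets S" for n A
  proof -
    have "(\<lambda>m. \<bar>?u (m + n) A - ?u n A\<bar>) \<longlonglongrightarrow> \<bar>p A - ?u n A\<bar>"
      by (intro tendsto_intros LIMSEQ_ignore_initial_segment lim A)
    then have "\<bar>p A - ?u n A\<bar> \<le> a ^ n * G"
      by (rule LIMSEQ_le_const2) (use cauchy[OF A] in auto)
    then show ?thesis by (simp add: abs_minus_commute)
  qed
  obtain \<pi> where \<pi>: "\<pi> \<in> space (prob_algebra S)" and \<pi>_p: "\<And>A. A \<in> sets S \<Longrightarrow> measure \<pi> A = p A"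
    by (rule uniform_limit_measure[OF nstep_prob[OF x] lim d aG]) blast+
  have int_lim: "(\<lambda>n. \<integral>y. \<phi> y \<partial>nstep S K n x) \<longlonglongrightarrow> (\<integral>y. \<phi> y \<partial>\<pi>)"
    if "\<phi> \<in> borel_measurable S" "\<And>y. y \<in> space S \<Longrightarrow> 0 \<le> \<phi> y \<and> \<phi> y \<le> (1::real)" for \<phi>
  proof (rule LIMSEQ_I)
    fix e :: real assume "0 < e"
    then obtain N where N: "\<And>n. n \<ge> N \<Longrightarrow> a ^ n * G < e"
      using LIMSEQ_D[OF aG, of e] by (force simp: abs_less_iff)
    have "\<bar>(\<integral>y. \<phi> y \<partial>nstep S K n x) - (\<integral>y. \<phi> y \<partial>\<pi>)\<bar> \<le> a ^ n * G" for n
      using that d by (intro abs_integral_diff_le[OF nstep_prob[OF x] \<pi>]) (auto simp: \<pi>_p)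
    with N have "norm ((\<integral>y. \<phi> y \<partial>nstep S K n x) - (\<integral>y. \<phi> y \<partial>\<pi>)) < e" if "n \<ge> N" for n
      using that by (metis order.strict_trans1 real_norm_def)
    then show "\<exists>no. \<forall>n\<ge>no. norm ((\<integral>y. \<phi> y \<partial>nstep S K n x) - (\<integral>y. \<phi> y \<partial>\<pi>)) < e" by blast
  qed
  have "\<pi> \<bind> K = \<pi>"
  proof (rule prob_algebra_eqI[OF prob_algebra_bind[OF \<pi> kernel] \<pi>])
    fix A assume A: "A \<in> sets S"
    have "(\<lambda>n. \<integral>y. measure (K y) A \<partial>nstep S K n x) \<longlonglongrightarrow> (\<integral>y. measure (K y) A \<partial>\<pi>)"
      by (rule int_lim[OF kernel_measure_measurable[OF kernel A]])
         (use prob_space.prob_le_1[OF prob_algebraD(1)[OF K_prob]] in simp)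
    moreover have "(\<integral>y. measure (K y) A \<partial>nstep S K n x) = ?u (Suc n) A" for n
      using prob_algebra_measure_bind[OF nstep_prob[OF x] kernel A] by simp
    ultimately have "(\<lambda>n. ?u (Suc n) A) \<longlonglongrightarrow> measure (\<pi> \<bind> K) A"
      using prob_algebra_measure_bind[OF \<pi> kernel A] by simp
    moreover have "(\<lambda>n. ?u (Suc n) A) \<longlonglongrightarrow> measure \<pi> A"
      unfolding \<pi>_p[OF A] by (rule LIMSEQ_Suc[OF lim[OF A]])
    ultimately show "measure (\<pi> \<bind> K) A = measure \<pi> A" by (rule LIMSEQ_unique)
  qed
  then have st: "stationary S K \<pi>" using \<pi> by (simp add: stationary_iff)
  \<comment> \<open>\<open>V\<close> is unbounded and \<open>int_lim\<close> handles functions with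
    values between 0 and 1, so the moment bound passes to the limit through truncations rescaled by
    \<open>k\<close>.\<close>
  have trunc: "(\<integral>\<^sup>+y. ennreal (min (V y) (real k)) \<partial>\<pi>) \<le> ennreal ?B" for k
  proof (cases "k = 0")
    case False
    let ?\<phi> = "\<lambda>y. min (V y) (real k) / real k"
    have \<phi>: "?\<phi> \<in> borel_measurable S" "\<And>y. y \<in> space S \<Longrightarrow> 0 \<le> ?\<phi> y \<and> ?\<phi> y \<le> 1"
      using V_nonneg False by (auto simp: min_le_iff_disj)
    have le: "(\<integral>y. ?\<phi> y \<partial>nstep S K n x) \<le> ?B / real k" for n
    proof -
      note \<rho> = nstep_prob[OF x, of n]
      have iV: "integrable (nstep S K n x) V" "(\<integral>y. V y \<partial>nstep S K n x) \<le> ?B"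
        using integral_V_finite[OF \<rho> nn_integral_V_nstep[OF x] B] .
      have "(\<integral>y. ?\<phi> y \<partial>nstep S K n x) \<le> (\<integral>y. V y / real k \<partial>nstep S K n x)"
      proof (rule integral_mono)
        show "integrable (nstep S K n x) ?\<phi>"
          by (rule prob_algebra_integrable(1)[OF \<rho> \<phi>(1), of 1]) (use \<phi>(2) in force)
      qed (use iV in \<open>auto intro: divide_right_mono\<close>)
      also have "\<dots> \<le> ?B / real k" using iV by (simp add: divide_right_mono)
      finally show ?thesis .
    qed
    have "(\<integral>y. ?\<phi> y \<partial>\<pi>) \<le> ?B / real k"
      by (rule LIMSEQ_le_const2[OF int_lim[OF \<phi>]]) (use le in auto)
    then have "(\<integral>y. min (V y) (real k) \<partial>\<pi>) \<le> ?B"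
      using False by (simp add: divide_le_cancel)
    moreover have "integrable \<pi> (\<lambda>y. min (V y) (real k))"
      by (rule prob_algebra_integrable(1)[OF \<pi>, of _ "real k"]) (use V_nonneg in \<open>auto simp: abs_le_iff\<close>)
    ultimately show ?thesis
      using V_nonneg prob_algebraD(3)[OF \<pi>] by (subst nn_integral_eq_integral) (auto intro!: ennreal_leI AE_I2)
  next
    case True
    then have "ennreal (min (V y) (real k)) = 0" for y by (simp add: ennreal_neg)
    then show ?thesis by simp
  qed
  have [measurable]: "V \<in> borel_measurable \<pi>"
    using V by (simp add: measurable_cong_sets[OF prob_algebraD(2)[OF \<pi>] refl])
  have "(\<integral>\<^sup>+y. ennreal (V y) \<partial>\<pi>) = (\<integral>\<^sup>+y. (SUP k. ennreal (min (V y) (real k))) \<partial>\<pi>)"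
  proof (rule nn_integral_cong)
    fix y
    have "(\<lambda>k. min (V y) (real k)) \<longlonglongrightarrow> V y"
    proof (rule tendsto_eventually)
      obtain k :: nat where "V y \<le> real k" using real_arch_simple by blast
      then show "\<forall>\<^sub>F k in sequentially. min (V y) (real k) = V y"
        unfolding eventually_sequentially by (intro exI[of _ k]) (auto simp: min_def)
    qed
    then have "(\<lambda>k. ennreal (min (V y) (real k))) \<longlonglongrightarrow> ennreal (V y)" by (rule tendsto_ennrealI)
    moreover have "incseq (\<lambda>k. ennreal (min (V y) (real k)))"
      by (auto simp: incseq_def intro!: ennreal_leI)
    ultimately show "ennreal (V y) = (SUP k. ennreal (min (V y) (real k)))"
      using LIMSEQ_SUP LIMSEQ_unique by blast
  qed
  also have "\<dots> = (SUP k. \<integral>\<^sup>+y. ennreal (min (V y) (real k)) \<partial>\<pi>)"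
    by (rule nn_integral_monotone_convergence_SUP)
       (auto simp: incseq_def le_fun_def intro!: ennreal_leI)
  also have "\<dots> \<le> ennreal ?B" by (rule SUP_least) (rule trunc)
  finally have "integrable \<pi> V" using integral_V_finite(1)[OF \<pi> _ B] by simp
  with st show thesis by (rule that)
qed

text \<open>The oscillation bound is averaged over \<open>y\<close> distributed as
  \<open>\<pi>\<close>, which is where integrability of \<open>V\<close> under \<open>\<pi>\<close>
  enters. For uniqueness, a second stationary law is a start that never moves, so its constant
  distance from \<open>\<pi>\<close> tends to 0.\<close>

lemma ergodic_and_unique:
  obtains \<pi> where "stationary S K \<pi>" "integrable \<pi> V" "ergodic S K \<pi>"
    "\<And>\<pi>'. stationary S K \<pi>' \<Longrightarrow> \<pi>' = \<pi>"
proof -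
  obtain a \<theta> where a: "0 < a" "a < 1" and \<theta>: "0 < \<theta>" and geo:
    "\<And>(\<psi> :: 'b \<Rightarrow> real) n x y. \<psi> \<in> borel_measurable S \<Longrightarrow> (\<And>z. z \<in> space S \<Longrightarrow> \<bar>\<psi> z\<bar> \<le> 1) \<Longrightarrow>
      x \<in> space S \<Longrightarrow> y \<in> space S \<Longrightarrow>
      \<bar>(\<integral>z. \<psi> z \<partial>nstep S K n x) - (\<integral>z. \<psi> z \<partial>nstep S K n y)\<bar> \<le> a ^ n * (2 + \<theta> * V x + \<theta> * V y)"
    by (rule geometric_oscillation) blast
  obtain \<pi> where st: "stationary S K \<pi>" and iV: "integrable \<pi> V" by (rule stationary_exists)
  have \<pi>: "\<pi> \<in> space (prob_algebra S)" using st by (simp add: stationary_iff)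
  interpret \<pi>: prob_space \<pi> by (rule prob_algebraD[OF \<pi>])
  define v where "v = (\<integral>y. V y \<partial>\<pi>)"
  have v: "0 \<le> v" unfolding v_def using V_nonneg prob_algebraD(3)[OF \<pi>] by (intro integral_nonneg_AE AE_I2) auto
  \<comment> \<open>An initial law may give \<open>V\<close> an infinite mean. Capping the bound at
    1 keeps it integrable, and dominated convergence then replaces the geometric rate.\<close>
  define b where "b n x = min 1 (a ^ n * (2 + \<theta> * V x + \<theta> * v))" for n x
  have b[measurable]: "b n \<in> borel_measurable S" for n unfolding b_def by measurable
  have b01: "0 \<le> b n x \<and> b n x \<le> 1" if "x \<in> space S" for n x
  proof -
    have "0 \<le> \<theta> * V x" "0 \<le> \<theta> * v" using \<theta> V_nonneg[OF that] v by auto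
    then show ?thesis using a by (auto simp: b_def)
  qed
  have pt: "\<bar>measure (nstep S K n x) A - measure \<pi> A\<bar> \<le> b n x" if x: "x \<in> space S" and A: "A \<in> sets S" for n x A
  proof -
    have iA: "integrable \<pi> (\<lambda>y. measure (nstep S K n y) A)"
      by (rule kernel_measure_integrable[OF \<pi> nstep_measurable A])
    have "measure \<pi> A = (\<integral>y. measure (nstep S K n y) A \<partial>\<pi>)"
      using prob_algebra_measure_bind[OF \<pi> nstep_measurable A] stationary_bind_nstep[OF st] by simp
    then have "measure (nstep S K n x) A - measure \<pi> A =
        (\<integral>y. measure (nstep S K n x) A - measure (nstep S K n y) A \<partial>\<pi>)"
      using iA by (simp add: \<pi>.prob_space)
    also have "\<bar>\<dots>\<bar> \<le> (\<integral>y. \<bar>measure (nstep S K n x) A - measure (nstep S K n y) A\<bar> \<partial>\<pi>)"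
      by (rule integral_abs_bound)
    also have "\<dots> \<le> (\<integral>y. a ^ n * (2 + \<theta> * V x + \<theta> * V y) \<partial>\<pi>)"
    proof (intro integral_mono integrable_abs)
      fix y assume "y \<in> space \<pi>"
      then have y: "y \<in> space S" by (simp add: prob_algebraD(3)[OF \<pi>])
      show "\<bar>measure (nstep S K n x) A - measure (nstep S K n y) A\<bar> \<le> a ^ n * (2 + \<theta> * V x + \<theta> * V y)"
        unfolding measure_nstep_eq_integral[OF y A] measure_nstep_eq_integral[OF x A]
        using A by (intro geo y x) (auto split: split_indicator)
    qed (use iA iV in auto)
    also have "\<dots> = a ^ n * (2 + \<theta> * V x + \<theta> * v)"
      using iV by (simp add: v_def \<pi>.prob_space)
    finally show ?thesis using measure_diff_le_1[OF nstep_prob[OF x] \<pi>] by (simp add: b_def)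
  qed
  have conv: "(\<lambda>n. tv_dist S (\<nu> \<bind> nstep S K n) \<pi>) \<longlonglongrightarrow> 0" if \<nu>: "\<nu> \<in> space (prob_algebra S)" for \<nu>
  proof (rule tendsto_sandwich[OF _ _ tendsto_const])
    interpret \<nu>: prob_space \<nu> by (rule prob_algebraD[OF \<nu>])
    have [measurable]: "b n \<in> borel_measurable \<nu>" for n
      using b by (simp add: measurable_cong_sets[OF prob_algebraD(2)[OF \<nu>] refl])
    show "\<forall>\<^sub>F n in sequentially. 0 \<le> tv_dist S (\<nu> \<bind> nstep S K n) \<pi>"
      using tv_dist_nonneg[OF prob_algebra_bind[OF \<nu> nstep_measurable] \<pi>] by simp
    have "tv_dist S (\<nu> \<bind> nstep S K n) \<pi> \<le> (\<integral>x. b n x \<partial>\<nu>)" for n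
    proof (rule tv_dist_le)
      fix A assume A: "A \<in> sets S"
      have iA: "integrable \<nu> (\<lambda>y. measure (nstep S K n y) A)"
        by (rule kernel_measure_integrable[OF \<nu> nstep_measurable A])
      have ib: "integrable \<nu> (b n)"
        by (rule prob_algebra_integrable(1)[OF \<nu> b, where B=1]) (use b01 in force)
      have "measure (\<nu> \<bind> nstep S K n) A - measure \<pi> A = (\<integral>y. measure (nstep S K n y) A - measure \<pi> A \<partial>\<nu>)"
        using iA by (simp add: prob_algebra_measure_bind[OF \<nu> nstep_measurable A] \<nu>.prob_space)
      also have "\<bar>\<dots>\<bar> \<le> (\<integral>y. \<bar>measure (nstep S K n y) A - measure \<pi> A\<bar> \<partial>\<nu>)"
        by (rule integral_abs_bound)
      also have "\<dots> \<le> (\<integral>y. b n y \<partial>\<nu>)"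
        using iA ib pt[OF _ A] prob_algebraD(3)[OF \<nu>] by (intro integral_mono integrable_abs) auto
      finally show "\<bar>measure (\<nu> \<bind> nstep S K n) A - measure \<pi> A\<bar> \<le> (\<integral>x. b n x \<partial>\<nu>)" .
    qed
    then show "\<forall>\<^sub>F n in sequentially. tv_dist S (\<nu> \<bind> nstep S K n) \<pi> \<le> (\<integral>x. b n x \<partial>\<nu>)" by simp
    have "(\<lambda>n. \<integral>x. b n x \<partial>\<nu>) \<longlonglongrightarrow> (\<integral>x. 0 \<partial>\<nu>)"
    proof (rule integral_dominated_convergence[where w="\<lambda>_. 1"])
      show "AE x in \<nu>. (\<lambda>n. b n x) \<longlonglongrightarrow> 0"
      proof (rule AE_I2)
        fix x
        have "(\<lambda>n. a ^ n * (2 + \<theta> * V x + \<theta> * v)) \<longlonglongrightarrow> 0"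
          using a by (intro tendsto_mult_left_zero LIMSEQ_power_zero) auto
        from tendsto_min[OF tendsto_const[of 1] this] show "(\<lambda>n. b n x) \<longlonglongrightarrow> 0"
          by (simp add: b_def)
      qed
      show "AE x in \<nu>. norm (b n x) \<le> 1" for n
        using b01 prob_algebraD(3)[OF \<nu>] by (intro AE_I2) auto
    qed auto
    then show "(\<lambda>n. \<integral>x. b n x \<partial>\<nu>) \<longlonglongrightarrow> 0" by simp
  qed
  show thesis
  proof (rule that[OF st iV])
    show "ergodic S K \<pi>" using st conv by (simp add: ergodic_def)
    fix \<pi>' assume st': "stationary S K \<pi>'"
    have \<pi>': "\<pi>' \<in> space (prob_algebra S)" using st' by (simp add: stationary_iff)
    have "(\<lambda>n. tv_dist S \<pi>' \<pi>) \<longlonglongrightarrow> 0" using conv[OF \<pi>'] by (simp add: stationary_bind_nstep[OF st'])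
    then have "tv_dist S \<pi>' \<pi> = 0" by (simp add: LIMSEQ_const_iff)
    then have eq: "measure \<pi>' A = measure \<pi> A" if "A \<in> sets S" for A
      using measure_diff_le_tv_dist[OF \<pi>' \<pi> that] by simp
    show "\<pi>' = \<pi>" by (rule prob_algebra_eqI[OF \<pi>' \<pi> eq])
  qed
qed

end

section \<open>Recurrence under the path law\<close>

context markov_kernel
begin

text \<open>The kernel killed on \<open>A\<close>. Its \<open>m\<close>-th power applied to
  \<open>indicator (- A)\<close> is the probability of avoiding \<open>A\<close> at the times 0 to
  \<open>m\<close>; the starting state is tested as well.\<close>

definition taboo :: "'b set \<Rightarrow> ('b \<Rightarrow> ennreal) \<Rightarrow> 'b \<Rightarrow> ennreal" where
  "taboo A \<phi> y = indicator (- A) y * (\<integral>\<^sup>+z. \<phi> z \<partial>K y)"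

lemma nn_integral_kernel_measurable[measurable (raw)]:
  "\<phi> \<in> borel_measurable S \<Longrightarrow> (\<lambda>y. \<integral>\<^sup>+z. \<phi> z \<partial>K y) \<in> borel_measurable S"
  by (rule measurable_compose[OF measurable_prob_algebraD[OF kernel] nn_integral_measurable_subprob_algebra])

lemma indicator_compl_measurable[measurable (raw)]:
  "A \<in> sets S \<Longrightarrow> (\<lambda>y. indicator (- A) y :: ennreal) \<in> borel_measurable S"
  by (subst measurable_cong[of _ _ "indicator (space S - A)"]) (auto split: split_indicator)

lemma taboo_measurable:
  assumes [measurable]: "A \<in> sets S" "\<phi> \<in> borel_measurable S"
  shows "taboo A \<phi> \<in> borel_measurable S"
  unfolding taboo_def[abs_def] by measurable

lemma taboo_funpow_measurable:
  "A \<in> sets S \<Longrightarrow> \<phi> \<in> borel_measurable S \<Longrightarrow> (taboo A ^^ m) \<phi> \<in> borel_measurable S"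
  by (induction m) (auto intro: taboo_measurable)

text \<open>The event involves finitely many coordinates, so the projective limit is replaced by a
  finite-dimensional marginal. Its coordinates are then integrated out from the last one backwards,
  each integration inside the window applying the taboo operator once.\<close>

lemma path_law_avoid:
  assumes x: "x \<in> space S" and A[measurable]: "A \<in> sets S"
  shows "prob_space (path_law S K x)" and "sets (path_law S K x) = sets (Pi\<^sub>M UNIV (\<lambda>_. S))"
    and "emeasure (path_law S K x) {\<omega> \<in> space (path_law S K x). \<forall>k\<in>{n..n + m}. \<omega> k \<notin> A} =
      (\<integral>\<^sup>+y. (taboo A ^^ m) (indicator (- A)) y \<partial>nstep S K n x)"
proof -
  interpret IT: Ionescu_Tulcea "path_step S K x" "\<lambda>_. S"
    by (rule Ionescu_Tulcea_path_step[OF kernel x])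
  have lim: "path_law S K x = IT.PF.lim" by (simp add: path_law_def)
  show sets: "sets (path_law S K x) = sets (Pi\<^sub>M UNIV (\<lambda>_. S))" by (simp add: lim)
  let ?C = "\<lambda>n. IT.C 0 n (\<lambda>_. undefined)"
  \<comment> \<open>The empty history: \<open>undefined\<close> everywhere is the only point of the
    product over no coordinates.\<close>
  have e0: "(\<lambda>_. undefined) \<in> space (Pi\<^sub>M {0..<0::nat} (\<lambda>_. S))"
    by (simp add: space_PiM PiE_iff extensional_def)
  have C_sets: "sets (?C n) = sets (Pi\<^sub>M {0..<n} (\<lambda>_. S))" for n
    using IT.sets_C[OF e0, of n] by simp
  have C_space: "space (?C n) = space (Pi\<^sub>M {0..<n} (\<lambda>_. S))" for n
    using sets_eq_imp_space_eq[OF C_sets] .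
  have distr_C: "distr IT.PF.lim (Pi\<^sub>M {0..<n} (\<lambda>_. S)) (\<lambda>\<omega>. restrict \<omega> {0..<n}) = ?C n" for n
    unfolding IT.distr_lim[OF finite_atLeastLessThan]
  proof (rule measure_eqI)
    show "sets (IT.CI {0..<n}) = sets (?C n)" by (simp add: IT.CI_def C_sets)
    fix X assume "X \<in> sets (IT.CI {0..<n})"
    then have X: "X \<in> sets (Pi\<^sub>M {0..<n} (\<lambda>_. S))" by (simp add: IT.CI_def)
    have "prod_emb {0..<n} (\<lambda>_. S) {0..<n} X = X"
      using sets.sets_into_space[OF X] by (intro prod_emb_id) (simp add: space_PiM)
    then show "emeasure (IT.CI {0..<n}) X = emeasure (?C n) X"
      using IT.emeasure_CI[OF subset_refl X] by simp
  qed
  have restr[measurable]: "(\<lambda>\<omega>. restrict \<omega> {0..<n}) \<in> IT.PF.lim \<rightarrow>\<^sub>M Pi\<^sub>M {0..<n} (\<lambda>_. S)" for n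
    using measurable_restrict_subset[of "{0..<n}" UNIV "\<lambda>_. S"]
    by (simp add: measurable_cong_sets[OF IT.PF.sets_lim refl])
  show prob: "prob_space (path_law S K x)"
    unfolding lim by (rule prob_space_distrD[OF restr[of 0]]) (unfold distr_C, rule IT.prob_space_C[OF e0])
  \<comment> \<open>The condition \<open>W'\<close> says that \<open>W\<close> ignores the
    coordinates from \<open>Suc n\<close> on, so it is constant while the last coordinate is
    integrated.\<close>
  have C_step: "(\<integral>\<^sup>+\<omega>. \<phi> (\<omega> (Suc n)) * W \<omega> \<partial>?C (Suc (Suc n))) =
      (\<integral>\<^sup>+\<omega>. (\<integral>\<^sup>+z. \<phi> z \<partial>K (\<omega> n)) * W \<omega> \<partial>?C (Suc n))"
    if \<phi>[measurable]: "\<phi> \<in> borel_measurable S" and W[measurable]: "W \<in> borel_measurable (Pi\<^sub>M {0..<Suc n} (\<lambda>_. S))"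
      and W': "\<And>\<omega>. W (restrict \<omega> {0..<Suc n}) = W \<omega>" for \<phi> W n
  proof -
    have "(\<lambda>\<omega>. W (restrict \<omega> {0..<Suc n})) \<in> borel_measurable (Pi\<^sub>M {0..<Suc (Suc n)} (\<lambda>_. S))"
      by (rule measurable_compose[OF measurable_restrict_subset W]) auto
    then have f: "(\<lambda>\<omega>. \<phi> (\<omega> (Suc n)) * W \<omega>) \<in> borel_measurable (Pi\<^sub>M {0..<Suc (Suc n)} (\<lambda>_. S))"
      unfolding W' by measurable
    have "(\<integral>\<^sup>+\<omega>. \<phi> (\<omega> (Suc n)) * W \<omega> \<partial>?C (Suc (Suc n))) =
        (\<integral>\<^sup>+\<omega>. \<integral>\<^sup>+\<omega>'. \<phi> (\<omega>' (Suc n)) * W \<omega>' \<partial>IT.eP (Suc n) \<omega> \<partial>?C (Suc n))"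
    proof -
      have "IT.eP (Suc n) \<in> ?C (Suc n) \<rightarrow>\<^sub>M subprob_algebra (Pi\<^sub>M {0..<Suc (Suc n)} (\<lambda>_. S))"
        using IT.measurable_eP[of "Suc n"] by (simp only: measurable_cong_sets[OF C_sets refl])
      moreover have "?C (Suc (Suc n)) = ?C (Suc n) \<bind> IT.eP (Suc n)" by simp
      ultimately show ?thesis by (simp only: nn_integral_bind[OF f])
    qed
    also have "\<dots> = (\<integral>\<^sup>+\<omega>. (\<integral>\<^sup>+z. \<phi> z \<partial>K (\<omega> n)) * W \<omega> \<partial>?C (Suc n))"
    proof (rule nn_integral_cong)
      fix \<omega> assume "\<omega> \<in> space (?C (Suc n))"
      then have \<omega>: "\<omega> \<in> space (Pi\<^sub>M {0..<Suc n} (\<lambda>_. S))" by (simp only: C_space)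
      then have "\<omega> n \<in> space S" by (auto simp: space_PiM PiE_iff)
      then have [measurable]: "\<phi> \<in> borel_measurable (K (\<omega> n))"
        using \<phi> by (simp add: measurable_cong_sets[OF prob_algebraD(2)[OF K_prob] refl])
      have "W (fun_upd \<omega> (Suc n) z) = W \<omega>" for z
      proof -
        have "restrict (fun_upd \<omega> (Suc n) z) {0..<Suc n} = restrict \<omega> {0..<Suc n}"
          by (auto simp: restrict_def)
        then show ?thesis using W' by metis
      qed
      then show "(\<integral>\<^sup>+\<omega>'. \<phi> (\<omega>' (Suc n)) * W \<omega>' \<partial>IT.eP (Suc n) \<omega>) = (\<integral>\<^sup>+z. \<phi> z \<partial>K (\<omega> n)) * W \<omega>"
        unfolding IT.nn_integral_eP[OF \<omega> f] by (simp add: path_step_def nn_integral_multc)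
    qed
    finally show ?thesis .
  qed
  \<comment> \<open>Coordinate \<open>n\<close> is the last of the marginal on \<open>Suc n\<close>
    coordinates; since coordinate 0 is the starting point, it carries the \<open>n\<close>-step
    law.\<close>
  have law: "(\<integral>\<^sup>+\<omega>. \<phi> (\<omega> n) \<partial>?C (Suc n)) = (\<integral>\<^sup>+y. \<phi> y \<partial>nstep S K n x)"
    if \<phi>: "\<phi> \<in> borel_measurable S" for \<phi> n
    using \<phi>
  proof (induction n arbitrary: \<phi>)
    case 0
    have f: "(\<lambda>\<omega>. \<phi> (\<omega> 0)) \<in> borel_measurable (Pi\<^sub>M {0..<Suc 0} (\<lambda>_. S))"
      using 0 by measurable
    have "(\<integral>\<^sup>+\<omega>. \<phi> (\<omega> 0) \<partial>?C (Suc 0)) = (\<integral>\<^sup>+\<omega>. \<phi> (\<omega> 0) \<partial>IT.eP 0 (\<lambda>_. undefined))"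
      using bind_return[OF IT.measurable_eP e0] by simp
    also have "\<dots> = (\<integral>\<^sup>+y. \<phi> y \<partial>nstep S K 0 x)"
      unfolding IT.nn_integral_eP[OF e0 f] by (simp add: path_step_def)
    finally show ?case .
  next
    case (Suc n)
    note [measurable] = Suc.prems
    have "(\<integral>\<^sup>+\<omega>. \<phi> (\<omega> (Suc n)) \<partial>?C (Suc (Suc n))) = (\<integral>\<^sup>+\<omega>. (\<integral>\<^sup>+z. \<phi> z \<partial>K (\<omega> n)) \<partial>?C (Suc n))"
      using C_step[OF Suc.prems, of "\<lambda>_. 1" n] by simp
    also have "\<dots> = (\<integral>\<^sup>+y. (\<integral>\<^sup>+z. \<phi> z \<partial>K y) \<partial>nstep S K n x)"
      by (rule Suc.IH) measurable
    also have "\<dots> = (\<integral>\<^sup>+y. \<phi> y \<partial>nstep S K (Suc n) x)"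
      unfolding nstep.simps by (rule prob_algebra_nn_integral_bind[OF nstep_prob[OF x] kernel Suc.prems, symmetric])
    finally show ?case .
  qed
  \<comment> \<open>The product stops before \<open>n + m\<close>, leaving the last coordinate to
    \<open>\<phi>\<close>; the induction can then absorb one factor by passing from
    \<open>\<phi>\<close> to \<open>taboo A \<phi>\<close>.\<close>
  have avoid: "(\<integral>\<^sup>+\<omega>. \<phi> (\<omega> (n + m)) * (\<Prod>k\<in>{n..<n + m}. indicator (- A) (\<omega> k)) \<partial>?C (Suc (n + m))) =
      (\<integral>\<^sup>+y. (taboo A ^^ m) \<phi> y \<partial>nstep S K n x)"
    if \<phi>: "\<phi> \<in> borel_measurable S" for \<phi>
    using \<phi>
  proof (induction m arbitrary: \<phi>)
    case 0
    then show ?case by (simp add: law del: IT.C.simps)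
  next
    case (Suc m)
    let ?W = "\<lambda>\<omega>. (\<Prod>k\<in>{n..<n + Suc m}. indicator (- A) (\<omega> k)) :: ennreal"
    have W: "?W \<in> borel_measurable (Pi\<^sub>M {0..<Suc (n + m)} (\<lambda>_. S))"
      by (intro borel_measurable_prod_ennreal measurable_compose[OF measurable_component_singleton]
            indicator_compl_measurable A) auto
    have "(\<integral>\<^sup>+\<omega>. \<phi> (\<omega> (n + Suc m)) * ?W \<omega> \<partial>?C (Suc (n + Suc m))) =
        (\<integral>\<^sup>+\<omega>. (\<integral>\<^sup>+z. \<phi> z \<partial>K (\<omega> (n + m))) * ?W \<omega> \<partial>?C (Suc (n + m)))"
      using C_step[OF Suc.prems W] by (simp del: IT.C.simps)
    also have "\<dots> = (\<integral>\<^sup>+\<omega>. taboo A \<phi> (\<omega> (n + m)) * (\<Prod>k\<in>{n..<n + m}. indicator (- A) (\<omega> k)) \<partial>?C (Suc (n + m)))"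
      by (rule nn_integral_cong) (simp add: taboo_def ac_simps)
    also have "\<dots> = (\<integral>\<^sup>+y. (taboo A ^^ m) (taboo A \<phi>) y \<partial>nstep S K n x)"
      by (rule Suc.IH) (rule taboo_measurable[OF A Suc.prems])
    finally show ?case by (simp only: funpow_Suc_right comp_apply)
  qed
  have mA[measurable]: "(\<lambda>\<omega>. \<omega> k) \<in> path_law S K x \<rightarrow>\<^sub>M S" for k
    by (subst measurable_cong_sets[OF sets refl]) simp
  have "emeasure (path_law S K x) {\<omega> \<in> space (path_law S K x). \<forall>k\<in>{n..n + m}. \<omega> k \<notin> A} =
      (\<integral>\<^sup>+\<omega>. indicator {\<omega> \<in> space (path_law S K x). \<forall>k\<in>{n..n + m}. \<omega> k \<notin> A} \<omega> \<partial>path_law S K x)"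
    by (rule nn_integral_indicator[symmetric]) measurable
  also have "\<dots> = (\<integral>\<^sup>+\<omega>. (\<Prod>k\<in>{n..<Suc (n + m)}. indicator (- A) (restrict \<omega> {0..<Suc (n + m)} k)) \<partial>path_law S K x)"
  proof (rule nn_integral_cong)
    fix \<omega> assume \<omega>: "\<omega> \<in> space (path_law S K x)"
    have "(\<Prod>k\<in>{n..<Suc (n + m)}. indicator (- A) (restrict \<omega> {0..<Suc (n + m)} k)) =
        (\<Prod>k\<in>{n..<Suc (n + m)}. indicator (- A) (\<omega> k) :: ennreal)"
      by (rule prod.cong) auto
    also have "\<dots> = indicator {\<omega> \<in> space (path_law S K x). \<forall>k\<in>{n..n + m}. \<omega> k \<notin> A} \<omega>"
    proof (cases "\<forall>k\<in>{n..n + m}. \<omega> k \<notin> A")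
      case False
      then obtain k where "k \<in> {n..<Suc (n + m)}" "\<omega> k \<in> A" by (auto simp: less_Suc_eq_le)
      then have "(\<Prod>k\<in>{n..<Suc (n + m)}. indicator (- A) (\<omega> k) :: ennreal) = 0"
        by (intro prod_zero) (auto intro!: bexI[of _ k])
      with False show ?thesis by simp
    qed (use \<omega> in \<open>auto intro!: prod.neutral\<close>)
    finally show "indicator {\<omega> \<in> space (path_law S K x). \<forall>k\<in>{n..n + m}. \<omega> k \<notin> A} \<omega> =
        (\<Prod>k\<in>{n..<Suc (n + m)}. indicator (- A) (restrict \<omega> {0..<Suc (n + m)} k) :: ennreal)" ..
  qed
  also have "\<dots> = (\<integral>\<^sup>+\<omega>. (\<Prod>k\<in>{n..<Suc (n + m)}. indicator (- A) (\<omega> k)) \<partial>?C (Suc (n + m)))"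
    unfolding distr_C[symmetric] lim
    by (rule nn_integral_distr[symmetric, OF restr])
       (intro borel_measurable_prod_ennreal measurable_compose[OF measurable_component_singleton]
          indicator_compl_measurable A; auto)
  also have "\<dots> = (\<integral>\<^sup>+\<omega>. indicator (- A) (\<omega> (n + m)) * (\<Prod>k\<in>{n..<n + m}. indicator (- A) (\<omega> k)) \<partial>?C (Suc (n + m)))"
    by (simp add: ac_simps del: IT.C.simps)
  also have "\<dots> = (\<integral>\<^sup>+y. (taboo A ^^ m) (indicator (- A)) y \<partial>nstep S K n x)"
    by (rule avoid) measurable
  finally show "emeasure (path_law S K x) {\<omega> \<in> space (path_law S K x). \<forall>k\<in>{n..n + m}. \<omega> k \<notin> A} =
      (\<integral>\<^sup>+y. (taboo A ^^ m) (indicator (- A)) y \<partial>nstep S K n x)" .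
qed

end

context harris_kernel
begin

text \<open>Invariance writes the mass of \<open>A\<close> as the mean of the \<open>n\<close>-step
  probabilities of being in it. If that mass were 0, almost every state would have probability 0 for
  all \<open>n\<close> at once.\<close>

lemma stationary_measure_pos:
  assumes st: "stationary S K \<pi>" and A: "A \<in> sets S"
    and irr: "\<And>y. y \<in> space S \<Longrightarrow> \<exists>n. measure (nstep S K n y) A > 0"
  shows "measure \<pi> A > 0"
proof (rule ccontr)
  assume "\<not> measure \<pi> A > 0"
  then have 0: "measure \<pi> A = 0" by (simp add: zero_less_measure_iff)
  have \<pi>: "\<pi> \<in> space (prob_algebra S)" using st by (simp add: stationary_iff)
  interpret prob_space \<pi> by (rule prob_algebraD[OF \<pi>])
  have "AE y in \<pi>. \<forall>n. measure (nstep S K n y) A = 0"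
    unfolding AE_all_countable
  proof
    fix n
    have iA: "integrable \<pi> (\<lambda>y. measure (nstep S K n y) A)"
      by (rule kernel_measure_integrable[OF \<pi> nstep_measurable A])
    have "(\<integral>y. measure (nstep S K n y) A \<partial>\<pi>) = 0"
      using prob_algebra_measure_bind[OF \<pi> nstep_measurable A, of n] stationary_bind_nstep[OF st, of n] 0 by simp
    then show "AE y in \<pi>. measure (nstep S K n y) A = 0"
      using integral_nonneg_eq_0_iff_AE[OF iA] by simp
  qed
  with AE_space have "AE y in \<pi>. False"
  proof eventually_elim
    case (elim y)
    then obtain n where "measure (nstep S K n y) A > 0"
      using irr[of y] prob_algebraD(3)[OF \<pi>] by auto
    with elim show ?case by simp
  qed
  then show False by simp
qed

text \<open>
  A bounded function \<open>g\<close> with \<open>g \<le> K g\<close> satisfies \<open>g \<le> K\<^sup>n g\<close>, so by ergodicity it is dominated by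
  its mean under the stationary law, with equality almost everywhere.
\<close>
lemma subharmonic_eq_0:
  fixes g :: "'b \<Rightarrow> real"
  assumes erg: "ergodic S K \<pi>" and g[measurable]: "g \<in> borel_measurable S"
    and g01: "\<And>y. y \<in> space S \<Longrightarrow> 0 \<le> g y \<and> g y \<le> 1"
    and sub: "\<And>y. y \<in> space S \<Longrightarrow> g y \<le> (\<integral>z. g z \<partial>K y)"
    and A: "A \<in> sets S" "measure \<pi> A > 0" and gA: "\<And>y. y \<in> A \<Longrightarrow> g y = 0"
    and x: "x \<in> space S"
  shows "g x = 0"
proof -
  have st: "stationary S K \<pi>" using erg by (simp add: ergodic_def)
  have \<pi>: "\<pi> \<in> space (prob_algebra S)" using st by (simp add: stationary_iff)
  interpret prob_space \<pi> by (rule prob_algebraD[OF \<pi>])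
  have gabs: "\<bar>g z\<bar> \<le> 1" if "z \<in> space S" for z using g01[OF that] by simp
  let ?c = "\<integral>z. g z \<partial>\<pi>"
  have Kg: "(\<lambda>y. \<integral>z. g z \<partial>K y) \<in> borel_measurable S"
    by (rule measurable_compose[OF measurable_prob_algebraD[OF kernel] integral_measurable_subprob_algebra[OF g]])
  have Kg1: "\<bar>\<integral>z. g z \<partial>K y\<bar> \<le> 1" if "y \<in> space S" for y
    by (rule prob_algebra_integrable(2)[OF K_prob[OF that] g gabs])
  have le_n: "g y \<le> (\<integral>z. g z \<partial>nstep S K n y)" if y: "y \<in> space S" for y n
  proof (induction n)
    case 0
    then show ?case using y by (simp add: integral_return)
  next
    case (Suc n)
    note \<rho> = nstep_prob[OF y, of n]
    have "(\<integral>z. g z \<partial>nstep S K n y) \<le> (\<integral>w. (\<integral>z. g z \<partial>K w) \<partial>nstep S K n y)"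
      using sub prob_algebraD(3)[OF \<rho>]
      by (intro integral_mono prob_algebra_integrable(1)[OF \<rho> g gabs] prob_algebra_integrable(1)[OF \<rho> Kg Kg1]) auto
    also have "\<dots> = (\<integral>z. g z \<partial>nstep S K (Suc n) y)"
      unfolding nstep.simps by (rule prob_algebra_integral_bind[OF \<rho> kernel g gabs, symmetric])
    finally show ?case using Suc by linarith
  qed
  have le_c: "g y \<le> ?c" if y: "y \<in> space S" for y
  proof (rule LIMSEQ_le_const)
    let ?d = "\<lambda>n. tv_dist S (nstep S K n y) \<pi>"
    have "return S y \<in> space (prob_algebra S)"
      using y by (simp add: space_prob_algebra prob_space_return)
    moreover have "return S y \<bind> nstep S K n = nstep S K n y" for n
      by (rule bind_return[OF measurable_prob_algebraD[OF nstep_measurable] y])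
    ultimately have "?d \<longlonglongrightarrow> 0" using erg by (auto simp: ergodic_def)
    from tendsto_add[OF tendsto_const this] show "(\<lambda>n. ?c + ?d n) \<longlonglongrightarrow> ?c" by simp
    have "g y \<le> ?c + ?d n" for n
      using le_n[OF y, of n]
        abs_integral_diff_le[OF nstep_prob[OF y] \<pi> g g01 measure_diff_le_tv_dist[OF nstep_prob[OF y] \<pi>], of n]
      by (simp add: abs_le_iff)
    then show "\<exists>N. \<forall>n\<ge>N. g y \<le> ?c + ?d n" by blast
  qed
  have ig: "integrable \<pi> g" by (rule prob_algebra_integrable(1)[OF \<pi> g gabs])
  have A': "A \<in> sets \<pi>" using A prob_algebraD(2)[OF \<pi>] by simp
  have iA: "integrable \<pi> (\<lambda>y. ?c * indicator A y)"
    using A' by (intro integrable_mult_right integrable_real_indicator) (simp_all add: less_top[symmetric])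
  have "0 \<le> ?c" using g01[OF x] le_c[OF x] by simp
  \<comment> \<open>\<open>g\<close> is at most its mean \<open>?c\<close> everywhere and 0 on
    \<open>A\<close>, so the mean of \<open>?c - g\<close>, which is 0, is at least
    \<open>?c\<close> times the mass of \<open>A\<close>.\<close>
  have "?c * measure \<pi> A = (\<integral>y. ?c * indicator A y \<partial>\<pi>)"
    using A' sets.sets_into_space[OF A'] by (simp add: Int_absorb2)
  also have "\<dots> \<le> (\<integral>y. ?c - g y \<partial>\<pi>)"
    using iA ig le_c gA prob_algebraD(3)[OF \<pi>] by (intro integral_mono) (auto split: split_indicator)
  also have "\<dots> = 0" using ig by (simp add: prob_space)
  finally have "?c \<le> 0" using A(2) by (simp add: mult_le_0_iff)
  then show ?thesis using le_c[OF x] g01[OF x] by linarith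
qed

text \<open>The limit \<open>h\<close> of the avoidance probabilities is the probability of never
  visiting \<open>A\<close>; it vanishes on \<open>A\<close> and is at most its own mean after one
  step, hence is 0 by \<open>subharmonic_eq_0\<close>. Applied under the law at each time
  \<open>n\<close>, this gives a visit at or after every \<open>n\<close>, so infinitely
  many.\<close>

lemma path_recurrent:
  assumes A[measurable]: "A \<in> sets S"
    and irr: "\<And>y. y \<in> space S \<Longrightarrow> \<exists>n. measure (nstep S K n y) A > 0"
    and x: "x \<in> space S"
  shows "\<P>(\<omega> in path_law S K x. infinite {n. 1 \<le> n \<and> \<omega> n \<in> A}) = 1"
proof -
  obtain \<pi> where st: "stationary S K \<pi>" and erg: "ergodic S K \<pi>" by (rule ergodic_and_unique)
  have \<pi>A: "measure \<pi> A > 0" by (rule stationary_measure_pos[OF st A irr])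
  define g where "g m = (taboo A ^^ m) (indicator (- A))" for m
  have g_Suc: "g (Suc m) y = indicator (- A) y * (\<integral>\<^sup>+z. g m z \<partial>K y)" for m y
    by (simp add: g_def taboo_def)
  have gm[measurable]: "g m \<in> borel_measurable S" for m
    unfolding g_def by (rule taboo_funpow_measurable[OF A indicator_compl_measurable[OF A]])
  have g1: "g m y \<le> 1" if "y \<in> space S" for m y
    using that
  proof (induction m arbitrary: y)
    case (Suc m)
    have "(\<integral>\<^sup>+z. g m z \<partial>K y) \<le> (\<integral>\<^sup>+z. 1 \<partial>K y)"
      using Suc prob_algebraD(3)[OF K_prob[OF Suc.prems]] by (intro nn_integral_mono) auto
    also have "\<dots> = 1" using prob_space.emeasure_space_1[OF prob_algebraD(1)[OF K_prob[OF Suc.prems]]] by simp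
    finally show ?case by (auto simp: g_Suc split: split_indicator)
  qed (auto simp: g_def split: split_indicator)
  have dec: "g (Suc m) y \<le> g m y" if "y \<in> space S" for m y
    using that
  proof (induction m arbitrary: y)
    case 0
    have "(\<integral>\<^sup>+z. g 0 z \<partial>K y) \<le> (\<integral>\<^sup>+z. 1 \<partial>K y)"
      using g1 prob_algebraD(3)[OF K_prob[OF 0]] by (intro nn_integral_mono) auto
    also have "\<dots> = 1" using prob_space.emeasure_space_1[OF prob_algebraD(1)[OF K_prob[OF 0]]] by simp
    finally show ?case by (subst g_Suc) (auto simp: g_def split: split_indicator)
  next
    case (Suc m)
    have "(\<integral>\<^sup>+z. g (Suc m) z \<partial>K y) \<le> (\<integral>\<^sup>+z. g m z \<partial>K y)"
      using Suc.IH prob_algebraD(3)[OF K_prob[OF Suc.prems]] by (intro nn_integral_mono) auto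
    then show ?case by (subst (1 2) g_Suc) (auto split: split_indicator)
  qed
  have dec': "decseq (\<lambda>m. g m y)" if "y \<in> space S" for y
    using dec[OF that] by (rule decseq_SucI)
  define h where "h y = (INF m. g m y)" for y
  have h[measurable]: "h \<in> borel_measurable S" unfolding h_def[abs_def] by measurable
  have h1: "h y \<le> 1" if "y \<in> space S" for y
    unfolding h_def by (rule INF_lower2[of 0]) (auto intro: g1[OF that])
  have INF_int: "(INF m. \<integral>\<^sup>+z. g m z \<partial>\<rho>) = (\<integral>\<^sup>+z. h z \<partial>\<rho>)" if \<rho>: "\<rho> \<in> space (prob_algebra S)" for \<rho>
    unfolding h_def
  proof (rule nn_integral_monotone_convergence_INF_AE'[symmetric])
    show "AE z in \<rho>. g (Suc m) z \<le> g m z" for m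
      using dec prob_algebraD(3)[OF \<rho>] by (intro AE_I2) auto
    show "g m \<in> borel_measurable \<rho>" for m
      by (simp add: measurable_cong_sets[OF prob_algebraD(2)[OF \<rho>] refl])
    have "(\<integral>\<^sup>+z. g 0 z \<partial>\<rho>) \<le> (\<integral>\<^sup>+z. 1 \<partial>\<rho>)"
      using g1 prob_algebraD(3)[OF \<rho>] by (intro nn_integral_mono) auto
    also have "\<dots> < \<infinity>" using prob_space.emeasure_space_1[OF prob_algebraD(1)[OF \<rho>]] by simp
    finally show "(\<integral>\<^sup>+z. g 0 z \<partial>\<rho>) < \<infinity>" .
  qed
  have h_sub: "h y \<le> (\<integral>\<^sup>+z. h z \<partial>K y)" if y: "y \<in> space S" for y
    unfolding INF_int[OF K_prob[OF y], symmetric]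
  proof (rule INF_greatest)
    fix m
    have "h y \<le> g (Suc m) y" unfolding h_def by (rule INF_lower) simp
    also have "\<dots> \<le> (\<integral>\<^sup>+z. g m z \<partial>K y)" by (auto simp: g_Suc split: split_indicator)
    finally show "h y \<le> (\<integral>\<^sup>+z. g m z \<partial>K y)" .
  qed
  have h0: "h y = 0" if y: "y \<in> space S" for y
  proof -
    have eh: "ennreal (enn2real (h z)) = h z" if "z \<in> space S" for z
      using h1[OF that] by (intro ennreal_enn2real) (auto intro: order.strict_trans1)
    have h01: "0 \<le> enn2real (h z) \<and> enn2real (h z) \<le> 1" if "z \<in> space S" for z
      using h1[OF that] by (auto intro: enn2real_leI)
    have "enn2real (h y) = 0"
    proof (rule subharmonic_eq_0[OF erg _ h01 _ A \<pi>A _ y])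
      show "enn2real (h z) \<le> (\<integral>w. enn2real (h w) \<partial>K z)" if z: "z \<in> space S" for z
      proof -
        have hm: "(\<lambda>w. enn2real (h w)) \<in> borel_measurable S" by measurable
        have i: "integrable (K z) (\<lambda>w. enn2real (h w))"
          by (rule prob_algebra_integrable(1)[OF K_prob[OF z] hm, of 1]) (use h01 in force)
        have "(\<integral>\<^sup>+w. h w \<partial>K z) = (\<integral>\<^sup>+w. ennreal (enn2real (h w)) \<partial>K z)"
          using eh prob_algebraD(3)[OF K_prob[OF z]] by (intro nn_integral_cong) auto
        also have "\<dots> = ennreal (\<integral>w. enn2real (h w) \<partial>K z)"
          by (rule nn_integral_eq_integral[OF i]) simp
        finally show ?thesis using h_sub[OF z] by (intro enn2real_leI) auto
      qed
      show "enn2real (h z) = 0" if "z \<in> A" for z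
      proof -
        have "h z \<le> g 0 z" unfolding h_def by (rule INF_lower) simp
        then show ?thesis using that by (simp add: g_def)
      qed
    qed measurable
    then show ?thesis using eh[OF y] by simp
  qed
  let ?L = "path_law S K x"
  interpret L: prob_space ?L by (rule path_law_avoid(1)[OF x A])
  have coord[measurable]: "(\<lambda>\<omega>. \<omega> k) \<in> ?L \<rightarrow>\<^sub>M S" for k
    by (subst measurable_cong_sets[OF path_law_avoid(2)[OF x A] refl]) simp
  have avoid0: "AE \<omega> in ?L. \<exists>k\<ge>n. \<omega> k \<in> A" for n
  proof -
    let ?N = "{\<omega> \<in> space ?L. \<forall>k\<ge>n. \<omega> k \<notin> A}"
    have "emeasure ?L ?N \<le> (INF m. \<integral>\<^sup>+z. g m z \<partial>nstep S K n x)"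
    proof (rule INF_greatest)
      fix m
      have "emeasure ?L ?N \<le> emeasure ?L {\<omega> \<in> space ?L. \<forall>k\<in>{n..n + m}. \<omega> k \<notin> A}"
        by (rule emeasure_mono) auto
      then show "emeasure ?L ?N \<le> (\<integral>\<^sup>+z. g m z \<partial>nstep S K n x)"
        by (simp only: path_law_avoid(3)[OF x A] g_def)
    qed
    also have "\<dots> = (\<integral>\<^sup>+z. h z \<partial>nstep S K n x)" by (rule INF_int[OF nstep_prob[OF x]])
    also have "\<dots> = (\<integral>\<^sup>+z. 0 \<partial>nstep S K n x)"
      using h0 prob_algebraD(3)[OF nstep_prob[OF x]] by (intro nn_integral_cong) auto
    finally have "emeasure ?L ?N = 0" by simp
    then show ?thesis by (intro AE_I[of _ _ ?N]) auto
  qed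
  have "AE \<omega> in ?L. infinite {n. 1 \<le> n \<and> \<omega> n \<in> A}"
  proof -
    have "AE \<omega> in ?L. \<forall>n. \<exists>k\<ge>n. \<omega> k \<in> A" using avoid0 by (simp add: AE_all_countable)
    then show ?thesis
    proof eventually_elim
      case (elim \<omega>)
      show ?case
        unfolding infinite_nat_iff_unbounded_le
      proof
        fix m
        \<comment> \<open>The maximum with 1 discards the visit at time 0, which is not
          counted.\<close>
        from elim obtain k where "k \<ge> max 1 m" "\<omega> k \<in> A" by blast
        then show "\<exists>n\<ge>m. n \<in> {n. 1 \<le> n \<and> \<omega> n \<in> A}" by (intro exI[of _ k]) auto
      qed
    qed
  qed
  moreover have "{\<omega> \<in> space ?L. infinite {n. 1 \<le> n \<and> \<omega> n \<in> A}} \<in> sets ?L"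
    unfolding infinite_nat_iff_unbounded_le by measurable
  ultimately show ?thesis by (simp add: L.prob_Collect_eq_1)
qed

end

section \<open>The intensity kernel\<close>

locale intensity_parameters =
  fixes \<mu> \<alpha> \<beta> :: real
  assumes \<mu>: "0 < \<mu>" and \<alpha>: "0 < \<alpha>" and \<beta>: "0 < \<beta>"
begin

abbreviation "S \<equiv> state_space \<mu>"
abbreviation "\<Psi> \<equiv> Phi \<mu> \<alpha> \<beta>"
abbreviation "T x y \<equiv> Phi_inv \<mu> \<alpha> \<beta> y x"

definition nxt :: "real \<Rightarrow> real \<Rightarrow> real" where
  "nxt x y = \<mu> + (x - \<mu> + \<alpha>) * exp (- \<beta> * T x y)"

lemma space_S: "space S = {\<mu>..}"
  by (simp add: state_space_def space_restrict_space)

lemma sets_S_iff: "B \<in> sets S \<longleftrightarrow> B \<in> sets borel \<and> B \<subseteq> {\<mu>..}"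
  by (auto simp: state_space_def sets_restrict_space_iff)

section \<open>The compensator, its inverse in time and the step map\<close>

lemma Phi_0: "\<Psi> 0 x = 0"
  by (simp add: Phi_def)

lemma Phi_strict_mono:
  assumes "\<mu> \<le> x" "s < t"
  shows "\<Psi> s x < \<Psi> t x"
proof -
  have "(1 - exp (- \<beta> * s)) / \<beta> \<le> (1 - exp (- \<beta> * t)) / \<beta>"
    using assms \<beta> by (simp add: divide_right_mono)
  then have "(x - \<mu> + \<alpha>) * ((1 - exp (- \<beta> * s)) / \<beta>) \<le> (x - \<mu> + \<alpha>) * ((1 - exp (- \<beta> * t)) / \<beta>)"
    using assms \<alpha> by (intro mult_left_mono) auto
  moreover have "\<mu> * s < \<mu> * t" using assms \<mu> by simp
  ultimately show ?thesis by (simp add: Phi_def)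
qed

lemma Phi_le_iff: "\<mu> \<le> x \<Longrightarrow> \<Psi> s x \<le> \<Psi> t x \<longleftrightarrow> s \<le> t"
  using Phi_strict_mono[of x s t] Phi_strict_mono[of x t s] by (cases s t rule: linorder_cases) auto

lemma Phi_ge:
  assumes "\<mu> \<le> x" "0 \<le> t"
  shows "\<mu> * t \<le> \<Psi> t x"
proof -
  have "0 \<le> (x - \<mu> + \<alpha>) * ((1 - exp (- \<beta> * t)) / \<beta>)"
    using assms \<alpha> \<beta> by (intro mult_nonneg_nonneg) auto
  then show ?thesis unfolding Phi_def by linarith
qed

lemma Phi_mono_state:
  assumes "x \<le> x'" "0 \<le> t"
  shows "\<Psi> t x \<le> \<Psi> t x'"
proof -
  have "0 \<le> (1 - exp (- \<beta> * t)) / \<beta>" using assms \<beta> by simp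
  then show ?thesis unfolding Phi_def using assms by (intro add_left_mono mult_right_mono) auto
qed

lemma Phi_inv:
  assumes x: "\<mu> \<le> x" and y: "0 \<le> y"
  shows "0 \<le> T x y" and "\<Psi> (T x y) x = y"
proof -
  have "\<exists>t\<ge>0. t \<le> y / \<mu> \<and> \<Psi> t x = y"
  proof (rule IVT')
    show "\<Psi> 0 x \<le> y" using y by (simp add: Phi_0)
    show "y \<le> \<Psi> (y / \<mu>) x" using Phi_ge[OF x, of "y / \<mu>"] \<mu> y by simp
    show "0 \<le> y / \<mu>" using \<mu> y by simp
    show "continuous_on {0..y / \<mu>} (\<lambda>t. \<Psi> t x)"
      unfolding Phi_def using \<beta> by (intro continuous_intros) auto
  qed
  then have "y \<in> (\<lambda>t. \<Psi> t x) ` {0..}" by auto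
  moreover have inj: "inj_on (\<lambda>t. \<Psi> t x) {0..}"
    using Phi_strict_mono[OF x] by (intro linorder_inj_onI) (auto simp: less_imp_neq)
  ultimately show "0 \<le> T x y" "\<Psi> (T x y) x = y"
    using the_inv_into_into[OF inj, of y "{0..}"] f_the_inv_into_f[OF inj, of y]
    by (auto simp: Phi_inv_def)
qed

text \<open>A Galois connection between \<open>T\<close> and \<open>\<Psi>\<close> in the time
  variable. Bounds, monotonicity and measurability of the inverse are derived through it.\<close>

lemma Phi_inv_le_iff: "\<mu> \<le> x \<Longrightarrow> 0 \<le> y \<Longrightarrow> T x y \<le> t \<longleftrightarrow> y \<le> \<Psi> t x"
  using Phi_le_iff[of x "T x y" t] Phi_inv(2)[of x y] by simp

lemma Phi_inv_Phi:
  assumes "\<mu> \<le> x" "0 \<le> t"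
  shows "T x (\<Psi> t x) = t"
proof -
  have "0 \<le> \<Psi> t x" using Phi_ge[OF assms] \<mu> assms(2) by (auto intro: order_trans[of 0 "\<mu> * t"])
  then have "T x (\<Psi> t x) \<le> s \<longleftrightarrow> t \<le> s" for s
    using Phi_inv_le_iff[OF assms(1)] Phi_le_iff[OF assms(1)] by simp
  from this[of t] this[of "T x (\<Psi> t x)"] show ?thesis by simp
qed

lemma Phi_inv_le: "\<mu> \<le> x \<Longrightarrow> 0 \<le> y \<Longrightarrow> T x y \<le> y / \<mu>"
  using Phi_inv_le_iff[of x y "y / \<mu>"] Phi_ge[of x "y / \<mu>"] \<mu> by simp

lemma Phi_inv_antimono:
  assumes "\<mu> \<le> x" "x \<le> x'" "0 \<le> y"
  shows "T x' y \<le> T x y"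
proof -
  have "y = \<Psi> (T x y) x" using assms Phi_inv(2)[of x y] by simp
  also have "\<dots> \<le> \<Psi> (T x y) x'" using assms by (intro Phi_mono_state Phi_inv(1)) auto
  finally show ?thesis using assms Phi_inv_le_iff[of x' y] by simp
qed

lemma Phi_inv_mono: "\<mu> \<le> x \<Longrightarrow> 0 \<le> y \<Longrightarrow> y \<le> y' \<Longrightarrow> T x y \<le> T x y'"
  using Phi_inv_le_iff[of x y] Phi_inv(2)[of x y'] by simp

text \<open>The recursion telescopes: durations are recovered from increments of the intensity.\<close>
lemma nxt_eq:
  assumes "\<mu> \<le> x" "0 \<le> y"
  shows "nxt x y = x + \<alpha> - \<beta> * y + \<beta> * \<mu> * T x y"
proof -
  have "\<beta> * y = \<beta> * \<Psi> (T x y) x" using Phi_inv(2)[OF assms] by simp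
  also have "\<dots> = \<beta> * \<mu> * T x y + (x - \<mu> + \<alpha>) * (1 - exp (- \<beta> * T x y))"
    using \<beta> unfolding Phi_def distrib_left by simp
  finally show ?thesis by (simp add: nxt_def algebra_simps)
qed

lemma nxt_gt: "\<mu> \<le> x \<Longrightarrow> \<mu> < nxt x y"
  using \<alpha> by (simp add: nxt_def)

lemma nxt_le:
  assumes "\<mu> \<le> x" "0 \<le> y"
  shows "nxt x y \<le> x + \<alpha>"
proof -
  have "\<beta> * (\<mu> * T x y) \<le> \<beta> * y"
    using Phi_inv_le[OF assms] \<mu> \<beta> by (simp add: pos_le_divide_eq mult.commute)
  then show ?thesis using nxt_eq[OF assms] by simp
qed

text \<open>As \<open>y\<close> grows, \<open>nxt x y\<close> decreases although the term with
  \<open>T\<close> in \<open>nxt_eq\<close> increases, so its slope lies between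
  \<open>- \<beta>\<close> and 0. The Lipschitz bound is what carries null sets of innovations to
  null sets of states.\<close>

lemma nxt_Lipschitz:
  assumes x: "\<mu> \<le> x" and y: "0 \<le> y" "0 \<le> y'"
  shows "\<bar>nxt x y - nxt x y'\<bar> \<le> \<beta> * \<bar>y - y'\<bar>"
proof -
  have *: "\<bar>nxt x y - nxt x y'\<bar> \<le> \<beta> * \<bar>y - y'\<bar>" if y: "0 \<le> y" "y \<le> y'" for y y'
  proof -
    have T: "T x y \<le> T x y'" using x y by (rule Phi_inv_mono)
    have y': "0 \<le> y'" using y by simp
    have "nxt x y' \<le> nxt x y"
      using T x \<alpha> \<beta> unfolding nxt_def by (intro add_left_mono mult_left_mono) auto
    moreover have "\<beta> * \<mu> * T x y \<le> \<beta> * \<mu> * T x y'" using T \<mu> \<beta> by simp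
    ultimately show ?thesis
      using nxt_eq[OF x y(1)] nxt_eq[OF x y'] y by (simp add: abs_if algebra_simps)
  qed
  show ?thesis
    using *[of y y'] *[of y' y] y by (cases "y \<le> y'") (auto simp: abs_minus_commute)
qed

section \<open>The coordinate in which transition laws are translates\<close>

text \<open>Between arrivals \<open>w\<close>, the intensity above \<open>\<mu>\<close>, decays at
  rate \<open>\<beta> * w\<close> while the compensator grows at rate \<open>\<mu> + w\<close>. So
  an antiderivative of \<open>(\<mu> + w) / (\<beta> * w)\<close> falls by exactly the innovation
  consumed, and \<open>pot\<close> is such an antiderivative.\<close>

definition pot :: "real \<Rightarrow> real" where
  "pot w = (\<mu> * ln w + w) / \<beta>"

lemma pot_strict_mono: "0 < w \<Longrightarrow> w < w' \<Longrightarrow> pot w < pot w'"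
  using \<mu> \<beta> by (simp add: pot_def divide_strict_right_mono add_strict_mono)

lemma pot_mono: "0 < w \<Longrightarrow> w \<le> w' \<Longrightarrow> pot w \<le> pot w'"
  using pot_strict_mono[of w w'] by (cases "w = w'") auto

lemma pot_nxt:
  assumes x: "\<mu> \<le> x" and y: "0 \<le> y"
  shows "pot (nxt x y - \<mu>) = pot (x - \<mu> + \<alpha>) - y"
proof -
  have u: "0 < x - \<mu> + \<alpha>" using x \<alpha> by simp
  have "\<beta> * pot (nxt x y - \<mu>) = \<mu> * (ln (x - \<mu> + \<alpha>) - \<beta> * T x y) + (nxt x y - \<mu>)"
    using \<beta> u by (simp add: pot_def nxt_def ln_mult)
  also have "\<dots> = \<mu> * ln (x - \<mu> + \<alpha>) + (x - \<mu> + \<alpha>) - \<beta> * y"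
    using nxt_eq[OF x y] by (simp add: algebra_simps)
  also have "\<dots> = \<beta> * (pot (x - \<mu> + \<alpha>) - y)"
    using \<beta> by (simp add: pot_def right_diff_distrib)
  finally show ?thesis using \<beta> by simp
qed

text \<open>\<open>s\<close> is the extra innovation that the higher state consumes in order to
  reach the same point: both next states get the same potential, and \<open>pot\<close> is injective
  on positive arguments.\<close>

lemma nxt_shift:
  assumes x: "\<mu> \<le> x" and x': "x \<le> x'" and y: "0 \<le> y"
  defines "s \<equiv> pot (x' - \<mu> + \<alpha>) - pot (x - \<mu> + \<alpha>)"
  shows "nxt x' (y + s) = nxt x y" and "0 \<le> s"
proof -
  show s: "0 \<le> s" using pot_mono[of "x - \<mu> + \<alpha>" "x' - \<mu> + \<alpha>"] x x' \<alpha> by (simp add: s_def)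
  have x'': "\<mu> \<le> x'" and ys: "0 \<le> y + s" using x x' y s by auto
  have "pot (nxt x' (y + s) - \<mu>) = pot (nxt x y - \<mu>)"
    using pot_nxt[OF x y] pot_nxt[OF x'' ys] by (simp add: s_def)
  then show "nxt x' (y + s) = nxt x y"
    using pot_strict_mono[of "nxt x y - \<mu>" "nxt x' (y + s) - \<mu>"]
      pot_strict_mono[of "nxt x' (y + s) - \<mu>" "nxt x y - \<mu>"] nxt_gt[OF x, of y] nxt_gt[OF x'', of "y + s"]
    by (cases "nxt x y" "nxt x' (y + s)" rule: linorder_cases) auto
qed

lemma nxt_surj:
  assumes x: "\<mu> \<le> x" and b: "\<mu> < b" "b < x + \<alpha>"
  obtains y where "0 < y" "nxt x y = b"
proof -
  define u where "u = x - \<mu> + \<alpha>"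
  have u: "0 < u" "b - \<mu> < u" using x b \<alpha> by (auto simp: u_def)
  \<comment> \<open>The time after which an excess \<open>u\<close> over \<open>\<mu>\<close> has
    decayed to \<open>b - \<mu>\<close>; the witness is the compensator at that time.\<close>
  define t where "t = ln (u / (b - \<mu>)) / \<beta>"
  have t: "0 < t" using u b \<beta> by (simp add: t_def)
  have "exp (- \<beta> * t) = (b - \<mu>) / u"
    using u b \<beta> by (simp add: t_def exp_minus)
  then have "nxt x (\<Psi> t x) = b"
    using u t by (simp add: nxt_def Phi_inv_Phi[OF x] u_def[symmetric])
  moreover have "0 < \<Psi> t x" using Phi_strict_mono[OF x t] by (simp add: Phi_0)
  ultimately show thesis by (rule that[rotated])
qed

text \<open>By \<open>Phi_inv_le_iff\<close>, sublevel sets of the inverse are cut out by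
  \<open>snd p \<le> \<Psi> t (fst p)\<close>. The value 0 off the domain makes the function total
  on the plane.\<close>

lemma borel_measurable_duration:
  "(\<lambda>p. if \<mu> \<le> fst p \<and> 0 \<le> snd p then T (fst p) (snd p) else 0) \<in> borel_measurable (borel \<Otimes>\<^sub>M borel)"
proof (rule borel_measurableI_le)
  fix t :: real
  have [measurable]: "(\<lambda>x. \<Psi> t x) \<in> borel_measurable borel" unfolding Phi_def by measurable
  have "{p \<in> space (borel \<Otimes>\<^sub>M borel). (if \<mu> \<le> fst p \<and> 0 \<le> snd p then T (fst p) (snd p) else 0) \<le> t} =
    {p \<in> space (borel \<Otimes>\<^sub>M borel). if \<mu> \<le> fst p \<and> 0 \<le> snd p then snd p \<le> \<Psi> t (fst p) else 0 \<le> t}"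
    by (auto simp: Phi_inv_le_iff)
  also have "\<dots> \<in> sets (borel \<Otimes>\<^sub>M borel)" by measurable
  finally show "{p \<in> space (borel \<Otimes>\<^sub>M borel). (if \<mu> \<le> fst p \<and> 0 \<le> snd p then T (fst p) (snd p) else 0) \<le> t}
      \<in> sets (borel \<Otimes>\<^sub>M borel)" .
qed

lemma measurable_duration:
  assumes [measurable]: "X \<in> borel_measurable N" "Y \<in> borel_measurable N"
    and "\<And>\<omega>. \<omega> \<in> space N \<Longrightarrow> \<mu> \<le> X \<omega> \<and> 0 \<le> Y \<omega>"
  shows "(\<lambda>\<omega>. T (X \<omega>) (Y \<omega>)) \<in> borel_measurable N"
proof -
  have "(\<lambda>\<omega>. (X \<omega>, Y \<omega>)) \<in> N \<rightarrow>\<^sub>M borel \<Otimes>\<^sub>M borel" by measurable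
  from measurable_compose[OF this borel_measurable_duration] show ?thesis
    by (rule measurable_cong[THEN iffD1, rotated]) (use assms in auto)
qed

lemma measurable_nxt:
  assumes [measurable]: "X \<in> borel_measurable N" "Y \<in> borel_measurable N"
    and "\<And>\<omega>. \<omega> \<in> space N \<Longrightarrow> \<mu> \<le> X \<omega> \<and> 0 \<le> Y \<omega>"
  shows "(\<lambda>\<omega>. nxt (X \<omega>) (Y \<omega>)) \<in> N \<rightarrow>\<^sub>M S"
  unfolding state_space_def
proof (rule measurable_restrict_space2)
  have [measurable]: "(\<lambda>\<omega>. T (X \<omega>) (Y \<omega>)) \<in> borel_measurable N"
    using assms by (rule measurable_duration)
  show "(\<lambda>\<omega>. nxt (X \<omega>) (Y \<omega>)) \<in> borel_measurable N" unfolding nxt_def by measurable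
  show "(\<lambda>\<omega>. nxt (X \<omega>) (Y \<omega>)) \<in> space N \<rightarrow> {\<mu>..}"
    using nxt_gt assms(3) by (auto intro: less_imp_le)
qed

lemma measurable_S_borel: "X \<in> N \<rightarrow>\<^sub>M S \<Longrightarrow> X \<in> borel_measurable N"
  unfolding state_space_def by (auto simp: measurable_restrict_space2_iff)

end

text \<open>
  The superlevel sets of \<open>g\<close> exhaust \<open>(0, 2L)\<close>, so one of them overlaps its translates by at most \<open>L\<close>.
\<close>
lemma translation_overlap:
  fixes g :: "real \<Rightarrow> real"
  assumes g[measurable]: "g \<in> borel_measurable borel" and nonneg: "\<And>y. 0 \<le> g y"
    and pos: "\<And>y. 0 < y \<Longrightarrow> 0 < g y" and int: "integrable lborel g"
  obtains \<eta> where "0 < \<eta>" "\<And>s. 0 \<le> s \<Longrightarrow> s \<le> L \<Longrightarrow> \<eta> \<le> (\<integral>y. min (g y) (g (y - s)) \<partial>lborel)"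
proof -
  \<comment> \<open>Positive also when \<open>L\<close> is not, so that the interval of length
    \<open>2 * l\<close> is never degenerate.\<close>
  define l where "l = max L 1"
  have l: "0 < l" "L \<le> l" by (auto simp: l_def)
  define E where "E n = {y \<in> {0<..2 * l}. 1 / real (Suc n) \<le> g y}" for n
  have E[measurable]: "E n \<in> sets borel" for n unfolding E_def by measurable
  have Ioc_fm: "{0<..b} \<in> fmeasurable lborel" if "0 < b" for b :: real
    using that by (auto simp: fmeasurable_def)
  have E_fm: "E n \<in> fmeasurable lborel" for n
    by (rule fmeasurableI2[OF Ioc_fm[of "2 * l"]]) (use l in \<open>auto simp: E_def\<close>)
  have "(\<lambda>n. measure lborel (E n)) \<longlonglongrightarrow> measure lborel (\<Union>n. E n)"
  proof (rule Lim_measure_incseq)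
    show "incseq E"
    proof (rule incseq_SucI)
      fix n
      have "1 / real (Suc (Suc n)) \<le> 1 / real (Suc n)" by (simp add: frac_le)
      then show "E n \<subseteq> E (Suc n)" by (auto simp: E_def intro: order_trans)
    qed
    have "emeasure lborel (\<Union>n. E n) \<le> emeasure lborel {0<..2 * l}"
      by (rule emeasure_mono) (auto simp: E_def)
    then show "emeasure lborel (\<Union>n. E n) \<noteq> \<infinity>" using l by (auto simp: top_unique)
  qed (use E in auto)
  also have "(\<Union>n. E n) = {0<..2 * l}"
  proof (safe)
    fix y :: real assume y: "y \<in> {0<..2 * l}"
    then obtain n where "inverse (real (Suc n)) < g y" using pos reals_Archimedean by auto
    then show "y \<in> (\<Union>n. E n)" using y by (auto simp: E_def inverse_eq_divide intro!: exI[of _ n])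
  qed (auto simp: E_def)
  finally have "(\<lambda>n. measure lborel (E n)) \<longlonglongrightarrow> 2 * l" using l by simp
  \<comment> \<open>\<open>E n\<close> misses less than \<open>l / 4\<close> of an interval of
    length \<open>2 * l\<close>. Together with its translate it lies in an interval of length at
    most \<open>3 * l\<close>, so the two meet in measure at least
    \<open>2 * (2 * l - l / 4) - 3 * l = l / 2\<close>.\<close>
  then obtain n where "\<forall>m\<ge>n. norm (measure lborel (E m) - 2 * l) < l / 4"
    using LIMSEQ_D[of _ "2 * l" "l / 4"] l by fastforce
  then have "\<bar>measure lborel (E n) - 2 * l\<bar> < l / 4" by simp
  then have n: "2 * l - l / 4 < measure lborel (E n)" by linarith
  define c where "c = 1 / real (Suc n)"
  show thesis
  proof (rule that)
    show "0 < c * (l / 2)" using l by (simp add: c_def)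
    fix s assume s: "0 \<le> s" "s \<le> L"
    define F where "F = (\<lambda>y. y - s) -` E n"
    have F[measurable]: "F \<in> sets borel" using measurable_sets[of "\<lambda>y. y - s" borel borel "E n"] E by (simp add: F_def)
    have "emeasure lborel F = emeasure lborel (E n)"
    proof -
      have "emeasure (distr lborel borel (\<lambda>y. - s + y)) (E n) = emeasure lborel F"
        using E[of n] by (subst emeasure_distr) (auto simp: F_def intro!: arg_cong[where f="emeasure lborel"])
      then show ?thesis by (simp only: lborel_distr_plus)
    qed
    then have Fm: "measure lborel F = measure lborel (E n)" and F_fm: "F \<in> fmeasurable lborel"
      using E_fm[of n] by (auto simp: measure_def fmeasurable_def)
    have I_fm: "E n \<inter> F \<in> fmeasurable lborel" using E_fm F_fm by (intro fmeasurable.Int)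
    have "measure lborel (E n \<union> F) \<le> measure lborel {0<..2 * l + s}"
      using s l by (intro measure_mono_fmeasurable Ioc_fm) (auto simp: E_def F_def)
    moreover have "measure lborel {0<..2 * l + s} = 2 * l + s" using s l by simp
    moreover have "measure lborel (E n \<union> F) = measure lborel (E n) + measure lborel F - measure lborel (E n \<inter> F)"
      using E_fm F_fm by (rule measure_Un3)
    ultimately have I: "l / 2 \<le> measure lborel (E n \<inter> F)" using n Fm s l by linarith
    have "c * (l / 2) \<le> c * measure lborel (E n \<inter> F)" using I by (intro mult_left_mono) (simp_all add: c_def)
    also have "\<dots> = (\<integral>y. c * indicator (E n \<inter> F) y \<partial>lborel)" by simp
    also have "\<dots> \<le> (\<integral>y. min (g y) (g (y - s)) \<partial>lborel)"
    proof (rule integral_mono)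
      show "integrable lborel (\<lambda>y. c * indicator (E n \<inter> F) y)"
        using I_fm by (intro integrable_mult_right integrable_real_indicator) (auto simp: fmeasurable_def)
      show "integrable lborel (\<lambda>y. min (g y) (g (y - s)))"
        by (rule Bochner_Integration.integrable_bound[OF int]) (auto simp: nonneg min_def)
      show "c * indicator (E n \<inter> F) y \<le> min (g y) (g (y - s))" for y
        using nonneg by (auto split: split_indicator simp: E_def F_def c_def)
    qed
    finally show "c * (l / 2) \<le> (\<integral>y. min (g y) (g (y - s)) \<partial>lborel)" .
  qed
qed

section \<open>Local Doeblin condition for the intensity kernel\<close>

locale intensity_model = intensity_parameters + prob_space M for M :: "'a measure" +
  fixes e :: "'a \<Rightarrow> real" and g :: "real \<Rightarrow> real"
  assumes distributed_e: "distributed M lborel e (\<lambda>y. ennreal (g y))"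
    and e_pos: "\<And>\<omega>. \<omega> \<in> space M \<Longrightarrow> 0 < e \<omega>"
    and g_nonneg: "\<And>y. 0 \<le> g y" and g_pos: "\<And>y. 0 < y \<Longrightarrow> 0 < g y" and g_0: "\<And>y. y \<le> 0 \<Longrightarrow> g y = 0"
    and integrable_e: "integrable M e"
    and stable: "\<alpha> < \<beta> * expectation e"
begin

abbreviation "P \<equiv> intensity_kernel \<mu> \<alpha> \<beta> M e"

lemma e_measurable[measurable]: "e \<in> borel_measurable M"
  using distributed_measurable[OF distributed_e] by simp

lemma g_measurable[measurable]: "g \<in> borel_measurable borel"
  using distributed_real_measurable[OF _ distributed_e] g_nonneg by simp

lemma integral_e:
  fixes \<phi> :: "real \<Rightarrow> real"
  shows "\<phi> \<in> borel_measurable borel \<Longrightarrow> (\<integral>\<omega>. \<phi> (e \<omega>) \<partial>M) = (\<integral>y. g y * \<phi> y \<partial>lborel)"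
  using distributed_integral[OF distributed_e] g_nonneg by simp

lemma integrable_e_iff:
  fixes \<phi> :: "real \<Rightarrow> real"
  shows "\<phi> \<in> borel_measurable borel \<Longrightarrow> integrable M (\<lambda>\<omega>. \<phi> (e \<omega>)) \<longleftrightarrow> integrable lborel (\<lambda>y. g y * \<phi> y)"
  using distributed_integrable[OF distributed_e] g_nonneg by simp

lemma g_prob: "integrable lborel g" "(\<integral>y. g y \<partial>lborel) = 1"
  using integrable_e_iff[of "\<lambda>_. 1"] integral_e[of "\<lambda>_. 1"] by (simp_all add: prob_space)

lemma nxt_measurable_M: "\<mu> \<le> x \<Longrightarrow> (\<lambda>\<omega>. nxt x (e \<omega>)) \<in> M \<rightarrow>\<^sub>M S"
  by (rule measurable_nxt) (auto intro: less_imp_le[OF e_pos])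

lemma P_eq: "P x = distr M S (\<lambda>\<omega>. nxt x (e \<omega>))"
  by (simp add: intensity_kernel_def nxt_def)

lemma P_kernel: "P \<in> S \<rightarrow>\<^sub>M prob_algebra S"
proof -
  have "(\<lambda>p. nxt (fst p) (e (snd p))) \<in> S \<Otimes>\<^sub>M M \<rightarrow>\<^sub>M S"
  proof (rule measurable_nxt)
    show "fst \<in> borel_measurable (S \<Otimes>\<^sub>M M)" by (rule measurable_S_borel) measurable
  qed (auto simp: space_pair_measure space_S intro: less_imp_le[OF e_pos])
  then have "(\<lambda>x. distr M S (\<lambda>\<omega>. nxt x (e \<omega>))) \<in> S \<rightarrow>\<^sub>M prob_algebra S"
    by (intro measurable_distr_prob_space2[where M=M] measurable_const)
       (auto simp: space_prob_algebra prob_space_axioms case_prod_unfold)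
  then show ?thesis by (simp add: P_eq[abs_def])
qed

sublocale markov_kernel S P
  by unfold_locales (rule P_kernel)

lemma integral_P:
  fixes \<phi> :: "real \<Rightarrow> real"
  assumes "\<mu> \<le> x" "\<phi> \<in> borel_measurable S"
  shows "(\<integral>z. \<phi> z \<partial>P x) = (\<integral>\<omega>. \<phi> (nxt x (e \<omega>)) \<partial>M)"
  unfolding P_eq by (rule integral_distr[OF nxt_measurable_M[OF assms(1)] assms(2)])

lemma nn_integral_P:
  assumes "\<mu> \<le> x" "\<phi> \<in> borel_measurable S"
  shows "(\<integral>\<^sup>+z. \<phi> z \<partial>P x) = (\<integral>\<^sup>+\<omega>. \<phi> (nxt x (e \<omega>)) \<partial>M)"
  unfolding P_eq by (rule nn_integral_distr[OF nxt_measurable_M[OF assms(1)]]) (simp add: assms(2))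

lemma measurable_nxt_innovation: "\<mu> \<le> x \<Longrightarrow> (\<lambda>y. nxt x (max y 0)) \<in> borel \<rightarrow>\<^sub>M S"
  by (rule measurable_nxt) auto

text \<open>By \<open>nxt_shift\<close> the law from \<open>x\<close> is the image, under the step
  map of \<open>x'\<close>, of the innovation density translated by \<open>s\<close>. The difference
  is then an integral of \<open>g (y - s) - g y\<close> against a function bounded by 1, and
  \<open>\<bar>a - b\<bar> = a + b - 2 * min a b\<close>.\<close>

lemma abs_integral_P_diff_le:
  fixes \<phi> :: "real \<Rightarrow> real"
  assumes x: "\<mu> \<le> x" "x \<le> x'" and \<phi>: "\<phi> \<in> borel_measurable S" "\<And>z. z \<in> space S \<Longrightarrow> \<bar>\<phi> z\<bar> \<le> 1"
  defines "s \<equiv> pot (x' - \<mu> + \<alpha>) - pot (x - \<mu> + \<alpha>)"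
  shows "\<bar>(\<integral>z. \<phi> z \<partial>P x) - (\<integral>z. \<phi> z \<partial>P x')\<bar> \<le> 2 * (1 - (\<integral>y. min (g y) (g (y - s)) \<partial>lborel))"
proof -
  have x': "\<mu> \<le> x'" using x by simp
  have s: "0 \<le> s" using nxt_shift(2)[OF x order_refl] by (simp add: s_def)
  define \<psi> where "\<psi> z y = \<phi> (nxt z (max y 0))" for z y
  have \<psi>[measurable]: "\<psi> z \<in> borel_measurable borel" if "\<mu> \<le> z" for z
    unfolding \<psi>_def by (rule measurable_compose[OF measurable_nxt_innovation[OF that] \<phi>(1)])
  note [measurable] = \<psi>[OF x(1)] \<psi>[OF x']
  have \<psi>1: "\<bar>\<psi> z y\<bar> \<le> 1" if "\<mu> \<le> z" for z y
    unfolding \<psi>_def using nxt_gt[OF that] by (intro \<phi>(2)) (simp add: space_S less_imp_le)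
  have E: "(\<integral>w. \<phi> w \<partial>P z) = (\<integral>y. g y * \<psi> z y \<partial>lborel)" if z: "\<mu> \<le> z" for z
  proof -
    have "(\<integral>w. \<phi> w \<partial>P z) = (\<integral>\<omega>. \<psi> z (e \<omega>) \<partial>M)"
      unfolding integral_P[OF z \<phi>(1)] \<psi>_def
      by (intro Bochner_Integration.integral_cong refl) (simp add: max_absorb1 less_imp_le[OF e_pos])
    also have "\<dots> = (\<integral>y. g y * \<psi> z y \<partial>lborel)" by (rule integral_e[OF \<psi>[OF z]])
    finally show ?thesis .
  qed
  have int_shift: "integrable lborel (\<lambda>y. g (y - s))" "(\<integral>y. g (y - s) \<partial>lborel) = 1"
    using lborel_integrable_real_affine[OF g_prob(1), of 1 "- s"] lborel_integral_real_affine[of 1 g "- s"] g_prob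
    by simp_all
  have shift: "g y * \<psi> x y = g (s + y - s) * \<psi> x' (s + y)" for y
  proof (cases "0 < y")
    case True
    then show ?thesis
      using nxt_shift(1)[OF x, of y, folded s_def] s by (simp add: \<psi>_def max_absorb1 add.commute)
  qed (simp add: g_0)
  have "(\<integral>z. \<phi> z \<partial>P x) = (\<integral>y. g (s + y - s) * \<psi> x' (s + y) \<partial>lborel)"
    unfolding E[OF x(1)] by (rule Bochner_Integration.integral_cong[OF refl shift])
  also have "\<dots> = (\<integral>y. g (y - s) * \<psi> x' y \<partial>lborel)"
    using lborel_integral_real_affine[of 1 "\<lambda>y. g (y - s) * \<psi> x' y" s] by simp
  finally have Ex: "(\<integral>z. \<phi> z \<partial>P x) = (\<integral>y. g (y - s) * \<psi> x' y \<partial>lborel)" .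
  have i1: "integrable lborel (\<lambda>y. g (y - s) * \<psi> x' y)"
    by (rule Bochner_Integration.integrable_bound[OF int_shift(1)])
       (use \<psi>1[OF x'] g_nonneg in \<open>auto simp: abs_mult intro!: mult_left_le\<close>)
  have i2: "integrable lborel (\<lambda>y. g y * \<psi> x' y)"
    by (rule Bochner_Integration.integrable_bound[OF g_prob(1)])
       (use \<psi>1[OF x'] g_nonneg in \<open>auto simp: abs_mult intro!: mult_left_le\<close>)
  have im: "integrable lborel (\<lambda>y. min (g y) (g (y - s)))"
    by (rule Bochner_Integration.integrable_bound[OF g_prob(1)]) (auto simp: g_nonneg min_def)
  have "(\<integral>z. \<phi> z \<partial>P x) - (\<integral>z. \<phi> z \<partial>P x') = (\<integral>y. g (y - s) * \<psi> x' y - g y * \<psi> x' y \<partial>lborel)"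
    using i1 i2 by (simp add: Ex E[OF x'])
  also have "\<bar>\<dots>\<bar> \<le> (\<integral>y. \<bar>g (y - s) * \<psi> x' y - g y * \<psi> x' y\<bar> \<partial>lborel)"
    by (rule integral_abs_bound)
  also have "\<dots> \<le> (\<integral>y. g y + g (y - s) - 2 * min (g y) (g (y - s)) \<partial>lborel)"
  proof (rule integral_mono)
    show "\<bar>g (y - s) * \<psi> x' y - g y * \<psi> x' y\<bar> \<le> g y + g (y - s) - 2 * min (g y) (g (y - s))" for y
    proof -
      have "\<bar>g (y - s) * \<psi> x' y - g y * \<psi> x' y\<bar> = \<bar>g (y - s) - g y\<bar> * \<bar>\<psi> x' y\<bar>"
        by (simp add: left_diff_distrib[symmetric] abs_mult)
      also have "\<dots> \<le> \<bar>g (y - s) - g y\<bar>" using \<psi>1[OF x'] by (intro mult_left_le) auto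
      finally show ?thesis by (simp add: min_def abs_if split: if_splits)
    qed
  qed (use i1 i2 im int_shift g_prob in auto)
  also have "\<dots> = 2 * (1 - (\<integral>y. min (g y) (g (y - s)) \<partial>lborel))"
    using im int_shift g_prob by simp
  finally show ?thesis .
qed

text \<open>\<open>pot\<close> is monotone, so states between \<open>\<mu>\<close> and
  \<open>R\<close> correspond to translations by at most
  \<open>pot (R - \<mu> + \<alpha>) - pot \<alpha>\<close>, and one overlap constant serves them
  all.\<close>

lemma local_overlap:
  obtains \<eta> where "0 < \<eta>" "\<And>x y (\<phi> :: real \<Rightarrow> real). x \<in> {\<mu>..R} \<Longrightarrow> y \<in> {\<mu>..R} \<Longrightarrow>
    \<phi> \<in> borel_measurable S \<Longrightarrow> (\<And>z. z \<in> space S \<Longrightarrow> \<bar>\<phi> z\<bar> \<le> 1) \<Longrightarrow>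
    \<bar>(\<integral>z. \<phi> z \<partial>P x) - (\<integral>z. \<phi> z \<partial>P y)\<bar> \<le> 2 * (1 - \<eta>)"
proof -
  obtain \<eta> where \<eta>: "0 < \<eta>" and ov: "\<And>s. 0 \<le> s \<Longrightarrow> s \<le> pot (R - \<mu> + \<alpha>) - pot \<alpha> \<Longrightarrow>
      \<eta> \<le> (\<integral>y. min (g y) (g (y - s)) \<partial>lborel)"
    using translation_overlap[OF g_measurable g_nonneg g_pos g_prob(1)] by blast
  have half: "\<bar>(\<integral>z. \<phi> z \<partial>P x) - (\<integral>z. \<phi> z \<partial>P y)\<bar> \<le> 2 * (1 - \<eta>)"
    if xy: "\<mu> \<le> x" "x \<le> y" "y \<le> R" and \<phi>: "\<phi> \<in> borel_measurable S" "\<And>z. z \<in> space S \<Longrightarrow> \<bar>\<phi> z\<bar> \<le> 1"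
    for x y and \<phi> :: "real \<Rightarrow> real"
  proof -
    let ?s = "pot (y - \<mu> + \<alpha>) - pot (x - \<mu> + \<alpha>)"
    have "pot (y - \<mu> + \<alpha>) \<le> pot (R - \<mu> + \<alpha>)" "pot \<alpha> \<le> pot (x - \<mu> + \<alpha>)"
      using xy \<alpha> by (auto intro: pot_mono)
    then have "\<eta> \<le> (\<integral>z. min (g z) (g (z - ?s)) \<partial>lborel)"
      using nxt_shift(2)[OF xy(1,2) order_refl] by (intro ov) auto
    moreover have "\<bar>(\<integral>z. \<phi> z \<partial>P x) - (\<integral>z. \<phi> z \<partial>P y)\<bar> \<le>
        2 * (1 - (\<integral>z. min (g z) (g (z - ?s)) \<partial>lborel))"
      by (rule abs_integral_P_diff_le[OF xy(1,2) \<phi>])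
    moreover have "2 * (1 - u) \<le> 2 * (1 - \<eta>)" if "\<eta> \<le> u" for u using that by simp
    ultimately show ?thesis by (meson order_trans)
  qed
  show thesis
  proof (rule that[OF \<eta>])
    fix x y and \<phi> :: "real \<Rightarrow> real"
    assume "x \<in> {\<mu>..R}" "y \<in> {\<mu>..R}" "\<phi> \<in> borel_measurable S" "\<And>z. z \<in> space S \<Longrightarrow> \<bar>\<phi> z\<bar> \<le> 1"
    then show "\<bar>(\<integral>z. \<phi> z \<partial>P x) - (\<integral>z. \<phi> z \<partial>P y)\<bar> \<le> 2 * (1 - \<eta>)"
      using half[of x y \<phi>] half[of y x \<phi>] by (cases "x \<le> y") (auto simp: abs_minus_commute)
  qed
qed

section \<open>Negative drift at high intensities\<close>

text \<open>A bound for the increment \<open>nxt x y - x\<close> that is uniform over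
  \<open>x \<ge> \<mu> + n\<close>: the duration is longest from the lowest of these states.
  Truncating \<open>y\<close> at 0 gives a measurable function on the whole line.\<close>

definition excess :: "nat \<Rightarrow> real \<Rightarrow> real" where
  "excess n y = \<alpha> - \<beta> * max y 0 + \<beta> * \<mu> * T (\<mu> + real n) (max y 0)"

lemma excess_measurable[measurable]: "excess n \<in> borel_measurable borel"
proof -
  have "(\<lambda>y. T (\<mu> + real n) (max y 0)) \<in> borel_measurable borel"
    by (rule measurable_duration) auto
  then show ?thesis unfolding excess_def by measurable
qed

lemma excess_bounds: "excess n y \<le> \<alpha>" "\<bar>excess n y\<bar> \<le> \<alpha> + \<beta> * \<bar>y\<bar>"
proof -
  have 1: "\<beta> * (\<mu> * T (\<mu> + real n) (max y 0)) \<le> \<beta> * max y 0"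
    using Phi_inv_le[of "\<mu> + real n" "max y 0"] \<mu> \<beta> by (simp add: pos_le_divide_eq mult.commute)
  then show "excess n y \<le> \<alpha>" by (simp add: excess_def)
  have "0 \<le> T (\<mu> + real n) (max y 0)" by (rule Phi_inv(1)) auto
  then have "0 \<le> \<beta> * (\<mu> * T (\<mu> + real n) (max y 0))" using \<mu> \<beta> by simp
  moreover have "\<beta> * max y 0 \<le> \<beta> * \<bar>y\<bar>" using \<beta> by simp
  ultimately show "\<bar>excess n y\<bar> \<le> \<alpha> + \<beta> * \<bar>y\<bar>"
    using 1 \<alpha> by (simp add: excess_def abs_le_iff)
qed

lemma nxt_le_excess:
  assumes "\<mu> + real n \<le> x" "0 \<le> y"
  shows "nxt x y \<le> x + excess n y"
proof -
  have "T x y \<le> T (\<mu> + real n) y" using assms by (intro Phi_inv_antimono) auto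
  then have "\<beta> * \<mu> * T x y \<le> \<beta> * \<mu> * T (\<mu> + real n) y" using \<mu> \<beta> by simp
  then show ?thesis using assms nxt_eq[of x y] by (simp add: excess_def max_def)
qed

text \<open>Within any fixed time the compensator from \<open>\<mu> + n\<close> grows at least by
  \<open>n + \<alpha>\<close> times a positive constant, so for large \<open>n\<close> it passes
  \<open>y\<close> before that time.\<close>

lemma duration_tendsto_0:
  assumes y: "0 \<le> y"
  shows "(\<lambda>n. T (\<mu> + real n) y) \<longlonglongrightarrow> 0"
proof (rule LIMSEQ_I)
  fix t :: real assume t: "0 < t"
  have c: "0 < (1 - exp (- \<beta> * (t / 2))) / \<beta>" using t \<beta> by simp
  obtain N :: nat where N: "y / ((1 - exp (- \<beta> * (t / 2))) / \<beta>) \<le> real N" using real_arch_simple by blast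
  have "norm (T (\<mu> + real n) y - 0) < t" if n: "N \<le> n" for n
  proof -
    have "y \<le> real N * ((1 - exp (- \<beta> * (t / 2))) / \<beta>)" using N c by (simp only: pos_divide_le_eq)
    also have "\<dots> \<le> (real n + \<alpha>) * ((1 - exp (- \<beta> * (t / 2))) / \<beta>)"
      using n \<alpha> c by (intro mult_right_mono) auto
    also have "\<dots> \<le> \<Psi> (t / 2) (\<mu> + real n)" using \<mu> t by (simp add: Phi_def)
    finally have "T (\<mu> + real n) y \<le> t / 2" using y by (subst Phi_inv_le_iff) auto
    then show ?thesis using Phi_inv(1)[of "\<mu> + real n" y] y t by simp
  qed
  then show "\<exists>no. \<forall>n\<ge>no. norm (T (\<mu> + real n) y - 0) < t" by blast
qed

lemma integrable_excess: "integrable M (\<lambda>\<omega>. excess n (e \<omega>))"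
proof (rule Bochner_Integration.integrable_bound)
  show "integrable M (\<lambda>\<omega>. \<alpha> + \<beta> * \<bar>e \<omega>\<bar>)" using integrable_e by simp
  show "AE \<omega> in M. norm (excess n (e \<omega>)) \<le> norm (\<alpha> + \<beta> * \<bar>e \<omega>\<bar>)"
    using excess_bounds(2)[of n] \<alpha> \<beta> by (intro AE_I2) (simp add: abs_of_nonneg)
qed measurable

text \<open>The stability condition enters here. Durations from \<open>\<mu> + n\<close> vanish as
  \<open>n\<close> grows, so the means tend to \<open>\<alpha> - \<beta> * expectation e\<close>,
  which is negative.\<close>

lemma excess_mean_negative:
  obtains n where "expectation (\<lambda>\<omega>. excess n (e \<omega>)) < 0"
proof -
  have "(\<lambda>n. expectation (\<lambda>\<omega>. excess n (e \<omega>))) \<longlonglongrightarrow> expectation (\<lambda>\<omega>. \<alpha> - \<beta> * e \<omega>)"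
  proof (rule integral_dominated_convergence[where w="\<lambda>\<omega>. \<alpha> + \<beta> * \<bar>e \<omega>\<bar>"])
    show "AE \<omega> in M. (\<lambda>n. excess n (e \<omega>)) \<longlonglongrightarrow> \<alpha> - \<beta> * e \<omega>"
    proof (rule AE_I2)
      fix \<omega> assume "\<omega> \<in> space M"
      then have p: "0 \<le> e \<omega>" using e_pos by (simp add: less_imp_le)
      have "(\<lambda>n. \<alpha> - \<beta> * e \<omega> + \<beta> * \<mu> * T (\<mu> + real n) (e \<omega>)) \<longlonglongrightarrow> \<alpha> - \<beta> * e \<omega> + \<beta> * \<mu> * 0"
        by (intro tendsto_intros duration_tendsto_0 p)
      then show "(\<lambda>n. excess n (e \<omega>)) \<longlonglongrightarrow> \<alpha> - \<beta> * e \<omega>" using p by (simp add: excess_def max_def)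
    qed
    show "integrable M (\<lambda>\<omega>. \<alpha> + \<beta> * \<bar>e \<omega>\<bar>)" using integrable_e by simp
    show "AE \<omega> in M. norm (excess n (e \<omega>)) \<le> \<alpha> + \<beta> * \<bar>e \<omega>\<bar>" for n
      using excess_bounds(2)[of n] by (intro AE_I2) simp
  qed measurable
  moreover have "expectation (\<lambda>\<omega>. \<alpha> - \<beta> * e \<omega>) < 0"
    using integrable_e stable by (simp add: prob_space)
  ultimately have "\<forall>\<^sub>F n in sequentially. expectation (\<lambda>\<omega>. excess n (e \<omega>)) < 0"
    by (rule order_tendstoD(2))
  then show thesis using that by (auto simp: eventually_sequentially)
qed

end

text \<open>The difference quotients \<open>(exp (\<sigma> D) - 1) / \<sigma>\<close> converge to \<open>D\<close>, dominated by \<open>\<bar>D\<bar> exp b\<close> for \<open>\<sigma> \<le> 1\<close>.\<close>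
lemma (in prob_space) exponential_moment_less_1:
  fixes D :: "'a \<Rightarrow> real"
  assumes int: "integrable M D" and bound: "\<And>\<omega>. \<omega> \<in> space M \<Longrightarrow> D \<omega> \<le> b" and b: "0 \<le> b"
    and neg: "expectation D < 0"
  obtains \<sigma> where "0 < \<sigma>" "integrable M (\<lambda>\<omega>. exp (\<sigma> * D \<omega>))" "expectation (\<lambda>\<omega>. exp (\<sigma> * D \<omega>)) < 1"
proof -
  have [measurable]: "D \<in> borel_measurable M" using int by simp
  define \<sigma> where "\<sigma> n = 1 / real (Suc n)" for n
  have \<sigma>: "0 < \<sigma> n" "\<sigma> n \<le> 1" for n by (auto simp: \<sigma>_def)
  have ie: "integrable M (\<lambda>\<omega>. exp (\<sigma> n * D \<omega>))" for n
  proof (rule integrable_const_bound)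
    show "AE \<omega> in M. norm (exp (\<sigma> n * D \<omega>)) \<le> exp (\<sigma> n * b)"
      using bound \<sigma>(1)[of n] by (intro AE_I2) simp
  qed measurable
  define F where "F n \<omega> = (exp (\<sigma> n * D \<omega>) - 1) / \<sigma> n" for n \<omega>
  have lim: "(\<lambda>n. expectation (F n)) \<longlonglongrightarrow> expectation D"
  proof (rule integral_dominated_convergence[where w="\<lambda>\<omega>. \<bar>D \<omega>\<bar> * exp b"])
    show "AE \<omega> in M. (\<lambda>n. F n \<omega>) \<longlonglongrightarrow> D \<omega>"
    proof (rule AE_I2)
      fix \<omega>
      show "(\<lambda>n. F n \<omega>) \<longlonglongrightarrow> D \<omega>"
      proof (cases "D \<omega> = 0")
        case False
        have "((\<lambda>h::real. (exp h - 1) / h) \<longlongrightarrow> 1) (at 0)"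
          using DERIV_exp[of "0::real"] by (simp add: DERIV_def)
        moreover have "filterlim (\<lambda>n. \<sigma> n * D \<omega>) (at 0) sequentially"
        proof -
          have "(\<lambda>n. \<sigma> n * D \<omega>) \<longlonglongrightarrow> 0"
            unfolding \<sigma>_def by (rule tendsto_mult_left_zero) (rule LIMSEQ_Suc[OF lim_1_over_n])
          then show ?thesis using False \<sigma>(1) by (auto simp: filterlim_at less_imp_neq[symmetric])
        qed
        ultimately have "(\<lambda>n. (exp (\<sigma> n * D \<omega>) - 1) / (\<sigma> n * D \<omega>)) \<longlonglongrightarrow> 1"
          by (rule filterlim_compose)
        from tendsto_mult[OF this tendsto_const[of "D \<omega>"]] show ?thesis
          using False by (simp add: F_def)
      qed (simp add: F_def)
    qed
    show "integrable M (\<lambda>\<omega>. \<bar>D \<omega>\<bar> * exp b)" using int by simp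
    show "AE \<omega> in M. norm (F n \<omega>) \<le> \<bar>D \<omega>\<bar> * exp b" for n
    proof (rule AE_I2)
      fix \<omega> assume \<omega>: "\<omega> \<in> space M"
      let ?v = "\<sigma> n * D \<omega>"
      have eb: "1 \<le> exp b" using b by simp
      have "\<bar>exp ?v - 1\<bar> \<le> \<bar>?v\<bar> * exp b"
      proof (cases "0 \<le> D \<omega>")
        case True
        then have v: "0 \<le> ?v" using \<sigma>(1)[of n] by simp
        have "?v \<le> 1 * D \<omega>" using \<sigma>[of n] True by (intro mult_right_mono) auto
        then have vb: "exp ?v \<le> exp b" using bound[OF \<omega>] by simp
        have "(1 - ?v) * exp ?v \<le> exp (- ?v) * exp ?v"
          using exp_ge_add_one_self[of "- ?v"] by (intro mult_right_mono) auto
        then have "exp ?v - 1 \<le> ?v * exp ?v" by (simp add: exp_minus algebra_simps)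
        also have "\<dots> \<le> ?v * exp b" using v vb by (rule mult_left_mono[rotated])
        finally show ?thesis using v by simp
      next
        case False
        then have v: "?v \<le> 0" using \<sigma>(1)[of n] by (simp add: mult_nonneg_nonpos)
        have "1 - exp ?v \<le> - ?v * 1" using exp_ge_add_one_self[of ?v] unfolding mult_1_right by linarith
        also have "\<dots> \<le> - ?v * exp b" using v eb by (intro mult_left_mono) auto
        finally show ?thesis using v by simp
      qed
      then have "\<bar>exp ?v - 1\<bar> / \<sigma> n \<le> \<bar>?v\<bar> * exp b / \<sigma> n"
        using \<sigma>(1)[of n] by (intro divide_right_mono) auto
      then show "norm (F n \<omega>) \<le> \<bar>D \<omega>\<bar> * exp b"
        using \<sigma>(1)[of n] by (simp add: F_def abs_mult)
    qed
  qed (auto simp: F_def[abs_def])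
  have "\<forall>\<^sub>F n in sequentially. expectation (F n) < 0" using lim neg by (rule order_tendstoD(2))
  then obtain n where "expectation (F n) < 0" by (auto simp: eventually_sequentially)
  moreover have "expectation (F n) = (expectation (\<lambda>\<omega>. exp (\<sigma> n * D \<omega>)) - 1) / \<sigma> n"
    using ie[of n] unfolding F_def by (simp add: prob_space)
  ultimately have "expectation (\<lambda>\<omega>. exp (\<sigma> n * D \<omega>)) < 1" using \<sigma>(1)[of n] by (simp add: divide_less_0_iff)
  with \<sigma>(1) ie show thesis by (rule that)
qed

context intensity_model
begin

abbreviation "\<mu>e \<equiv> expectation e"

text \<open>From \<open>\<mu> + n\<close> upwards the exponential of the next state is at most the
  exponential of \<open>\<sigma>\<close> times the excess, multiplied by the current value; the mean
  of the first factor is \<open>r\<close>. From lower states the next state is at most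
  \<open>\<mu> + n + \<alpha>\<close>, whence \<open>C\<close>. Adding the two bounds covers both
  cases.\<close>

lemma geometric_drift:
  obtains \<sigma> r C where "0 < \<sigma>" "0 \<le> r" "r < 1" "0 < C"
    "\<And>x. \<mu> \<le> x \<Longrightarrow> (\<integral>\<^sup>+z. ennreal (exp (\<sigma> * (z - \<mu>))) \<partial>P x) \<le> ennreal (r * exp (\<sigma> * (x - \<mu>)) + C)"
proof -
  obtain n where n: "expectation (\<lambda>\<omega>. excess n (e \<omega>)) < 0" by (rule excess_mean_negative)
  obtain \<sigma> where \<sigma>: "0 < \<sigma>" and iE: "integrable M (\<lambda>\<omega>. exp (\<sigma> * excess n (e \<omega>)))"
    and r: "expectation (\<lambda>\<omega>. exp (\<sigma> * excess n (e \<omega>))) < 1"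
    using exponential_moment_less_1[OF integrable_excess _ _ n, of \<alpha>] excess_bounds(1) \<alpha> by (metis less_imp_le)
  define r where "r = expectation (\<lambda>\<omega>. exp (\<sigma> * excess n (e \<omega>)))"
  define C where "C = exp (\<sigma> * (real n + \<alpha>))"
  show thesis
  proof (rule that[OF \<sigma>])
    show r0: "0 \<le> r" and "r < 1" and C: "0 < C" using r by (simp_all add: r_def C_def)
    fix x assume x: "\<mu> \<le> x"
    have pt: "exp (\<sigma> * (nxt x y - \<mu>)) \<le> exp (\<sigma> * excess n y) * exp (\<sigma> * (x - \<mu>)) + C" if y: "0 \<le> y" for y
    proof (cases "\<mu> + real n \<le> x")
      case True
      have "exp (\<sigma> * (nxt x y - \<mu>)) \<le> exp (\<sigma> * (excess n y + (x - \<mu>)))"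
        using nxt_le_excess[OF True y] \<sigma> by simp
      then show ?thesis using C by (simp add: distrib_left exp_add)
    next
      case False
      have "exp (\<sigma> * (nxt x y - \<mu>)) \<le> C"
        unfolding C_def using nxt_le[OF x y] False \<sigma> by simp
      then show ?thesis by (simp add: add_increasing)
    qed
    have "(\<integral>\<^sup>+z. ennreal (exp (\<sigma> * (z - \<mu>))) \<partial>P x) = (\<integral>\<^sup>+\<omega>. ennreal (exp (\<sigma> * (nxt x (e \<omega>) - \<mu>))) \<partial>M)"
    proof (rule nn_integral_P[OF x])
      have [measurable]: "(\<lambda>z. z) \<in> borel_measurable S" by (rule measurable_S_borel) simp
      show "(\<lambda>z. ennreal (exp (\<sigma> * (z - \<mu>)))) \<in> borel_measurable S" by measurable
    qed
    also have "\<dots> \<le> (\<integral>\<^sup>+\<omega>. ennreal (exp (\<sigma> * excess n (e \<omega>)) * exp (\<sigma> * (x - \<mu>)) + C) \<partial>M)"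
      by (intro nn_integral_mono ennreal_leI pt less_imp_le[OF e_pos])
    also have "\<dots> = ennreal (\<integral>\<omega>. exp (\<sigma> * excess n (e \<omega>)) * exp (\<sigma> * (x - \<mu>)) + C \<partial>M)"
      using iE C by (intro nn_integral_eq_integral) (auto intro!: add_nonneg_nonneg simp: less_imp_le)
    also have "(\<integral>\<omega>. exp (\<sigma> * excess n (e \<omega>)) * exp (\<sigma> * (x - \<mu>)) + C \<partial>M) = r * exp (\<sigma> * (x - \<mu>)) + C"
      using iE by (simp add: r_def prob_space)
    finally show "(\<integral>\<^sup>+z. ennreal (exp (\<sigma> * (z - \<mu>))) \<partial>P x) \<le> ennreal (r * exp (\<sigma> * (x - \<mu>)) + C)" .
  qed
qed

lemma harris_kernel_exponential:
  obtains \<sigma> r C where "0 < \<sigma>" "harris_kernel S P (\<lambda>x. exp (\<sigma> * (x - \<mu>))) r C"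
proof -
  obtain \<sigma> r C where \<sigma>: "0 < \<sigma>" and r: "0 \<le> r" "r < 1" and C: "0 < C" and drift:
    "\<And>x. \<mu> \<le> x \<Longrightarrow> (\<integral>\<^sup>+z. ennreal (exp (\<sigma> * (z - \<mu>))) \<partial>P x) \<le> ennreal (r * exp (\<sigma> * (x - \<mu>)) + C)"
    by (rule geometric_drift) blast
  have "harris_kernel S P (\<lambda>x. exp (\<sigma> * (x - \<mu>))) r C"
  proof unfold_locales
    have [measurable]: "(\<lambda>z. z) \<in> borel_measurable S" by (rule measurable_S_borel) simp
    show "(\<lambda>x. exp (\<sigma> * (x - \<mu>))) \<in> borel_measurable S" by measurable
    show "space S \<noteq> {}" by (auto simp: space_S)
    fix R
    \<comment> \<open>Sublevel sets of the Lyapunov function are intervals starting at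
      \<open>\<mu>\<close>; the maximum with 1 provides a logarithm also when \<open>R\<close> is
      not positive.\<close>
    define R' where "R' = \<mu> + ln (max R 1) / \<sigma>"
    have bd: "x \<in> {\<mu>..R'}" if "x \<in> space S" "exp (\<sigma> * (x - \<mu>)) \<le> R" for x
    proof -
      have "exp (\<sigma> * (x - \<mu>)) \<le> max R 1" using that by simp
      then have "\<sigma> * (x - \<mu>) \<le> ln (max R 1)" by (subst ln_ge_iff) auto
      then show ?thesis using that \<sigma> by (simp add: R'_def space_S field_simps)
    qed
    obtain \<eta> where \<eta>: "0 < \<eta>" and ov: "\<And>x y (\<phi> :: real \<Rightarrow> real). x \<in> {\<mu>..R'} \<Longrightarrow> y \<in> {\<mu>..R'} \<Longrightarrow>
      \<phi> \<in> borel_measurable S \<Longrightarrow> (\<And>z. z \<in> space S \<Longrightarrow> \<bar>\<phi> z\<bar> \<le> 1) \<Longrightarrow>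
      \<bar>(\<integral>z. \<phi> z \<partial>P x) - (\<integral>z. \<phi> z \<partial>P y)\<bar> \<le> 2 * (1 - \<eta>)"
      by (rule local_overlap[of R']) blast
    show "\<exists>\<eta>>0. \<forall>x\<in>space S. \<forall>y\<in>space S. exp (\<sigma> * (x - \<mu>)) \<le> R \<longrightarrow> exp (\<sigma> * (y - \<mu>)) \<le> R \<longrightarrow>
      (\<forall>\<phi>\<in>borel_measurable S. (\<forall>z\<in>space S. \<bar>\<phi> z\<bar> \<le> (1::real)) \<longrightarrow>
        (\<integral>z. \<phi> z \<partial>P x) - (\<integral>z. \<phi> z \<partial>P y) \<le> 2 * (1 - \<eta>))"
      by (intro exI[of _ \<eta>] conjI ballI impI \<eta>, rule abs_le_D1, rule ov[OF bd bd]) auto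
  qed (use r C drift in \<open>auto simp: space_S\<close>)
  with \<sigma> show thesis by (rule that)
qed

section \<open>Irreducibility and aperiodicity\<close>

text \<open>Were \<open>B\<close> not charged, the set of positive innovations leading into
  \<open>B\<close> would be null, because the density is positive there. Its image under the
  Lipschitz map \<open>nxt x\<close> would be null too, yet it contains the part of \<open>B\<close>
  between \<open>\<mu>\<close> and \<open>x + \<alpha>\<close>, all of which is reachable.\<close>

lemma measure_P_pos:
  assumes x: "\<mu> \<le> x" and B: "B \<in> sets S" and pos: "emeasure lborel (B \<inter> {\<mu><..<x + \<alpha>}) > 0"
  shows "measure (P x) B > 0"
proof (rule ccontr)
  assume "\<not> measure (P x) B > 0"
  then have "emeasure (P x) B = 0"
    using prob_algebraD(1)[OF K_prob[of x]] x
    by (simp add: zero_less_measure_iff space_S finite_measure.emeasure_eq_measure prob_space.finite_measure)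
  then have 0: "emeasure M ((\<lambda>\<omega>. nxt x (e \<omega>)) -` B \<inter> space M) = 0"
    using B nxt_measurable_M[OF x] by (simp add: P_eq emeasure_distr)
  define N where "N = {y \<in> space borel. 0 < y \<and> nxt x (max y 0) \<in> B}"
  have N[measurable]: "N \<in> sets borel"
  proof -
    note [measurable] = measurable_nxt_innovation[OF x] B
    show ?thesis unfolding N_def by measurable
  qed
  have "e -` N \<inter> space M = (\<lambda>\<omega>. nxt x (e \<omega>)) -` B \<inter> space M"
    by (auto simp: N_def max_absorb1 less_imp_le[OF e_pos] e_pos)
  then have "(\<integral>\<^sup>+y. ennreal (g y) * indicator N y \<partial>lborel) = 0"
    using 0 distributed_emeasure[OF distributed_e, of N] by simp
  then have "AE y in lborel. ennreal (g y) * indicator N y = 0"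
    by (subst (asm) nn_integral_0_iff_AE) auto
  then have "AE y in lborel. y \<notin> N"
  proof eventually_elim
    case (elim y)
    show ?case
    proof
      assume y: "y \<in> N"
      then have "0 < g y" by (auto simp: N_def intro: g_pos)
      with elim y show False by simp
    qed
  qed
  then have "N \<in> null_sets lborel" by (subst AE_iff_null_sets) auto
  then have neg: "negligible N"
    by (simp add: negligible_iff_null_sets null_sets_completionI)
  have "negligible ((\<lambda>y. nxt x y) ` N)"
  proof (rule negligible_locally_Lipschitz_image[OF _ neg])
    fix y assume "y \<in> N"
    then show "\<exists>U C. open U \<and> y \<in> U \<and> (\<forall>z\<in>N \<inter> U. norm (nxt x z - nxt x y) \<le> C * norm (z - y))"
      using nxt_Lipschitz[OF x] by (intro exI[of _ UNIV] exI[of _ \<beta>]) (auto simp: N_def)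
  qed simp
  moreover have "B \<inter> {\<mu><..<x + \<alpha>} \<subseteq> (\<lambda>y. nxt x y) ` N"
  proof
    fix b assume b: "b \<in> B \<inter> {\<mu><..<x + \<alpha>}"
    then obtain y where "0 < y" "nxt x y = b" using nxt_surj[OF x, of b] by auto
    with b show "b \<in> (\<lambda>y. nxt x y) ` N" by (auto simp: N_def max_def intro!: image_eqI[of _ _ y])
  qed
  ultimately have "negligible (B \<inter> {\<mu><..<x + \<alpha>})" by (rule negligible_subset)
  moreover have "B \<inter> {\<mu><..<x + \<alpha>} \<in> sets borel" using B by (auto simp: sets_S_iff)
  ultimately have "emeasure lborel (B \<inter> {\<mu><..<x + \<alpha>}) = 0"
    by (simp add: negligible_iff_null_sets null_sets_def)
  with pos show False by simp
qed

text \<open>A step can climb by nearly \<open>\<alpha>\<close>, but the endpoint is not attained.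
  The target interval is therefore shortened by some \<open>\<alpha> / (j + 1)\<close> without
  losing positive measure, and the first step is required to land within that distance of
  \<open>x + \<alpha>\<close>; from there the induction hypothesis covers the shortened
  interval.\<close>

lemma measure_nstep_pos:
  assumes "\<mu> \<le> x" "B \<in> sets S" "emeasure lborel (B \<inter> {\<mu><..<x + real (Suc n) * \<alpha>}) > 0"
  shows "measure (nstep S P (Suc n) x) B > 0"
  using assms
proof (induction n arbitrary: x)
  case 0
  then show ?case using measure_P_pos[of x B] nstep_1[of x] by (simp add: space_S del: nstep.simps)
next
  case (Suc n)
  have x: "x \<in> space S" using Suc.prems by (simp add: space_S)
  note B = Suc.prems(2)
  let ?b = "x + real (Suc (Suc n)) * \<alpha>"
  let ?I = "\<lambda>j. B \<inter> {\<mu><..<?b - \<alpha> / real (Suc j)}"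
  have "\<exists>j. emeasure lborel (?I j) > 0"
  proof (rule ccontr)
    assume "\<not> (\<exists>j. emeasure lborel (?I j) > 0)"
    moreover have "?I j \<in> sets lborel" for j using B by (auto simp: sets_S_iff)
    ultimately have "(\<Union>j. ?I j) \<in> null_sets lborel" by (intro null_sets_UN) (auto simp: null_sets_def)
    moreover have "(\<Union>j. ?I j) = B \<inter> {\<mu><..<?b}"
    proof safe
      fix j b assume "b \<in> {\<mu><..<?b - \<alpha> / real (Suc j)}"
      moreover have "0 < \<alpha> / real (Suc j)" using \<alpha> by simp
      ultimately show "b \<in> {\<mu><..<?b}" unfolding greaterThanLessThan_iff by linarith
    next
      fix b assume b: "b \<in> B" "b \<in> {\<mu><..<?b}"
      then obtain j where "inverse (real (Suc j)) < (?b - b) / \<alpha>"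
        using reals_Archimedean[of "(?b - b) / \<alpha>"] \<alpha> by auto
      then have "\<alpha> / real (Suc j) < ?b - b" using \<alpha> by (simp add: field_simps)
      then show "b \<in> (\<Union>j. ?I j)" using b by (intro UN_I[of j]) auto
    qed
    ultimately show False using Suc.prems(3) by (simp add: null_sets_def)
  qed
  then obtain j where j: "emeasure lborel (?I j) > 0" by blast
  define c where "c = max \<mu> (x + \<alpha> - \<alpha> / real (Suc j))"
  have aj: "0 < \<alpha> / real (Suc j)" using \<alpha> by simp
  have c: "\<mu> \<le> c" "c < x + \<alpha>" using aj \<alpha> Suc.prems(1) by (auto simp: c_def)
  have good: "measure (nstep S P (Suc n) y) B > 0" if y: "y \<in> {c<..<x + \<alpha>}" for y
  proof (rule Suc.IH[OF _ B])
    show "\<mu> \<le> y" using y c by simp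
    have "emeasure lborel (?I j) \<le> emeasure lborel (B \<inter> {\<mu><..<y + real (Suc n) * \<alpha>})"
      using y B by (intro emeasure_mono) (auto simp: c_def sets_S_iff algebra_simps)
    with j show "emeasure lborel (B \<inter> {\<mu><..<y + real (Suc n) * \<alpha>}) > 0" by (rule order.strict_trans2)
  qed
  let ?J = "{c<..<x + \<alpha>}"
  have J: "?J \<in> sets S" using c by (auto simp: sets_S_iff)
  have "?J \<inter> {\<mu><..<x + \<alpha>} = ?J" using c by auto
  then have PJ: "measure (P x) ?J > 0"
    using c by (intro measure_P_pos[OF Suc.prems(1) J]) simp
  let ?f = "\<lambda>y. measure (nstep S P (Suc n) y) B"
  have fi: "integrable (P x) ?f"
    by (rule kernel_measure_integrable[OF K_prob[OF x] nstep_measurable B])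
  have "nstep S P (Suc (Suc n)) x = P x \<bind> nstep S P (Suc n)"
    using nstep_add[OF x, of "Suc 0" "Suc n"] by (simp only: nstep_1[OF x] add_Suc add_0)
  then have eq: "measure (nstep S P (Suc (Suc n)) x) B = (\<integral>y. ?f y \<partial>P x)"
    using prob_algebra_measure_bind[OF K_prob[OF x] nstep_measurable B] by (simp del: nstep.simps)
  have "(\<integral>y. ?f y \<partial>P x) \<noteq> 0"
  proof
    assume "(\<integral>y. ?f y \<partial>P x) = 0"
    then have "AE y in P x. ?f y = 0" using integral_nonneg_eq_0_iff_AE[OF fi] by (simp del: nstep.simps)
    then have "AE y in P x. y \<notin> ?J"
    proof eventually_elim
      case (elim y)
      then show ?case using good[of y] by (auto simp del: nstep.simps)
    qed
    then have "?J \<in> null_sets (P x)"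
      using J prob_algebraD(2)[OF K_prob[OF x]] by (subst AE_iff_null_sets) auto
    then show False using PJ by (simp add: null_sets_def measure_def)
  qed
  then show ?case unfolding eq by (simp add: less_le integral_nonneg_AE del: nstep.simps)
qed

text \<open>The reachable intervals exhaust the states above \<open>\<mu>\<close>, and the point
  \<open>\<mu>\<close> itself has measure zero.\<close>

lemma irreducible: "lebesgue_irreducible S P"
  unfolding lebesgue_irreducible_def
proof (intro ballI impI)
  fix x B assume x: "x \<in> space S" and B: "B \<in> sets S" and pos: "emeasure lborel B > 0"
  have "\<exists>n. emeasure lborel (B \<inter> {\<mu><..<x + real (Suc n) * \<alpha>}) > 0"
  proof (rule ccontr)
    assume *: "\<not> (\<exists>n. emeasure lborel (B \<inter> {\<mu><..<x + real (Suc n) * \<alpha>}) > 0)"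
    moreover have "B \<inter> {\<mu><..<x + real (Suc n) * \<alpha>} \<in> sets lborel" for n using B by (auto simp: sets_S_iff)
    ultimately have "(\<Union>n. B \<inter> {\<mu><..<x + real (Suc n) * \<alpha>}) \<in> null_sets lborel"
      by (intro null_sets_UN) (auto simp: null_sets_def)
    moreover have "{\<mu>} \<in> null_sets lborel" by (simp add: null_sets_def)
    ultimately have "(\<Union>n. B \<inter> {\<mu><..<x + real (Suc n) * \<alpha>}) \<union> {\<mu>} \<in> null_sets lborel" by (rule null_sets.Un)
    moreover have "B \<subseteq> (\<Union>n. B \<inter> {\<mu><..<x + real (Suc n) * \<alpha>}) \<union> {\<mu>}"
    proof
      fix b assume b: "b \<in> B"
      obtain n :: nat where n: "(b - x) / \<alpha> < real n" using reals_Archimedean2 by blast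
      then have "b < x + real (Suc n) * \<alpha>" using \<alpha> by (simp add: field_simps)
      moreover have "\<mu> \<le> b" using b B by (auto simp: sets_S_iff)
      ultimately show "b \<in> (\<Union>n. B \<inter> {\<mu><..<x + real (Suc n) * \<alpha>}) \<union> {\<mu>}" using b by force
    qed
    moreover have "B \<in> sets lborel" using B by (simp add: sets_S_iff)
    ultimately have "B \<in> null_sets lborel" using null_sets_subset by blast
    with pos show False by (simp add: null_sets_def)
  qed
  then obtain n where "emeasure lborel (B \<inter> {\<mu><..<x + real (Suc n) * \<alpha>}) > 0" by blast
  then show "\<exists>n\<ge>1. measure (nstep S P n x) B > 0"
    using measure_nstep_pos[of x B n] x B by (intro exI[of _ "Suc n"]) (simp add: space_S del: nstep.simps)
qed

text \<open>
  Whatever the starting point, one step charges every non-null subset of \<open>(\<mu>, \<mu> + \<alpha>)\<close>, so two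
  disjoint sets cannot both be reached with certainty.
\<close>
lemma aperiodic_P: "aperiodic S P"
  unfolding aperiodic_def
proof (rule notI, elim exE conjE)
  fix d :: nat and D :: "nat \<Rightarrow> real set"
  assume d: "2 \<le> d" and D: "\<forall>i<d. D i \<in> sets S" and disj: "disjoint_family_on D {..<d}"
    and cover: "(\<Union>i<d. D i) = space S"
    and step: "\<forall>i<d. \<forall>x\<in>D i. measure (P x) (D (Suc i mod d)) = 1"
  let ?I = "{\<mu><..<\<mu> + \<alpha>}"
  have null: "?I - D (Suc i mod d) \<in> null_sets lborel" if i: "i < d" and x: "x \<in> D i" for i x
  proof (rule ccontr)
    let ?k = "Suc i mod d"
    have Dk: "D ?k \<in> sets S" and xS: "x \<in> space S"
      using D i d x sets.sets_into_space[of "D i" S] by auto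
    have x': "\<mu> \<le> x" using xS by (simp add: space_S)
    let ?B = "?I - D ?k"
    have B: "?B \<in> sets S" using Dk by (auto simp: sets_S_iff)
    assume "?B \<notin> null_sets lborel"
    then have "0 < emeasure lborel ?B" using B by (auto simp: null_sets_def sets_S_iff zero_less_iff_neq_zero)
    moreover have "?B \<inter> {\<mu><..<x + \<alpha>} = ?B" using x' by auto
    ultimately have "measure (P x) ?B > 0" by (intro measure_P_pos[OF x' B]) simp
    moreover have "measure (P x) (?B \<union> D ?k) = measure (P x) ?B + measure (P x) (D ?k)"
      using B Dk prob_algebraD(2)[OF K_prob[OF xS]]
      by (intro finite_measure.finite_measure_Union prob_space.finite_measure prob_algebraD(1)[OF K_prob[OF xS]]) auto
    ultimately show False
      using step i x prob_space.prob_le_1[OF prob_algebraD(1)[OF K_prob[OF xS]], of "?B \<union> D ?k"] by force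
  qed
  have "\<mu> \<in> space S" by (simp add: space_S)
  then obtain i x where i: "i < d" "x \<in> D i" using cover by blast
  \<comment> \<open>Two consecutive classes are compared. \<open>D j\<close> follows a class known
    to have a point, and has a point itself since it is entered with probability 1; so
    \<open>D j\<close> and \<open>D k\<close> both fill the interval up to null sets, and
    \<open>j \<noteq> k\<close> as \<open>d \<ge> 2\<close>.\<close>
  define j where "j = Suc i mod d"
  define k where "k = Suc j mod d"
  have jk: "j < d" "k < d" using d by (simp_all add: j_def k_def)
  have "j \<noteq> k" using d jk(1) by (cases "Suc j = d") (auto simp: k_def)
  have nj: "?I - D j \<in> null_sets lborel" unfolding j_def using i by (rule null)
  have "\<exists>y. y \<in> D j"
  proof (rule ccontr)
    assume "\<nexists>y. y \<in> D j"
    then show False using step i by (auto simp: j_def)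
  qed
  then obtain y where "y \<in> D j" by blast
  with jk(1) have nk: "?I - D k \<in> null_sets lborel" unfolding k_def by (rule null)
  have "D j \<inter> D k = {}" using disj jk \<open>j \<noteq> k\<close> by (auto simp: disjoint_family_on_def)
  then have "?I = (?I - D j) \<union> (?I - D k)" by auto
  then have "?I \<in> null_sets lborel" using null_sets.Un[OF nj nk] by simp
  then show False using \<alpha> by (simp add: null_sets_def)
qed

section \<open>Recurrence, the stationary law and its mean duration\<close>

lemma positive_harris_P: "positive_harris_recurrent S P"
proof -
  obtain \<sigma> r C where "harris_kernel S P (\<lambda>x. exp (\<sigma> * (x - \<mu>))) r C" by (rule harris_kernel_exponential)
  then interpret H: harris_kernel S P "\<lambda>x. exp (\<sigma> * (x - \<mu>))" r C .
  have "\<exists>\<pi>. stationary S P \<pi>" using H.ergodic_and_unique by metis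
  moreover have "\<P>(\<omega> in path_law S P x. infinite {n. 1 \<le> n \<and> \<omega> n \<in> A}) = 1"
    if "A \<in> sets S" "emeasure lborel A > 0" "x \<in> A" for A x
  proof (rule H.path_recurrent[OF that(1)])
    show "x \<in> space S" using that sets.sets_into_space[OF that(1)] by auto
    show "\<exists>n. measure (nstep S P n y) A > 0" if "y \<in> space S" for y
      using irreducible that \<open>A \<in> sets S\<close> \<open>emeasure lborel A > 0\<close>
      unfolding lebesgue_irreducible_def by blast
  qed
  ultimately show ?thesis by (simp add: positive_harris_recurrent_def harris_recurrent_def)
qed

text \<open>The stationary mean is finite because \<open>x - \<mu>\<close> is at most
  \<open>exp (\<sigma> * (x - \<mu>)) / \<sigma>\<close> and the Lyapunov function is integrable;
  the cancellation in the mean duration rests on this.\<close>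

lemma stationary_unique_ergodic:
  obtains \<pi> where "stationary S P \<pi>" "ergodic S P \<pi>" "integrable \<pi> (\<lambda>x. x)"
    "\<And>\<pi>'. stationary S P \<pi>' \<Longrightarrow> \<pi>' = \<pi>"
proof -
  obtain \<sigma> r C where \<sigma>: "0 < \<sigma>" and "harris_kernel S P (\<lambda>x. exp (\<sigma> * (x - \<mu>))) r C"
    by (rule harris_kernel_exponential)
  then interpret H: harris_kernel S P "\<lambda>x. exp (\<sigma> * (x - \<mu>))" r C by simp
  obtain \<pi> where st: "stationary S P \<pi>" and iV: "integrable \<pi> (\<lambda>x. exp (\<sigma> * (x - \<mu>)))"
    and erg: "ergodic S P \<pi>" and uniq: "\<And>\<pi>'. stationary S P \<pi>' \<Longrightarrow> \<pi>' = \<pi>"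
    by (rule H.ergodic_and_unique) blast
  have \<pi>: "\<pi> \<in> space (prob_algebra S)" using st by (simp add: stationary_iff)
  interpret \<pi>: prob_space \<pi> by (rule prob_algebraD[OF \<pi>])
  have "integrable \<pi> (\<lambda>x. x)"
  proof (rule Bochner_Integration.integrable_bound[where f="\<lambda>x. \<mu> + exp (\<sigma> * (x - \<mu>)) / \<sigma>"])
    show "integrable \<pi> (\<lambda>x. \<mu> + exp (\<sigma> * (x - \<mu>)) / \<sigma>)" using iV by simp
    have "(\<lambda>x. x) \<in> borel_measurable S" by (rule measurable_S_borel) simp
    then show "(\<lambda>x. x) \<in> borel_measurable \<pi>"
      by (simp add: measurable_cong_sets[OF prob_algebraD(2)[OF \<pi>] refl])
    show "AE x in \<pi>. norm x \<le> norm (\<mu> + exp (\<sigma> * (x - \<mu>)) / \<sigma>)"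
    proof (rule AE_I2)
      fix x assume "x \<in> space \<pi>"
      then have x: "\<mu> \<le> x" by (simp add: prob_algebraD(3)[OF \<pi>] space_S)
      have "\<sigma> * (x - \<mu>) \<le> exp (\<sigma> * (x - \<mu>))" using exp_ge_add_one_self[of "\<sigma> * (x - \<mu>)"] by linarith
      then have "x - \<mu> \<le> exp (\<sigma> * (x - \<mu>)) / \<sigma>" using \<sigma> by (simp add: pos_le_divide_eq mult.commute)
      then show "norm x \<le> norm (\<mu> + exp (\<sigma> * (x - \<mu>)) / \<sigma>)" using x \<mu> by simp
    qed
  qed
  with st erg show thesis using uniq by (rule that)
qed

text \<open>Averaging \<open>nxt_eq\<close> over the innovation and then over \<open>\<pi>\<close>
  gives the stationary mean on both sides. Being finite, it cancels and leaves
  \<open>\<beta> * \<mu> * m = \<beta> * \<mu>e - \<alpha>\<close> for the mean duration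
  \<open>m\<close>.\<close>

lemma mean_duration_stationary:
  assumes st: "stationary S P \<pi>" and int: "integrable \<pi> (\<lambda>x. x)"
  shows "mean_duration \<mu> \<alpha> \<beta> M e \<pi> = (\<beta> * \<mu>e - \<alpha>) / (\<beta> * \<mu>)"
proof -
  have \<pi>: "\<pi> \<in> space (prob_algebra S)" and inv: "\<pi> \<bind> P = \<pi>" using st by (auto simp: stationary_iff)
  interpret \<pi>: prob_space \<pi> by (rule prob_algebraD[OF \<pi>])
  note sp = prob_algebraD(3)[OF \<pi>]
  have id[measurable]: "(\<lambda>x. x) \<in> borel_measurable S" by (rule measurable_S_borel) simp
  define D where "D x = (\<integral>\<omega>. T x (e \<omega>) \<partial>M)" for x
  have iT: "integrable M (\<lambda>\<omega>. T x (e \<omega>))" if x: "\<mu> \<le> x" for x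
  proof (rule Bochner_Integration.integrable_bound[where f="\<lambda>\<omega>. e \<omega> / \<mu>"])
    show "(\<lambda>\<omega>. T x (e \<omega>)) \<in> borel_measurable M"
      by (rule measurable_duration) (use x in \<open>auto intro: less_imp_le[OF e_pos]\<close>)
    show "AE \<omega> in M. norm (T x (e \<omega>)) \<le> norm (e \<omega> / \<mu>)"
    proof (rule AE_I2)
      fix \<omega> assume "\<omega> \<in> space M"
      then have "0 \<le> e \<omega>" using e_pos by (simp add: less_imp_le)
      then show "norm (T x (e \<omega>)) \<le> norm (e \<omega> / \<mu>)"
        using Phi_inv(1)[OF x] Phi_inv_le[OF x] \<mu> by simp
    qed
  qed (use integrable_e in simp)
  have D_bound: "\<bar>D x\<bar> \<le> \<mu>e / \<mu>" if x: "x \<in> space S" for x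
  proof -
    have x': "\<mu> \<le> x" using x by (simp add: space_S)
    have "0 \<le> D x" unfolding D_def using Phi_inv(1)[OF x'] less_imp_le[OF e_pos]
      by (intro integral_nonneg_AE AE_I2) auto
    moreover have "D x \<le> (\<integral>\<omega>. e \<omega> / \<mu> \<partial>M)" unfolding D_def
      using iT[OF x'] integrable_e Phi_inv_le[OF x'] less_imp_le[OF e_pos] by (intro integral_mono) auto
    ultimately show ?thesis by simp
  qed
  have D_meas[measurable]: "D \<in> borel_measurable S"
  proof -
    have "(\<lambda>p. T (fst p) (e (snd p))) \<in> borel_measurable (S \<Otimes>\<^sub>M M)"
    proof (rule measurable_duration)
      show "fst \<in> borel_measurable (S \<Otimes>\<^sub>M M)" by (rule measurable_S_borel) measurable
    qed (auto simp: space_pair_measure space_S intro: less_imp_le[OF e_pos])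
    then show ?thesis unfolding D_def[abs_def]
      by (intro borel_measurable_lebesgue_integral) (simp add: case_prod_unfold)
  qed
  have iD: "integrable \<pi> D" by (rule prob_algebra_integrable(1)[OF \<pi> D_meas D_bound])
  \<comment> \<open>Invariance is applied to the unbounded identity function, so it is carried out
    with nonnegative integrals; the sign condition \<open>?B\<close> permits the return to real
    numbers.\<close>
  have step: "(\<integral>\<^sup>+z. ennreal z \<partial>P x) = ennreal (x + \<alpha> - \<beta> * \<mu>e + \<beta> * \<mu> * D x)" (is ?A)
    and nonneg: "0 \<le> x + \<alpha> - \<beta> * \<mu>e + \<beta> * \<mu> * D x" (is ?B) if x: "x \<in> space S" for x
  proof -
    have x': "\<mu> \<le> x" using x by (simp add: space_S)
    have eq: "nxt x (e \<omega>) = x + \<alpha> - \<beta> * e \<omega> + \<beta> * \<mu> * T x (e \<omega>)" if "\<omega> \<in> space M" for \<omega>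
      using nxt_eq[OF x'] less_imp_le[OF e_pos[OF that]] by simp
    have pos: "0 \<le> nxt x (e \<omega>)" for \<omega> using nxt_gt[OF x', of "e \<omega>"] \<mu> by simp
    have i: "integrable M (\<lambda>\<omega>. nxt x (e \<omega>))"
      by (subst Bochner_Integration.integrable_cong[OF refl eq]) (use iT[OF x'] integrable_e in auto)
    have v: "(\<integral>\<omega>. nxt x (e \<omega>) \<partial>M) = x + \<alpha> - \<beta> * \<mu>e + \<beta> * \<mu> * D x"
      by (subst Bochner_Integration.integral_cong[OF refl eq])
         (use iT[OF x'] integrable_e in \<open>auto simp: prob_space D_def\<close>)
    have "(\<integral>\<^sup>+z. ennreal z \<partial>P x) = (\<integral>\<^sup>+\<omega>. ennreal (nxt x (e \<omega>)) \<partial>M)"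
      by (rule nn_integral_P[OF x']) measurable
    also have "\<dots> = ennreal (\<integral>\<omega>. nxt x (e \<omega>) \<partial>M)"
      by (rule nn_integral_eq_integral[OF i]) (use pos in simp)
    finally show ?A unfolding v .
    show ?B unfolding v[symmetric] using pos by (intro integral_nonneg_AE) simp
  qed
  have x_pos: "AE x in \<pi>. 0 \<le> x" by (intro AE_I2) (use \<mu> in \<open>simp add: sp space_S\<close>)
  have "ennreal (\<integral>x. x \<partial>\<pi>) = (\<integral>\<^sup>+x. ennreal x \<partial>\<pi>)"
    using nn_integral_eq_integral[OF int x_pos] by simp
  also have "\<dots> = (\<integral>\<^sup>+x. ennreal x \<partial>(\<pi> \<bind> P))" by (simp add: inv)
  also have "\<dots> = (\<integral>\<^sup>+x. (\<integral>\<^sup>+z. ennreal z \<partial>P x) \<partial>\<pi>)"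
    by (rule prob_algebra_nn_integral_bind[OF \<pi> P_kernel]) measurable
  also have "\<dots> = (\<integral>\<^sup>+x. ennreal (x + \<alpha> - \<beta> * \<mu>e + \<beta> * \<mu> * D x) \<partial>\<pi>)"
    by (rule nn_integral_cong) (simp add: sp step)
  also have "\<dots> = ennreal (\<integral>x. x + \<alpha> - \<beta> * \<mu>e + \<beta> * \<mu> * D x \<partial>\<pi>)"
    using int iD nonneg by (intro nn_integral_eq_integral AE_I2) (auto simp: sp)
  finally have "(\<integral>x. x \<partial>\<pi>) = (\<integral>x. x + \<alpha> - \<beta> * \<mu>e + \<beta> * \<mu> * D x \<partial>\<pi>)"
    using x_pos nonneg by (subst (asm) ennreal_inj) (auto intro!: integral_nonneg_AE AE_I2 simp: sp)
  also have "\<dots> = (\<integral>x. x \<partial>\<pi>) + \<alpha> - \<beta> * \<mu>e + \<beta> * \<mu> * (\<integral>x. D x \<partial>\<pi>)"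
    using int iD by (simp add: \<pi>.prob_space)
  finally have "\<beta> * \<mu> * (\<integral>x. D x \<partial>\<pi>) = \<beta> * \<mu>e - \<alpha>" by simp
  then show ?thesis
    using \<beta> \<mu> by (simp add: mean_duration_def D_def field_simps)
qed

end

section \<open>The intensity process\<close>

text \<open>With \<open>D\<close> the partial sums of \<open>d\<close>, unrolling bounds
  \<open>u n - D n\<close> by the maximum of \<open>u 0\<close> and the numbers
  \<open>c - D k\<close> for \<open>k \<le> n\<close>. Up to a small slope \<open>- D k\<close> is
  close to \<open>- k * m\<close>, which grows in \<open>k\<close> as \<open>m < 0\<close>, so the
  worst index is \<open>n\<close>; adding \<open>D n\<close> back cancels the linear terms.\<close>

lemma reflected_walk_sublinear:
  fixes u d :: "nat \<Rightarrow> real"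
  assumes step: "\<And>n. u (Suc n) \<le> max c (u n + d n)" and nonneg: "\<And>n. 0 \<le> u n"
    and mean: "(\<lambda>n. (\<Sum>i<n. d i) / real n) \<longlonglongrightarrow> m" and m: "m < 0"
  shows "(\<lambda>n. u n / real n) \<longlonglongrightarrow> 0"
proof (rule LIMSEQ_I)
  fix r :: real assume r: "0 < r"
  \<comment> \<open>The final bound is \<open>B + 2 * \<delta> * n\<close>; a quarter lets the
    second term take half of \<open>r * n\<close> and leaves the other half for
    \<open>B\<close>.\<close>
  define \<delta> where "\<delta> = r / 4"
  have \<delta>: "0 < \<delta>" using r by (simp add: \<delta>_def)
  define D where "D n = (\<Sum>i<n. d i)" for n
  obtain N where N: "\<forall>n\<ge>N. norm (D n / real n - m) < \<delta>"
    using LIMSEQ_D[OF mean \<delta>] by (auto simp: D_def)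
  \<comment> \<open>Absorbs the finitely many indices before the averages are within
    \<open>\<delta>\<close> of \<open>m\<close>.\<close>
  define A where "A = (\<Sum>k\<le>N. \<bar>D k - real k * m\<bar>)"
  have A: "0 \<le> A" by (simp add: A_def sum_nonneg)
  have dev: "\<bar>D k - real k * m\<bar> \<le> \<delta> * real k + A" for k
  proof (cases "k \<le> N")
    case True
    then have "\<bar>D k - real k * m\<bar> \<le> A" unfolding A_def by (intro member_le_sum) auto
    then show ?thesis using \<delta> by (simp add: add_increasing)
  next
    case False
    then have k: "0 < real k" and "\<bar>D k / real k - m\<bar> < \<delta>" using N by auto
    moreover have "D k - real k * m = real k * (D k / real k - m)" using k by (simp add: field_simps)
    ultimately have "\<bar>D k - real k * m\<bar> \<le> real k * \<delta>" by (simp add: abs_mult)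
    then show ?thesis using A by (simp add: mult.commute)
  qed
  have bound: "u n - D n \<le> u 0 + \<bar>c\<bar> + A + real n * (\<delta> - m)" for n
  proof (induction n)
    case 0
    then show ?case using A by (simp add: D_def)
  next
    case (Suc n)
    have "u (Suc n) - D (Suc n) \<le> max (c - D (Suc n)) (u n - D n)"
      using step[of n] by (simp add: D_def max_def split: if_splits)
    moreover have "c - D (Suc n) \<le> u 0 + \<bar>c\<bar> + A + real (Suc n) * (\<delta> - m)"
    proof -
      have "real (Suc n) * (\<delta> - m) = \<delta> * real (Suc n) - real (Suc n) * m"
        by (simp add: algebra_simps)
      then show ?thesis using dev[of "Suc n"] nonneg[of 0] abs_ge_self[of c] by linarith
    qed
    moreover have "u n - D n \<le> u 0 + \<bar>c\<bar> + A + real (Suc n) * (\<delta> - m)"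
      using Suc \<delta> m by (simp add: distrib_right)
    ultimately show ?case by linarith
  qed
  define B where "B = u 0 + \<bar>c\<bar> + 2 * A"
  have ub: "u n \<le> B + 2 * \<delta> * real n" for n
    using bound[of n] dev[of n] by (simp add: B_def abs_le_iff algebra_simps)
  have B: "0 \<le> B" using nonneg[of 0] A by (simp add: B_def)
  obtain n0 :: nat where n0: "B / (r / 2) < real n0" using reals_Archimedean2 by blast
  have "norm (u n / real n - 0) < r" if n: "Suc n0 \<le> n" for n
  proof -
    have n': "0 < real n" "B / (r / 2) < real n" using n n0 by auto
    then have "B < real n * (r / 2)" using r by (simp add: pos_divide_less_eq)
    then have "u n < r * real n" using ub[of n] by (simp add: \<delta>_def algebra_simps)
    then show ?thesis using n' nonneg[of n] by (simp add: pos_divide_less_eq)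
  qed
  then show "\<exists>no. \<forall>n\<ge>no. norm (u n / real n - 0) < r" by blast
qed

section \<open>The Markov property\<close>

text \<open>Slot 0 of the family \<open>\<epsilon>(0 := \<Lambda> 0)\<close> holds the initial
  state, so one independence assumption covers the innovations among themselves and their
  independence of the start.\<close>

locale intensity_process = intensity_model +
  fixes \<epsilon> \<Lambda> :: "nat \<Rightarrow> 'a \<Rightarrow> real"
  assumes \<epsilon>_pos: "\<And>n \<omega>. \<omega> \<in> space M \<Longrightarrow> 0 < \<epsilon> (Suc n) \<omega>"
    and \<epsilon>_distr: "\<And>n. distr M borel (\<epsilon> (Suc n)) = distr M borel e"
    and init: "\<Lambda> 0 \<in> M \<rightarrow>\<^sub>M S"
    and indep: "indep_vars (\<lambda>_. borel) (\<epsilon>(0 := \<Lambda> 0)) UNIV"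
    and recursion: "\<And>n \<omega>. \<omega> \<in> space M \<Longrightarrow> \<Lambda> (Suc n) \<omega> = nxt (\<Lambda> n \<omega>) (\<epsilon> (Suc n) \<omega>)"
begin

lemma \<epsilon>_measurable[measurable]: "\<epsilon> (Suc n) \<in> borel_measurable M"
proof -
  have "(\<epsilon>(0 := \<Lambda> 0)) (Suc n) \<in> borel_measurable M" using indep by (auto simp only: indep_vars_def)
  then show ?thesis by simp
qed

lemma \<Lambda>_measurable[measurable]: "\<Lambda> n \<in> M \<rightarrow>\<^sub>M S"
proof (induction n)
  case (Suc n)
  have "(\<lambda>\<omega>. nxt (\<Lambda> n \<omega>) (\<epsilon> (Suc n) \<omega>)) \<in> M \<rightarrow>\<^sub>M S"
    using measurable_space[OF Suc] less_imp_le[OF \<epsilon>_pos]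
    by (intro measurable_nxt measurable_S_borel[OF Suc]) (auto simp: space_S)
  then show ?case by (rule measurable_cong[THEN iffD1, rotated]) (simp add: recursion)
qed (rule init)

lemma \<Lambda>_ge: "\<omega> \<in> space M \<Longrightarrow> \<mu> \<le> \<Lambda> n \<omega>"
  using measurable_space[OF \<Lambda>_measurable, of \<omega> n] by (simp add: space_S)

definition hist :: "nat \<Rightarrow> 'a \<Rightarrow> nat \<Rightarrow> real" where
  "hist n \<omega> = (\<lambda>k\<in>{..n}. \<Lambda> k \<omega>)"

lemma hist_measurable[measurable]: "hist n \<in> M \<rightarrow>\<^sub>M Pi\<^sub>M {..n} (\<lambda>_. S)"
  unfolding hist_def[abs_def] by measurable

text \<open>The truncations make \<open>flow\<close> measurable on the whole product space; they are inactive on actual paths.\<close>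
primrec flow :: "nat \<Rightarrow> (nat \<Rightarrow> real) \<Rightarrow> real" where
  "flow 0 y = max \<mu> (y 0)"
| "flow (Suc k) y = nxt (flow k y) (max 0 (y (Suc k)))"

lemma flow_ge: "\<mu> \<le> flow k y"
  by (induction k) (auto intro: less_imp_le nxt_gt)

lemma flow_measurable: "k \<le> n \<Longrightarrow> flow k \<in> Pi\<^sub>M {..n} (\<lambda>_. borel) \<rightarrow>\<^sub>M S"
proof (induction k)
  case 0
  have "(\<lambda>y. max \<mu> (y 0)) \<in> Pi\<^sub>M {..n} (\<lambda>_. borel) \<rightarrow>\<^sub>M S"
    unfolding state_space_def
    by (intro measurable_restrict_space2 borel_measurable_max measurable_component_singleton) auto
  then show ?case by simp
next
  case (Suc k)
  have c: "(\<lambda>y. y (Suc k)) \<in> borel_measurable (Pi\<^sub>M {..n} (\<lambda>_. borel))"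
    using Suc.prems by (intro measurable_component_singleton) auto
  have "(\<lambda>y. nxt (flow k y) (max 0 (y (Suc k)))) \<in> Pi\<^sub>M {..n} (\<lambda>_. borel) \<rightarrow>\<^sub>M S"
    using flow_ge Suc.prems
    by (intro measurable_nxt measurable_S_borel[OF Suc.IH] borel_measurable_max c) auto
  then show ?case by simp
qed

lemma flow_eq: "\<omega> \<in> space M \<Longrightarrow> k \<le> n \<Longrightarrow> flow k (\<lambda>i\<in>{..n}. (\<epsilon>(0 := \<Lambda> 0)) i \<omega>) = \<Lambda> k \<omega>"
  by (induction k) (auto simp: recursion max_absorb2 \<Lambda>_ge less_imp_le[OF \<epsilon>_pos])

text \<open>The history is a function of the slots up to \<open>n\<close>, and the next innovation
  is a function of slot \<open>n + 1\<close>; disjoint blocks of an independent family are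
  independent, and \<open>flow\<close> supplies the first function measurably.\<close>

lemma joint_hist:
  "distr M (Pi\<^sub>M {..n} (\<lambda>_. S) \<Otimes>\<^sub>M borel) (\<lambda>\<omega>. (hist n \<omega>, \<epsilon> (Suc n) \<omega>)) =
    distr M (Pi\<^sub>M {..n} (\<lambda>_. S)) (hist n) \<Otimes>\<^sub>M distr M borel e"
proof -
  let ?Y = "\<epsilon>(0 := \<Lambda> 0)"
  let ?U = "Pi\<^sub>M {..n} (\<lambda>_. borel :: real measure)" and ?W = "Pi\<^sub>M {Suc n} (\<lambda>_. borel :: real measure)"
  let ?X1 = "\<lambda>\<omega>. restrict (\<lambda>i. ?Y i \<omega>) {..n}" and ?X2 = "\<lambda>\<omega>. restrict (\<lambda>i. ?Y i \<omega>) {Suc n}"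
  let ?H = "Pi\<^sub>M {..n} (\<lambda>_. S)"
  let ?G = "\<lambda>y. \<lambda>k\<in>{..n}. flow k y" and ?E = "\<lambda>y :: nat \<Rightarrow> real. y (Suc n)"
  have "indep_var ?U ?X1 ?W ?X2" by (rule indep_var_restrict[OF indep]) auto
  then have X1[measurable]: "?X1 \<in> M \<rightarrow>\<^sub>M ?U" and X2[measurable]: "?X2 \<in> M \<rightarrow>\<^sub>M ?W"
    and prod: "distr M ?U ?X1 \<Otimes>\<^sub>M distr M ?W ?X2 = distr M (?U \<Otimes>\<^sub>M ?W) (\<lambda>\<omega>. (?X1 \<omega>, ?X2 \<omega>))"
    unfolding indep_var_distribution_eq by auto
  have G[measurable]: "?G \<in> ?U \<rightarrow>\<^sub>M ?H" by (intro measurable_restrict flow_measurable) simp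
  have E[measurable]: "?E \<in> ?W \<rightarrow>\<^sub>M borel" by (rule measurable_component_singleton) simp
  have G_eq: "?G (?X1 \<omega>) = hist n \<omega>" if "\<omega> \<in> space M" for \<omega>
    unfolding hist_def by (rule restrict_ext) (use flow_eq[OF that] in simp)
  have E_eq: "?E (?X2 \<omega>) = \<epsilon> (Suc n) \<omega>" for \<omega> by simp
  have 1: "distr M ?H (hist n) = distr (distr M ?U ?X1) ?H ?G"
    unfolding distr_distr[OF G X1] comp_def by (rule distr_cong[OF refl refl]) (simp only: G_eq)
  have 2: "distr M borel e = distr (distr M ?W ?X2) borel ?E"
    unfolding distr_distr[OF E X2] comp_def E_eq by (simp only: \<epsilon>_distr)
  have sf: "sigma_finite_measure (distr (distr M ?W ?X2) borel ?E)"
    unfolding 2[symmetric] by (intro prob_space_imp_sigma_finite prob_space_distr) simp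
  have "distr M ?H (hist n) \<Otimes>\<^sub>M distr M borel e =
      distr (distr M ?U ?X1 \<Otimes>\<^sub>M distr M ?W ?X2) (?H \<Otimes>\<^sub>M borel) (\<lambda>(x, y). (?G x, ?E y))"
    unfolding 1 2 by (rule pair_measure_distr[OF _ _ sf]) (simp_all add: G E)
  also have "\<dots> = distr M (?H \<Otimes>\<^sub>M borel) (\<lambda>\<omega>. (?G (?X1 \<omega>), ?E (?X2 \<omega>)))"
  proof -
    have "(\<lambda>(x, y). (?G x, ?E y)) \<in> ?U \<Otimes>\<^sub>M ?W \<rightarrow>\<^sub>M ?H \<Otimes>\<^sub>M borel"
      using G E by measurable
    moreover have "(\<lambda>\<omega>. (?X1 \<omega>, ?X2 \<omega>)) \<in> M \<rightarrow>\<^sub>M ?U \<Otimes>\<^sub>M ?W" using X1 X2 by (rule measurable_Pair)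
    ultimately show ?thesis unfolding prod by (subst distr_distr) (simp_all only: comp_def prod.case)
  qed
  also have "\<dots> = distr M (?H \<Otimes>\<^sub>M borel) (\<lambda>\<omega>. (hist n \<omega>, \<epsilon> (Suc n) \<omega>))"
    by (rule distr_cong[OF refl refl]) (simp only: G_eq E_eq)
  finally show ?thesis ..
qed

lemma measure_P_innovation:
  assumes "\<mu> \<le> x" "B \<in> sets S"
  shows "measure (P x) B = (\<integral>y. indicator B (nxt x (max y 0)) \<partial>distr M borel e)"
proof -
  have m: "(\<lambda>y. nxt x (max y 0)) \<in> borel \<rightarrow>\<^sub>M S" by (rule measurable_nxt_innovation[OF assms(1)])
  have iB: "(indicator B :: real \<Rightarrow> real) \<in> borel_measurable S" using assms by simp
  have xS: "x \<in> space S" using assms by (simp add: space_S)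
  have "measure (P x) B = (\<integral>z. indicator B z \<partial>P x)"
    using assms(2) prob_algebraD(3)[OF K_prob[OF xS]] sets.sets_into_space[OF assms(2)] by (simp add: Int_absorb2)
  also have "\<dots> = (\<integral>\<omega>. indicator B (nxt x (max (e \<omega>) 0)) \<partial>M)"
    unfolding integral_P[OF assms(1) iB]
    by (intro Bochner_Integration.integral_cong refl) (simp add: max_absorb1 less_imp_le[OF e_pos])
  also have "\<dots> = (\<integral>y. indicator B (nxt x (max y 0)) \<partial>distr M borel e)"
    by (rule integral_distr[symmetric]) (use measurable_compose[OF m iB] in simp_all)
  finally show ?thesis .
qed

text \<open>Fubini for the joint law: with the history frozen, integrating over the next innovation
  produces the kernel. The indicator of \<open>A\<close> is there to test against history events, as
  conditional expectation demands.\<close>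

lemma transition:
  assumes A[measurable]: "A \<in> sets (Pi\<^sub>M {..n} (\<lambda>_. S))" and B[measurable]: "B \<in> sets S"
  shows "(\<integral>\<omega>. indicator A (hist n \<omega>) * indicator B (\<Lambda> (Suc n) \<omega>) \<partial>M) =
    (\<integral>\<omega>. indicator A (hist n \<omega>) * measure (P (\<Lambda> n \<omega>)) B \<partial>M)"
proof -
  let ?H = "distr M (Pi\<^sub>M {..n} (\<lambda>_. S)) (hist n)"
  let ?L = "distr M borel e"
  interpret H: prob_space ?H by (rule prob_space_distr) measurable
  interpret L: prob_space ?L by (rule prob_space_distr) measurable
  interpret HL: pair_prob_space ?H ?L ..
  let ?f = "\<lambda>p. indicator A (fst p) * indicator B (nxt (fst p n) (max (snd p) 0)) :: real"
  have c: "(\<lambda>h. h n) \<in> Pi\<^sub>M {..n} (\<lambda>_. S) \<rightarrow>\<^sub>M S" by (rule measurable_component_singleton) simp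
  have nm[measurable]: "(\<lambda>p. nxt (fst p n) (max (snd p) 0)) \<in> Pi\<^sub>M {..n} (\<lambda>_. S) \<Otimes>\<^sub>M borel \<rightarrow>\<^sub>M S"
  proof (rule measurable_nxt)
    show "(\<lambda>p. fst p n) \<in> borel_measurable (Pi\<^sub>M {..n} (\<lambda>_. S) \<Otimes>\<^sub>M borel)"
      using measurable_S_borel[OF c] by measurable
  next
    fix p :: "(nat \<Rightarrow> real) \<times> real" assume "p \<in> space (Pi\<^sub>M {..n} (\<lambda>_. S) \<Otimes>\<^sub>M borel)"
    then show "\<mu> \<le> fst p n \<and> 0 \<le> max (snd p) 0"
      by (auto simp: space_pair_measure space_PiM space_S PiE_iff)
  qed measurable
  have f[measurable]: "?f \<in> borel_measurable (Pi\<^sub>M {..n} (\<lambda>_. S) \<Otimes>\<^sub>M borel)" by measurable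
  have joint: "distr M (Pi\<^sub>M {..n} (\<lambda>_. S) \<Otimes>\<^sub>M borel) (\<lambda>\<omega>. (hist n \<omega>, \<epsilon> (Suc n) \<omega>)) = ?H \<Otimes>\<^sub>M ?L"
    by (rule joint_hist)
  have "(\<integral>\<omega>. indicator A (hist n \<omega>) * indicator B (\<Lambda> (Suc n) \<omega>) \<partial>M) = (\<integral>\<omega>. ?f (hist n \<omega>, \<epsilon> (Suc n) \<omega>) \<partial>M)"
    by (intro Bochner_Integration.integral_cong refl)
       (simp add: recursion hist_def max_absorb1 less_imp_le[OF \<epsilon>_pos])
  also have "\<dots> = (\<integral>p. ?f p \<partial>(?H \<Otimes>\<^sub>M ?L))"
    unfolding joint[symmetric] by (rule integral_distr[symmetric]) measurable
  also have "\<dots> = (\<integral>h. (\<integral>y. ?f (h, y) \<partial>?L) \<partial>?H)"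
  proof (rule HL.integral_fst'[symmetric])
    have "?f \<in> borel_measurable (?H \<Otimes>\<^sub>M ?L)"
      using f by (simp add: measurable_cong_sets[OF sets_pair_measure_cong[OF sets_distr sets_distr] refl])
    then show "integrable (?H \<Otimes>\<^sub>M ?L) ?f"
      by (rule HL.integrable_const_bound[where B=1, rotated]) (auto split: split_indicator)
  qed
  also have "\<dots> = (\<integral>h. indicator A h * measure (P (h n)) B \<partial>?H)"
  proof (intro Bochner_Integration.integral_cong refl)
    fix h assume "h \<in> space ?H"
    then have "\<mu> \<le> h n" by (auto simp: space_PiM space_S PiE_iff)
    then show "(\<integral>y. ?f (h, y) \<partial>?L) = indicator A h * measure (P (h n)) B"
      using B by (simp add: measure_P_innovation)
  qed
  also have "\<dots> = (\<integral>\<omega>. indicator A (hist n \<omega>) * measure (P (hist n \<omega> n)) B \<partial>M)"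
    using measurable_compose[OF c kernel_measure_measurable[OF P_kernel B]]
    by (intro integral_distr hist_measurable borel_measurable_times borel_measurable_indicator A) auto
  finally show ?thesis by (simp add: hist_def)
qed

lemma law_prob: "distr M S (\<Lambda> n) \<in> space (prob_algebra S)"
  by (auto simp: space_prob_algebra intro: prob_space_distr)

text \<open>Events of the history are preimages under \<open>hist n\<close>, so the integrals that
  characterise the conditional expectation are instances of \<open>transition\<close>.\<close>

lemma chain: "markov_chain M S P \<Lambda>"
  unfolding markov_chain_def
proof (intro conjI allI ballI prob_space_axioms P_kernel \<Lambda>_measurable)
  fix n B assume B[measurable]: "B \<in> sets S"
  let ?F = "history M S \<Lambda> n"
  have F_eq: "?F = vimage_algebra (space M) (hist n) (Pi\<^sub>M {..n} (\<lambda>_. S))"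
    by (simp add: history_def hist_def[abs_def])
  have hs: "hist n \<in> space M \<rightarrow> space (Pi\<^sub>M {..n} (\<lambda>_. S))"
    using measurable_space[OF hist_measurable] by auto
  have sub: "subalgebra M ?F"
    unfolding subalgebra_def F_eq
    by (auto simp: sets_vimage_algebra2[OF hs] intro: measurable_sets[OF hist_measurable])
  interpret F: finite_measure_subalgebra M ?F by unfold_locales (rule sub)
  show "AE \<omega> in M. real_cond_exp M ?F (indicator (\<Lambda> (Suc n) -` B \<inter> space M)) \<omega> = measure (P (\<Lambda> n \<omega>)) B"
  proof (rule F.real_cond_exp_charact)
    have ev[measurable]: "\<Lambda> (Suc n) -` B \<inter> space M \<in> sets M" by (rule measurable_sets[OF \<Lambda>_measurable B])
    show "integrable M (indicator (\<Lambda> (Suc n) -` B \<inter> space M) :: 'a \<Rightarrow> real)"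
      by (rule integrable_real_indicator[OF ev]) (simp add: less_top[symmetric])
    show "integrable M (\<lambda>\<omega>. measure (P (\<Lambda> n \<omega>)) B)"
      by (rule integrable_distr[OF \<Lambda>_measurable kernel_measure_integrable[OF law_prob P_kernel B]])
    have "(\<lambda>h. h n) \<in> Pi\<^sub>M {..n} (\<lambda>_. S) \<rightarrow>\<^sub>M S" by (rule measurable_component_singleton) simp
    from measurable_compose[OF measurable_vimage_algebra1[OF hs] measurable_compose[OF this kernel_measure_measurable[OF P_kernel B]]]
    show "(\<lambda>\<omega>. measure (P (\<Lambda> n \<omega>)) B) \<in> borel_measurable ?F"
      unfolding F_eq by (simp add: hist_def)
    fix A assume "A \<in> sets ?F"
    then obtain A' where A': "A' \<in> sets (Pi\<^sub>M {..n} (\<lambda>_. S))" and A: "A = hist n -` A' \<inter> space M"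
      unfolding F_eq sets_vimage_algebra2[OF hs] by auto
    have "(\<integral>\<omega>\<in>A. (indicator (\<Lambda> (Suc n) -` B \<inter> space M) \<omega> :: real) \<partial>M) =
        (\<integral>\<omega>. indicator A' (hist n \<omega>) * indicator B (\<Lambda> (Suc n) \<omega>) \<partial>M)"
      unfolding set_lebesgue_integral_def
      by (intro Bochner_Integration.integral_cong refl) (auto simp: A split: split_indicator)
    also have "\<dots> = (\<integral>\<omega>. indicator A' (hist n \<omega>) * measure (P (\<Lambda> n \<omega>)) B \<partial>M)"
      by (rule transition[OF A' B])
    also have "\<dots> = (\<integral>\<omega>\<in>A. measure (P (\<Lambda> n \<omega>)) B \<partial>M)"
      unfolding set_lebesgue_integral_def
      by (intro Bochner_Integration.integral_cong refl) (auto simp: A split: split_indicator)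
    finally show "(\<integral>\<omega>\<in>A. (indicator (\<Lambda> (Suc n) -` B \<inter> space M) \<omega> :: real) \<partial>M) = (\<integral>\<omega>\<in>A. measure (P (\<Lambda> n \<omega>)) B \<partial>M)" .
  qed
qed

lemma law_step: "distr M S (\<Lambda> (Suc n)) = distr M S (\<Lambda> n) \<bind> P"
proof (rule prob_algebra_eqI[OF law_prob prob_algebra_bind[OF law_prob P_kernel]])
  fix B assume B: "B \<in> sets S"
  have "measure (distr M S (\<Lambda> (Suc n))) B = (\<integral>z. indicator B z \<partial>distr M S (\<Lambda> (Suc n)))"
    using B sets.sets_into_space[OF B] by (simp add: Int_absorb2)
  also have "\<dots> = (\<integral>\<omega>. indicator B (\<Lambda> (Suc n) \<omega>) \<partial>M)"
    using B by (intro integral_distr \<Lambda>_measurable) simp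
  also have "\<dots> = (\<integral>\<omega>. indicator (space (Pi\<^sub>M {..n} (\<lambda>_. S))) (hist n \<omega>) * indicator B (\<Lambda> (Suc n) \<omega>) \<partial>M)"
    using measurable_space[OF hist_measurable] by (intro Bochner_Integration.integral_cong refl) simp
  also have "\<dots> = (\<integral>\<omega>. indicator (space (Pi\<^sub>M {..n} (\<lambda>_. S))) (hist n \<omega>) * measure (P (\<Lambda> n \<omega>)) B \<partial>M)"
    by (rule transition[OF sets.top B])
  also have "\<dots> = (\<integral>\<omega>. measure (P (\<Lambda> n \<omega>)) B \<partial>M)"
    using measurable_space[OF hist_measurable] by (intro Bochner_Integration.integral_cong refl) simp
  also have "\<dots> = (\<integral>x. measure (P x) B \<partial>distr M S (\<Lambda> n))"
    by (rule integral_distr[symmetric, OF \<Lambda>_measurable kernel_measure_measurable[OF P_kernel B]])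
  also have "\<dots> = measure (distr M S (\<Lambda> n) \<bind> P) B"
    by (rule prob_algebra_measure_bind[OF law_prob P_kernel B, symmetric])
  finally show "measure (distr M S (\<Lambda> (Suc n))) B = measure (distr M S (\<Lambda> n) \<bind> P) B" .
qed

lemma law_eq: "distr M S (\<Lambda> n) = distr M S (\<Lambda> 0) \<bind> nstep S P n"
proof (induction n)
  case 0
  show ?case by (simp add: bind_return'')
next
  case (Suc n)
  show ?case unfolding law_step bind_nstep_Suc[OF law_prob] Suc[symmetric] ..
qed

section \<open>Averages and means of durations\<close>

lemma innovation_average:
  fixes \<phi> :: "real \<Rightarrow> real"
  assumes \<phi>[measurable]: "\<phi> \<in> borel_measurable borel" and int: "integrable M (\<lambda>\<omega>. \<phi> (e \<omega>))"
  shows "AE \<omega> in M. (\<lambda>n. (\<Sum>i<n. \<phi> (\<epsilon> (Suc i) \<omega>)) / real n) \<longlonglongrightarrow> expectation (\<lambda>\<omega>. \<phi> (e \<omega>))"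
proof -
  have push: "distr M borel (\<lambda>\<omega>. \<phi> (\<epsilon> (Suc i) \<omega>)) = distr M borel (\<lambda>\<omega>. \<phi> (e \<omega>))" for i
  proof -
    have "distr M borel (\<lambda>\<omega>. \<phi> (\<epsilon> (Suc i) \<omega>)) = distr (distr M borel (\<epsilon> (Suc i))) borel \<phi>"
      by (subst distr_distr) (auto simp: comp_def)
    also have "\<dots> = distr M borel (\<lambda>\<omega>. \<phi> (e \<omega>))"
      unfolding \<epsilon>_distr by (subst distr_distr) (auto simp: comp_def)
    finally show ?thesis .
  qed
  \<comment> \<open>One-element blocks drop the initial state in slot 0 and reindex the innovations
    from 0.\<close>
  have "indep_vars (\<lambda>i. Pi\<^sub>M {Suc i} (\<lambda>_. borel)) (\<lambda>i \<omega>. restrict (\<lambda>j. (\<epsilon>(0 := \<Lambda> 0)) j \<omega>) {Suc i}) UNIV"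
    by (rule indep_vars_restrict[OF indep]) (auto simp: disjoint_family_on_def)
  moreover have "(\<lambda>y. \<phi> (y (Suc i))) \<in> borel_measurable (Pi\<^sub>M {Suc i} (\<lambda>_. borel))" for i
    by (rule measurable_compose[OF _ \<phi>]) simp
  ultimately have "indep_vars (\<lambda>_. borel) (\<lambda>i \<omega>. \<phi> (restrict (\<lambda>j. (\<epsilon>(0 := \<Lambda> 0)) j \<omega>) {Suc i} (Suc i))) UNIV"
    by (rule indep_vars_compose2[where Y="\<lambda>i y. \<phi> (y (Suc i))"])
  then have "indep_vars (\<lambda>_. borel) (\<lambda>i \<omega>. \<phi> (\<epsilon> (Suc i) \<omega>)) UNIV" by simp
  moreover have "integrable M (\<lambda>\<omega>. \<phi> (\<epsilon> (Suc 0) \<omega>))"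
    "expectation (\<lambda>\<omega>. \<phi> (\<epsilon> (Suc 0) \<omega>)) = expectation (\<lambda>\<omega>. \<phi> (e \<omega>))"
  proof -
    have "integrable (distr M borel (\<lambda>\<omega>. \<phi> (e \<omega>))) (\<lambda>x. x)" using int by (simp add: integrable_distr_eq)
    then show "integrable M (\<lambda>\<omega>. \<phi> (\<epsilon> (Suc 0) \<omega>))"
      unfolding push[of 0, symmetric] by (simp add: integrable_distr_eq)
    have "(\<integral>x. x \<partial>distr M borel (\<lambda>\<omega>. \<phi> (\<epsilon> (Suc 0) \<omega>))) = (\<integral>x. x \<partial>distr M borel (\<lambda>\<omega>. \<phi> (e \<omega>)))"
      by (simp only: push)
    then show "expectation (\<lambda>\<omega>. \<phi> (\<epsilon> (Suc 0) \<omega>)) = expectation (\<lambda>\<omega>. \<phi> (e \<omega>))"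
      by (simp add: integral_distr)
  qed
  moreover have "distr M borel (\<lambda>\<omega>. \<phi> (\<epsilon> (Suc i) \<omega>)) = distr M borel (\<lambda>\<omega>. \<phi> (\<epsilon> (Suc 0) \<omega>))" for i
    by (simp only: push)
  ultimately show ?thesis
    using strong_law_of_large_numbers[of "\<lambda>i \<omega>. \<phi> (\<epsilon> (Suc i) \<omega>)"] by simp
qed

lemma duration_sum:
  assumes \<omega>: "\<omega> \<in> space M"
  shows "\<beta> * \<mu> * (\<Sum>i<n. T (\<Lambda> i \<omega>) (\<epsilon> (Suc i) \<omega>)) =
    \<Lambda> n \<omega> - \<Lambda> 0 \<omega> - real n * \<alpha> + \<beta> * (\<Sum>i<n. \<epsilon> (Suc i) \<omega>)"
proof (induction n)
  case (Suc n)
  have "\<Lambda> (Suc n) \<omega> = \<Lambda> n \<omega> + \<alpha> - \<beta> * \<epsilon> (Suc n) \<omega> + \<beta> * \<mu> * T (\<Lambda> n \<omega>) (\<epsilon> (Suc n) \<omega>)"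
    using nxt_eq[OF \<Lambda>_ge[OF \<omega>] less_imp_le[OF \<epsilon>_pos[OF \<omega>]]] recursion[OF \<omega>] by simp
  with Suc show ?case by (simp add: distrib_left distrib_right)
qed simp

text \<open>By \<open>duration_sum\<close> and the strong law for the innovations it remains to see
  that \<open>\<Lambda> n / n\<close> tends to 0. Above \<open>\<mu> + N\<close> the increments are
  bounded by independent variables of negative mean, so \<open>reflected_walk_sublinear\<close>
  applies on almost every path, whatever the initial law.\<close>

lemma duration_average:
  "AE \<omega> in M. (\<lambda>n. (\<Sum>i<n. T (\<Lambda> i \<omega>) (\<epsilon> (Suc i) \<omega>)) / real n) \<longlonglongrightarrow> (\<beta> * \<mu>e - \<alpha>) / (\<beta> * \<mu>)"
proof -
  obtain N where N: "expectation (\<lambda>\<omega>. excess N (e \<omega>)) < 0" by (rule excess_mean_negative)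
  have "AE \<omega> in M. (\<lambda>n. (\<Sum>i<n. excess N (\<epsilon> (Suc i) \<omega>)) / real n) \<longlonglongrightarrow> expectation (\<lambda>\<omega>. excess N (e \<omega>))"
    by (rule innovation_average[OF excess_measurable integrable_excess])
  moreover have "AE \<omega> in M. (\<lambda>n. (\<Sum>i<n. \<epsilon> (Suc i) \<omega>) / real n) \<longlonglongrightarrow> \<mu>e"
    using innovation_average[of "\<lambda>x. x"] integrable_e by simp
  ultimately show ?thesis
    using AE_space
  proof eventually_elim
    case (elim \<omega>)
    note \<omega> = elim(3)
    have "(\<lambda>n. (\<Lambda> n \<omega> - \<mu>) / real n) \<longlonglongrightarrow> 0"
    proof (rule reflected_walk_sublinear[OF _ _ elim(1) N])
      fix n
      show "0 \<le> \<Lambda> n \<omega> - \<mu>" using \<Lambda>_ge[OF \<omega>] by simp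
      \<comment> \<open>From below \<open>\<mu> + N\<close> a step ends at most
        \<open>\<alpha>\<close> above that level, whence the constant of the reflection.\<close>
      show "\<Lambda> (Suc n) \<omega> - \<mu> \<le> max (real N + \<alpha>) (\<Lambda> n \<omega> - \<mu> + excess N (\<epsilon> (Suc n) \<omega>))"
      proof (cases "\<mu> + real N \<le> \<Lambda> n \<omega>")
        case True
        have "\<Lambda> (Suc n) \<omega> \<le> \<Lambda> n \<omega> + excess N (\<epsilon> (Suc n) \<omega>)"
          unfolding recursion[OF \<omega>] by (rule nxt_le_excess[OF True less_imp_le[OF \<epsilon>_pos[OF \<omega>]]])
        then show ?thesis by simp
      next
        case False
        have "\<Lambda> (Suc n) \<omega> \<le> \<Lambda> n \<omega> + \<alpha>"
          unfolding recursion[OF \<omega>] by (rule nxt_le[OF \<Lambda>_ge[OF \<omega>] less_imp_le[OF \<epsilon>_pos[OF \<omega>]]])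
        then show ?thesis using False by simp
      qed
    qed
    moreover have "(\<lambda>n. (\<mu> - \<Lambda> 0 \<omega>) / real n) \<longlonglongrightarrow> 0" by (rule lim_const_over_n)
    ultimately have lim: "(\<lambda>n. ((\<Lambda> n \<omega> - \<mu>) / real n + (\<mu> - \<Lambda> 0 \<omega>) / real n - \<alpha> + \<beta> * ((\<Sum>i<n. \<epsilon> (Suc i) \<omega>) / real n)) / (\<beta> * \<mu>))
      \<longlonglongrightarrow> (0 + 0 - \<alpha> + \<beta> * \<mu>e) / (\<beta> * \<mu>)"
      using elim(2) \<beta> \<mu> by (intro tendsto_intros) auto
    have avg: "((\<Lambda> n \<omega> - \<mu>) / real n + (\<mu> - \<Lambda> 0 \<omega>) / real n - \<alpha> + \<beta> * ((\<Sum>i<n. \<epsilon> (Suc i) \<omega>) / real n)) / (\<beta> * \<mu>) =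
        (\<Sum>i<n. T (\<Lambda> i \<omega>) (\<epsilon> (Suc i) \<omega>)) / real n" if n: "0 < n" for n
    proof -
      have "(\<Lambda> n \<omega> - \<mu>) / real n + (\<mu> - \<Lambda> 0 \<omega>) / real n - \<alpha> + \<beta> * ((\<Sum>i<n. \<epsilon> (Suc i) \<omega>) / real n) =
          (\<Lambda> n \<omega> - \<Lambda> 0 \<omega> - real n * \<alpha> + \<beta> * (\<Sum>i<n. \<epsilon> (Suc i) \<omega>)) / real n"
        using n by (simp add: field_simps)
      also have "\<dots> = \<beta> * \<mu> * (\<Sum>i<n. T (\<Lambda> i \<omega>) (\<epsilon> (Suc i) \<omega>)) / real n"
        by (simp only: duration_sum[OF \<omega>])
      finally show ?thesis using \<beta> \<mu> by simp
    qed
    have "\<forall>\<^sub>F n in sequentially. ((\<Lambda> n \<omega> - \<mu>) / real n + (\<mu> - \<Lambda> 0 \<omega>) / real n - \<alpha> + \<beta> * ((\<Sum>i<n. \<epsilon> (Suc i) \<omega>) / real n)) / (\<beta> * \<mu>) =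
        (\<Sum>i<n. T (\<Lambda> i \<omega>) (\<epsilon> (Suc i) \<omega>)) / real n"
      by (rule eventually_mono[OF eventually_gt_at_top[of 0]]) (rule avg)
    from Lim_transform_eventually[OF lim this] show ?case by (simp add: algebra_simps)
  qed
qed

text \<open>By \<open>nxt_eq\<close> a duration is a linear combination of two successive states and
  an innovation. Under stationarity the states have the same finite mean, which cancels.\<close>

lemma stationary_duration:
  assumes st: "stationary S P \<pi>" and int: "integrable \<pi> (\<lambda>x. x)" and start: "distr M S (\<Lambda> 0) = \<pi>"
  shows "integrable M (\<lambda>\<omega>. T (\<Lambda> n \<omega>) (\<epsilon> (Suc n) \<omega>))"
    and "expectation (\<lambda>\<omega>. T (\<Lambda> n \<omega>) (\<epsilon> (Suc n) \<omega>)) = (\<beta> * \<mu>e - \<alpha>) / (\<beta> * \<mu>)"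
proof -
  have law: "distr M S (\<Lambda> n) = \<pi>" for n
    unfolding law_eq[of n] start by (rule stationary_bind_nstep[OF st])
  have id: "(\<lambda>x. x) \<in> borel_measurable S" by (rule measurable_S_borel) simp
  have i\<Lambda>: "integrable M (\<Lambda> n)" for n
    using integrable_distr[OF \<Lambda>_measurable, of n "\<lambda>x. x"] int by (simp add: law)
  have e\<Lambda>: "expectation (\<Lambda> n) = (\<integral>x. x \<partial>\<pi>)" for n
    using integral_distr[OF \<Lambda>_measurable id, of n] by (simp add: law)
  have i\<epsilon>: "integrable M (\<epsilon> (Suc n))"
  proof -
    have "integrable (distr M borel (\<epsilon> (Suc n))) (\<lambda>x. x)"
      unfolding \<epsilon>_distr using integrable_e by (simp add: integrable_distr_eq)
    from integrable_distr[OF \<epsilon>_measurable this] show ?thesis .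
  qed
  have e\<epsilon>: "expectation (\<epsilon> (Suc n)) = \<mu>e"
  proof -
    have "expectation (\<epsilon> (Suc n)) = (\<integral>x. x \<partial>distr M borel (\<epsilon> (Suc n)))"
      by (rule integral_distr[symmetric]) simp_all
    also have "\<dots> = \<mu>e" unfolding \<epsilon>_distr by (rule integral_distr) simp_all
    finally show ?thesis .
  qed
  let ?R = "\<lambda>\<omega>. (\<Lambda> (Suc n) \<omega> - \<Lambda> n \<omega> - \<alpha> + \<beta> * \<epsilon> (Suc n) \<omega>) / (\<beta> * \<mu>)"
  have eq: "T (\<Lambda> n \<omega>) (\<epsilon> (Suc n) \<omega>) = ?R \<omega>" if \<omega>: "\<omega> \<in> space M" for \<omega>
    using nxt_eq[OF \<Lambda>_ge[OF \<omega>] less_imp_le[OF \<epsilon>_pos[OF \<omega>]], of n n] recursion[OF \<omega>, of n] \<beta> \<mu> by simp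
  show "integrable M (\<lambda>\<omega>. T (\<Lambda> n \<omega>) (\<epsilon> (Suc n) \<omega>))"
    by (subst Bochner_Integration.integrable_cong[OF refl eq]) (use i\<Lambda> i\<epsilon> in auto)
  have "expectation (\<lambda>\<omega>. T (\<Lambda> n \<omega>) (\<epsilon> (Suc n) \<omega>)) = expectation ?R"
    by (rule Bochner_Integration.integral_cong[OF refl eq])
  also have "\<dots> = (\<beta> * \<mu>e - \<alpha>) / (\<beta> * \<mu>)"
    using i\<Lambda> i\<epsilon> by (simp add: e\<Lambda> e\<epsilon> prob_space)
  finally show "expectation (\<lambda>\<omega>. T (\<Lambda> n \<omega>) (\<epsilon> (Suc n) \<omega>)) = (\<beta> * \<mu>e - \<alpha>) / (\<beta> * \<mu>)" .
qed

end

theorem theorem2: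
  fixes \<mu> \<alpha> \<beta> \<mu>\<^sub>\<epsilon> :: real
    and M :: "'a measure"
    and \<epsilon> \<Lambda> \<tau> :: "nat \<Rightarrow> 'a \<Rightarrow> real"
    and f :: "real \<Rightarrow> real"
    and S :: "real measure"
    and P :: "real \<Rightarrow> real measure"
  assumes "\<mu> > 0" and "\<alpha> > 0" and "\<beta> > 0"
    and "prob_space M"
    and "\<And>n \<omega>. n \<ge> 1 \<Longrightarrow> \<omega> \<in> space M \<Longrightarrow> \<epsilon> n \<omega> > 0"
    and "\<And>n. n \<ge> 1 \<Longrightarrow>
           distributed M lborel (\<epsilon> n) (\<lambda>y. ennreal (f y * indicator {0<..} y))"
    and "\<And>y. y > 0 \<Longrightarrow> f y > 0"
    and "integrable M (\<epsilon> 1)" and "\<mu>\<^sub>\<epsilon> = integral\<^sup>L M (\<epsilon> 1)"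
    and "S = state_space \<mu>"
    and "\<Lambda> 0 \<in> M \<rightarrow>\<^sub>M S"
    and "prob_space.indep_vars M (\<lambda>_. borel) (\<epsilon>(0 := \<Lambda> 0)) UNIV"
    and "\<And>n \<omega>. n \<ge> 1 \<Longrightarrow> \<omega> \<in> space M \<Longrightarrow>
           \<tau> n \<omega> = Phi_inv \<mu> \<alpha> \<beta> (\<epsilon> n \<omega>) (\<Lambda> (n - 1) \<omega>)"
    and "\<And>n \<omega>. n \<ge> 1 \<Longrightarrow> \<omega> \<in> space M \<Longrightarrow>
           \<Lambda> n \<omega> = \<mu> + (\<Lambda> (n - 1) \<omega> - \<mu> + \<alpha>) * exp (- \<beta> * \<tau> n \<omega>)"
    and "P = intensity_kernel \<mu> \<alpha> \<beta> M (\<epsilon> 1)"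
    and "\<alpha> < \<beta> * \<mu>\<^sub>\<epsilon>"
  shows "markov_chain M S P \<Lambda> \<and>
    lebesgue_irreducible S P \<and> aperiodic S P \<and> positive_harris_recurrent S P \<and>
    (\<exists>\<pi>. stationary S P \<pi> \<and> (\<forall>\<pi>'. stationary S P \<pi>' \<longrightarrow> \<pi>' = \<pi>) \<and>
      ergodic S P \<pi> \<and>
      (\<lambda>n. tv_dist S (distr M S (\<Lambda> n)) \<pi>) \<longlonglongrightarrow> 0 \<and>
      (AE \<omega> in M. (\<lambda>N. (\<Sum>n=1..N. \<tau> n \<omega>) / real N) \<longlonglongrightarrow> mean_duration \<mu> \<alpha> \<beta> M (\<epsilon> 1) \<pi>) \<and>
      mean_duration \<mu> \<alpha> \<beta> M (\<epsilon> 1) \<pi> = (\<beta> * \<mu>\<^sub>\<epsilon> - \<alpha>) / (\<beta> * \<mu>) \<and>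
      (distr M S (\<Lambda> 0) = \<pi> \<longrightarrow>
        (\<forall>n\<ge>1. integrable M (\<tau> n) \<and>
          integral\<^sup>L M (\<tau> n) = (\<beta> * \<mu>\<^sub>\<epsilon> - \<alpha>) / (\<beta> * \<mu>))))"
proof -
  \<comment> \<open>The indicator makes the density vanish off the positive half-line, where
    \<open>f\<close> itself is unconstrained.\<close>
  let ?g = "\<lambda>y. f y * indicator {0<..} y"
  interpret M: prob_space M by fact
  interpret intensity_model \<mu> \<alpha> \<beta> M "\<epsilon> 1" ?g
  proof (unfold_locales)
    show "distributed M lborel (\<epsilon> 1) (\<lambda>y. ennreal (?g y))" by (rule assms(6)) simp
    show "0 \<le> ?g y" for y using assms(7)[of y] by (auto split: split_indicator)
    show "\<alpha> < \<beta> * integral\<^sup>L M (\<epsilon> 1)" using assms(9,16) by simp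
  qed (use assms in auto)
  interpret intensity_process \<mu> \<alpha> \<beta> M "\<epsilon> 1" ?g \<epsilon> \<Lambda>
  proof (unfold_locales)
    show "distr M borel (\<epsilon> (Suc n)) = distr M borel (\<epsilon> 1)" for n
    proof -
      have "distr M lborel (\<epsilon> k) = density lborel (\<lambda>y. ennreal (?g y))" if "k \<ge> 1" for k
        by (rule distributed_distr_eq_density[OF assms(6)[OF that]])
      then have "distr M lborel (\<epsilon> (Suc n)) = distr M lborel (\<epsilon> 1)" by simp
      then show ?thesis by (simp cong: distr_cong)
    qed
    show "\<Lambda> (Suc n) \<omega> = nxt (\<Lambda> n \<omega>) (\<epsilon> (Suc n) \<omega>)" if "\<omega> \<in> space M" for n \<omega>
      using assms(13,14)[of "Suc n" \<omega>] that by (simp add: nxt_def)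
  qed (use assms in auto)
  have S: "S = state_space \<mu>" and P: "P = intensity_kernel \<mu> \<alpha> \<beta> M (\<epsilon> 1)" by fact+
  obtain \<pi> where st: "stationary S P \<pi>" and erg: "ergodic S P \<pi>" and int: "integrable \<pi> (\<lambda>x. x)"
    and uniq: "\<And>\<pi>'. stationary S P \<pi>' \<Longrightarrow> \<pi>' = \<pi>"
    unfolding S P by (rule stationary_unique_ergodic) blast
  have \<tau>: "\<tau> (Suc n) \<omega> = Phi_inv \<mu> \<alpha> \<beta> (\<epsilon> (Suc n) \<omega>) (\<Lambda> n \<omega>)" if "\<omega> \<in> space M" for n \<omega>
    using assms(13)[of "Suc n" \<omega>] that by simp
  have mean: "mean_duration \<mu> \<alpha> \<beta> M (\<epsilon> 1) \<pi> = (\<beta> * \<mu>\<^sub>\<epsilon> - \<alpha>) / (\<beta> * \<mu>)"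
    using mean_duration_stationary[OF st[unfolded S P] int] assms(9) by simp
  have average: "AE \<omega> in M. (\<lambda>N. (\<Sum>n=1..N. \<tau> n \<omega>) / real N) \<longlonglongrightarrow> mean_duration \<mu> \<alpha> \<beta> M (\<epsilon> 1) \<pi>"
    using duration_average AE_space
  proof eventually_elim
    case (elim \<omega>)
    have "(\<Sum>n=1..N. \<tau> n \<omega>) = (\<Sum>i<N. Phi_inv \<mu> \<alpha> \<beta> (\<epsilon> (Suc i) \<omega>) (\<Lambda> i \<omega>))" for N
      by (simp add: sum.atLeast1_atMost_eq \<tau>[OF elim(2)])
    with elim(1) show ?case unfolding mean assms(9) by simp
  qed
  have tv: "(\<lambda>n. tv_dist S (distr M S (\<Lambda> n)) \<pi>) \<longlonglongrightarrow> 0"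
  proof -
    have "(\<lambda>n. tv_dist S (distr M S (\<Lambda> 0) \<bind> nstep S P n) \<pi>) \<longlonglongrightarrow> 0"
      using erg law_prob[of 0] unfolding ergodic_def S P by blast
    then show ?thesis unfolding S P law_eq[symmetric] .
  qed
  have durations: "integrable M (\<tau> n) \<and> integral\<^sup>L M (\<tau> n) = (\<beta> * \<mu>\<^sub>\<epsilon> - \<alpha>) / (\<beta> * \<mu>)"
    if start: "distr M S (\<Lambda> 0) = \<pi>" and n: "n \<ge> 1" for n
  proof -
    obtain k where k: "n = Suc k" using n by (cases n) auto
    note sd = stationary_duration[OF st[unfolded S P] int start[unfolded S], of k]
    have "integrable M (\<tau> n) \<longleftrightarrow> integrable M (\<lambda>\<omega>. Phi_inv \<mu> \<alpha> \<beta> (\<epsilon> (Suc k) \<omega>) (\<Lambda> k \<omega>))"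
      unfolding k by (rule Bochner_Integration.integrable_cong[OF refl \<tau>])
    moreover have "integral\<^sup>L M (\<tau> n) = integral\<^sup>L M (\<lambda>\<omega>. Phi_inv \<mu> \<alpha> \<beta> (\<epsilon> (Suc k) \<omega>) (\<Lambda> k \<omega>))"
      unfolding k by (rule Bochner_Integration.integral_cong[OF refl \<tau>])
    ultimately show ?thesis using sd assms(9) by simp
  qed
  show ?thesis
    using chain irreducible aperiodic_P positive_harris_P st erg uniq tv average mean durations
    unfolding S P by blast
qed

end
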